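(* Let $h\in\mathcal Z_+'$ be real and suppose that $\langle h,\bar f\star f\rangle\ge0$ for all $f\in\mathcal D$. Then $h(t)$ admits the representation $$h(t)=\int_0^\infty e^{-t\lambda}\,dm(\lambda),\qquad t>0,$$ with a positive measure $dm(\lambda)$ on $\mathbb R_+=(0,\infty)$ satisfying, for some $\varkappa$, the condition $$\int_0^\infty(1+|\ln\lambda|)^{-\varkappa}\lambda^{-1}\,dm(\lambda)<\infty.$$
   Context: Notation: $\mathbb R_+=(0,\infty)$. For a topological vector space $\mathcal L$, $\mathcal L'$ is the space of continuous antilinear functionals; brackets $\langle\cdot,\cdot\rangle$ are linear in the first and antilinear in the second argument. $\mathcal Z$ is the set of Schwartz functions $\varphi$ on $\mathbb R$ that extend to entire functions with $|\varphi(z)|\le C_n(1+|z|)^{-n}e^{r|\operatorname{Im}z|}$ for all $n$ and some $r=r(\varphi)>0$ (equivalently, $\mathcal Z$ is the image of $C_0^\infty(\mathbb R)$ under the Fourier transform, with the corresponding topology). $\mathcal Z_+$ is the set of functions $F$ on $\mathbb R_+$ such that $x\mapsto F(e^x)$ belongs to $\mathcal Z$ (with the transferred topology), and $\mathcal Z_+'$ is its dual. The distribution $h$ is real if $\langle h,\bar F\rangle=\overline{\langle h,F\rangle}$ for all $F\in\mathcal Z_+$. An identity between $h\in\mathcal Z_+'$ and a function $h(t)$ means $\langle h,F\rangle=\int_0^\infty h(t)\overline{F(t)}dt$ for all $F\in\mathcal Z_+$. $\mathcal D$ is the set of functions $f$ on $\mathbb R_+$ such that $e^{x/2}f(e^x)$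 belongs to $\mathcal Z$ as a function of $x\in\mathbb R$. The Laplace convolution is $(\bar f_1\star f_2)(t)=\int_0^t\overline{f_1(s)}f_2(t-s)ds$; for $f_1,f_2\in\mathcal D$ it belongs to $\mathcal Z_+$. *)

theory Defs
  imports "HOL-Analysis.Analysis"
begin

section \<open>Test functions\<close>

definition nth_deriv :: "nat \<Rightarrow> (real \<Rightarrow> complex) \<Rightarrow> real \<Rightarrow> complex" where
  "nth_deriv k u = ((\<lambda>v x. vector_derivative v (at x)) ^^ k) u"

definition smooth :: "(real \<Rightarrow> complex) \<Rightarrow> bool" where
  "smooth u \<longleftrightarrow> (\<forall>k x. nth_deriv k u differentiable (at x))"

definition test_funs_in :: "real set \<Rightarrow> (real \<Rightarrow> complex) set" where
  "test_funs_in K = {u. smooth u \<and> closure {x. u x \<noteq> 0} \<subseteq> K}"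

definition test_funs :: "(real \<Rightarrow> complex) set" where
  "test_funs = (\<Union>K\<in>{K. compact K}. test_funs_in K)"

definition seminorm_on :: "(real \<Rightarrow> complex) set \<Rightarrow> ((real \<Rightarrow> complex) \<Rightarrow> real) \<Rightarrow> bool" where
  "seminorm_on V p \<longleftrightarrow>
     (\<forall>u\<in>V. \<forall>v\<in>V. p (\<lambda>x. u x + v x) \<le> p u + p v) \<and>
     (\<forall>c. \<forall>u\<in>V. p (\<lambda>x. c * u x) = norm c * p u)"

text \<open>The usual inductive limit topology on the test functions is the finest locally convex
  topology for which all inclusions of the Frechet spaces \<open>test_funs_in K\<close>, \<open>K\<close> compact,
  are continuous. Its continuous seminorms are those whose restriction to each
  \<open>test_funs_in K\<close> is dominated by finitely many of the norms \<open>u \<mapsto> sup |u\<^sup>(\<^sup>k\<^sup>)|\<close>.\<close>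

definition test_seminorm :: "((real \<Rightarrow> complex) \<Rightarrow> real) \<Rightarrow> bool" where
  "test_seminorm p \<longleftrightarrow> seminorm_on test_funs p \<and>
     (\<forall>K. compact K \<longrightarrow>
        (\<exists>C N. \<forall>u\<in>test_funs_in K. p u \<le> C * (\<Sum>k\<le>N. SUP x. norm (nth_deriv k u x))))"

definition test_topology :: "(real \<Rightarrow> complex) topology" where
  "test_topology = topology_generated_by
     {{v \<in> test_funs. p (\<lambda>x. v x - u x) < r} | p u r. test_seminorm p \<and> u \<in> test_funs \<and> 0 < r}"

section \<open>The space \<open>\<Z>\<close> and its topology\<close>

definition schwartz :: "(real \<Rightarrow> complex) \<Rightarrow> bool" where
  "schwartz \<phi> \<longleftrightarrow> smooth \<phi> \<and>
     (\<forall>j k. \<exists>C. \<forall>x. \<bar>x\<bar> ^ j * norm (nth_deriv k \<phi> x) \<le> C)"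

definition Z :: "(real \<Rightarrow> complex) set" where
  "Z = {\<phi>. schwartz \<phi> \<and>
     (\<exists>g r. g holomorphic_on UNIV \<and> (\<forall>x. g (complex_of_real x) = \<phi> x) \<and> 0 < r \<and>
        (\<forall>n::nat. \<exists>C. \<forall>z. norm (g z) \<le> C * (1 + norm z) powi (- int n) * exp (r * \<bar>Im z\<bar>)))}"

definition fourier :: "(real \<Rightarrow> complex) \<Rightarrow> real \<Rightarrow> complex" where
  "fourier u \<xi> = complex_of_real (1 / sqrt (2 * pi)) * (LINT x|lborel. exp (- \<i> * of_real (x * \<xi>)) * u x)"

text \<open>Since \<open>fourier\<close> is a bijection of \<open>test_funs\<close> onto \<open>Z\<close> (Paley-Wiener), the topology of
  \<open>Z\<close> transferred along it has as open sets those whose preimages are open. Neither the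
  normalisation nor the sign in the exponent affects the result.\<close>

definition Z_topology :: "(real \<Rightarrow> complex) topology" where
  "Z_topology = topology (\<lambda>V. V \<subseteq> Z \<and> openin test_topology {u \<in> test_funs. fourier u \<in> V})"

lemma topspace_test_topology: "topspace test_topology = test_funs"
proof
  show "topspace test_topology \<subseteq> test_funs"
    unfolding test_topology_def topology_generated_by_topspace by blast
next
  have z: "test_seminorm (\<lambda>u. 0)"
    unfolding test_seminorm_def seminorm_on_def by (auto intro!: exI[of _ "0::real"])
  show "test_funs \<subseteq> topspace test_topology"
  proof
    fix u assume u: "u \<in> test_funs"
    let ?p = "\<lambda>u::real \<Rightarrow> complex. 0::real"
    have "{v \<in> test_funs. ?p (\<lambda>x. v x - u x) < 1} \<in>
        {{v \<in> test_funs. p (\<lambda>x. v x - u x) < r} | p u r. test_seminorm p \<and> u \<in> test_funs \<and> 0 < r}"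
      unfolding mem_Collect_eq
      by (rule exI[of _ ?p], rule exI[of _ u], rule exI[of _ 1]) (simp add: z u)
    moreover have "u \<in> {v \<in> test_funs. ?p (\<lambda>x. v x - u x) < 1}" using u by simp
    ultimately show "u \<in> topspace test_topology"
      unfolding test_topology_def topology_generated_by_topspace by (rule UnionI)
  qed
qed

lemma openin_Z_topology:
  "openin Z_topology V \<longleftrightarrow> V \<subseteq> Z \<and> openin test_topology {u \<in> test_funs. fourier u \<in> V}"
proof -
  have "istopology (\<lambda>V. V \<subseteq> Z \<and> openin test_topology {u \<in> test_funs. fourier u \<in> V})"
    unfolding istopology_def
  proof (intro conjI allI impI)
    fix S T
    assume a: "S \<subseteq> Z \<and> openin test_topology {u \<in> test_funs. fourier u \<in> S}"
      and b: "T \<subseteq> Z \<and> openin test_topology {u \<in> test_funs. fourier u \<in> T}"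
    show "S \<inter> T \<subseteq> Z" using a by blast
    have "{u \<in> test_funs. fourier u \<in> S \<inter> T} =
        {u \<in> test_funs. fourier u \<in> S} \<inter> {u \<in> test_funs. fourier u \<in> T}" by blast
    then show "openin test_topology {u \<in> test_funs. fourier u \<in> S \<inter> T}"
      using a b by (simp add: openin_Int)
  next
    fix \<V> assume a: "\<forall>V\<in>\<V>. V \<subseteq> Z \<and> openin test_topology {u \<in> test_funs. fourier u \<in> V}"
    show "\<Union>\<V> \<subseteq> Z" using a by blast
    have "{u \<in> test_funs. fourier u \<in> \<Union>\<V>} =
        (\<Union>V\<in>\<V>. {u \<in> test_funs. fourier u \<in> V})" by blast
    then show "openin test_topology {u \<in> test_funs. fourier u \<in> \<Union>\<V>}"
      using a by (metis (no_types, lifting) imageE openin_Union)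
  qed
  then show ?thesis by (simp add: Z_topology_def topology_inverse')
qed

section \<open>Functions and distributions on \<open>(0,\<infinity>)\<close>\<close>

text \<open>A function on \<open>(0,\<infinity>)\<close> is represented by its extension by zero to the real line, so
  that equality of representatives is equality on \<open>(0,\<infinity>)\<close>.\<close>

definition Zplus :: "(real \<Rightarrow> complex) set" where
  "Zplus = {F. (\<forall>t\<le>0. F t = 0) \<and> (\<lambda>x. F (exp x)) \<in> Z}"

definition Zplus_topology :: "(real \<Rightarrow> complex) topology" where
  "Zplus_topology = pullback_topology Zplus (\<lambda>F x. F (exp x)) Z_topology"

text \<open>The value \<open>h F\<close> is the bracket \<open>\<langle>h, F\<rangle>\<close>, antilinear in \<open>F\<close>; only the values of \<open>h\<close> on
  \<open>Zplus\<close> matter.\<close>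

definition Zplus_dual :: "((real \<Rightarrow> complex) \<Rightarrow> complex) set" where
  "Zplus_dual = {h.
     (\<forall>F\<in>Zplus. \<forall>G\<in>Zplus. h (\<lambda>t. F t + G t) = h F + h G) \<and>
     (\<forall>c. \<forall>F\<in>Zplus. h (\<lambda>t. c * F t) = cnj c * h F) \<and>
     continuous_map Zplus_topology euclidean h}"

definition real_dist :: "((real \<Rightarrow> complex) \<Rightarrow> complex) \<Rightarrow> bool" where
  "real_dist h \<longleftrightarrow> (\<forall>F\<in>Zplus. h (\<lambda>t. cnj (F t)) = cnj (h F))"

definition dist_eq_fun :: "((real \<Rightarrow> complex) \<Rightarrow> complex) \<Rightarrow> (real \<Rightarrow> complex) \<Rightarrow> bool" where
  "dist_eq_fun h g \<longleftrightarrow> (\<forall>F\<in>Zplus.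
     set_integrable lborel {0<..} (\<lambda>t. g t * cnj (F t)) \<and>
     h F = (LINT t:{0<..}|lborel. g t * cnj (F t)))"

definition D :: "(real \<Rightarrow> complex) set" where
  "D = {f. (\<forall>t\<le>0. f t = 0) \<and> (\<lambda>x. of_real (exp (x / 2)) * f (exp x)) \<in> Z}"

definition laplace_conv :: "(real \<Rightarrow> complex) \<Rightarrow> (real \<Rightarrow> complex) \<Rightarrow> real \<Rightarrow> complex"
    (infixl "\<star>" 70) where
  "(f \<star> g) t = (LINT s:{0..t}|lborel. f s * g (t - s))"

end

theory Submission
  imports Defs "HOL-Complex_Analysis.Complex_Analysis" "HOL-Probability.Probability"
begin

text \<open>In logarithmic variables, with \<open>\<lambda> = e\<^sup>-\<^sup>x\<close>, the Laplace transform becomes multiplication by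
  \<open>Gamma (1 - \<i> \<zeta>)\<close> on the Fourier side, and by the Beta integral the function \<open>cnj f \<star> f\<close> becomes
  \<open>1 / Gamma (1 - \<i> \<zeta>)\<close> times the autocorrelation of a test function \<open>g\<close>, which is arbitrary because
  \<open>Gamma\<close> has no zeros. Hence \<open>h\<close>, divided by \<open>Gamma (1 - \<i> \<zeta>)\<close>, is a positive definite distribution on
  the Fourier side, and by the Bochner-Schwartz theorem it is the Fourier transform of a positive
  measure \<open>M\<close> of polynomial growth; the measure sought is the image of \<open>e\<^sup>-\<^sup>x dM(x)\<close>.

  For the Bochner-Schwartz theorem the distribution is multiplied by dilated autocorrelations
  tending to 1. Its Fourier transform is then a nonnegative function, the growth of these functions is
  bounded uniformly by testing against modulations of one fixed autocorrelation, and Helly's theorem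
  yields the limit measure.\<close>

section \<open>Smooth functions\<close>

text \<open>With \<open>t = exp y\<close> and \<open>\<lambda> = exp (- x)\<close>, the product of
  \<open>t * \<lambda>\<close> and \<open>exp (- t * \<lambda>)\<close> is a function of
  \<open>y - x\<close>, namely \<open>gumbel (y - x)\<close>, and its Fourier transform is Gamma on
  the line \<open>1 - \<i> * \<zeta>\<close>. The extra factor \<lambda> in this kernel is the
  origin of the weight 1 / \<lambda> in the growth condition. It is possible here because
  \<open>Z\<close> consists of Fourier transforms of compactly supported functions, on which every
  smooth function is a multiplier. The price is that a continuous functional on \<open>Z\<close>
  has, a priori, an order that depends on the support of the test function. Positivity repairs this:
  the order on the support of a single autocorrelation bounds the growth of the whole measure, and
  it determines \<kappa>. The square roots in \<open>D\<close> give each factor of the convolution a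
  Gamma on the line \<open>Re z = 1 / 2\<close>; the Beta integral then puts the reciprocal Gamma on
  the line \<open>Re z = 1\<close>, exactly where the Laplace kernel lives.\<close>

definition derivs :: "(real \<Rightarrow> complex) \<Rightarrow> (nat \<Rightarrow> real \<Rightarrow> complex) \<Rightarrow> bool" where
  "derivs u d \<longleftrightarrow> d 0 = u \<and> (\<forall>k x. (d k has_vector_derivative d (Suc k) x) (at x))"

lemma nth_deriv_0 [simp]: "nth_deriv 0 u = u"
  by (simp add: nth_deriv_def)

lemma nth_deriv_Suc: "nth_deriv (Suc k) u = (\<lambda>x. vector_derivative (nth_deriv k u) (at x))"
  by (simp add: nth_deriv_def)

text \<open>Since derivatives are unique, exhibiting closed forms of all orders at once identifies
  them with \<open>nth_deriv\<close>. Smoothness and bounds on derivatives are therefore obtained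
  below from an explicit \<open>d\<close>, without iterating
  \<open>vector_derivative\<close>.\<close>

lemma derivs_nth_deriv_eq: "derivs u d \<Longrightarrow> nth_deriv k u = d k"
proof (induction k)
  case (Suc k)
  then show ?case by (auto simp: derivs_def nth_deriv_Suc intro!: vector_derivative_at)
qed (simp add: derivs_def)

lemma derivs_imp_smooth:
  assumes "derivs u d" shows "smooth u"
  unfolding smooth_def using assms
  by (auto simp: derivs_nth_deriv_eq[OF assms] derivs_def intro: differentiableI_vector)

lemma smooth_has_vector_derivative:
  "smooth u \<Longrightarrow> (nth_deriv k u has_vector_derivative nth_deriv (Suc k) u x) (at x)"
  unfolding smooth_def nth_deriv_Suc by (simp add: vector_derivative_works)

lemma smooth_derivs: "smooth u \<Longrightarrow> derivs u (\<lambda>k. nth_deriv k u)"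
  by (simp add: derivs_def smooth_has_vector_derivative)

lemma smooth_continuous_on: "smooth u \<Longrightarrow> continuous_on A (nth_deriv k u)"
  using smooth_has_vector_derivative[of u k]
  by (meson continuous_at_imp_continuous_on has_vector_derivative_continuous)

lemmas smooth_continuous_on_0 = smooth_continuous_on[where k = 0, simplified]

lemma smooth_const: "derivs (\<lambda>x. c) (\<lambda>k x. if k = 0 then c else 0)"
  by (auto simp: derivs_def)

lemma derivs_add: "derivs u d \<Longrightarrow> derivs v e \<Longrightarrow> derivs (\<lambda>x. u x + v x) (\<lambda>k x. d k x + e k x)"
  unfolding derivs_def by (auto intro!: derivative_eq_intros)

lemma derivs_cmult: "derivs u d \<Longrightarrow> derivs (\<lambda>x. c * u x) (\<lambda>k x. c * d k x)"
  unfolding derivs_def by (auto intro!: derivative_eq_intros)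

text \<open>Covers every case in which each differentiation brings out one more factor
  \<open>c\<close>: affine substitutions, exponentials, holomorphic functions on a line and Fourier
  integrals.\<close>

lemma derivs_powers:
  assumes "\<And>k x. (e k has_vector_derivative c * e (Suc k) x) (at x)"
  shows "derivs (e 0) (\<lambda>k x. c ^ k * e k x)"
  unfolding derivs_def
proof (intro conjI allI)
  fix k x
  show "((\<lambda>x. c ^ k * e k x) has_vector_derivative c ^ Suc k * e (Suc k) x) (at x)"
    using has_vector_derivative_mult_right[OF assms, of "c ^ k" k x] by (simp add: mult_ac)
qed simp

lemma derivs_affine:
  assumes "derivs u d"
  shows "derivs (\<lambda>x. u (a * x + b)) (\<lambda>k x. of_real a ^ k * d k (a * x + b))"
proof -
  have "((\<lambda>x. d k (a * x + b)) has_vector_derivative a *\<^sub>R d (Suc k) (a * x + b)) (at x)" for k x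
  proof -
    have "((\<lambda>x. a * x + b) has_vector_derivative a) (at x)"
      by (auto intro!: derivative_eq_intros simp: has_real_derivative_iff_has_vector_derivative[symmetric])
    from vector_diff_chain_at[OF this, of "d k" "d (Suc k) (a * x + b)"] show ?thesis
      using assms by (simp add: derivs_def o_def)
  qed
  then show ?thesis
    using derivs_powers[of "\<lambda>k x. d k (a * x + b)" "of_real a"] assms
    by (simp add: scaleR_conv_of_real derivs_def)
qed

lemma derivs_mult:
  assumes f: "derivs f d" and g: "derivs g e"
  shows "derivs (\<lambda>x. f x * g x)
    (\<lambda>k x. \<Sum>j\<le>k. of_nat (k choose j) * (d j x * e (k - j) x))"
proof -
  have df: "(d k has_vector_derivative d (Suc k) x) (at x)" for k x
    using f by (simp add: derivs_def)
  have dg: "(e k has_vector_derivative e (Suc k) x) (at x)" for k x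
    using g by (simp add: derivs_def)
  have "((\<lambda>x. \<Sum>j\<le>k. of_nat (k choose j) * (d j x * e (k - j) x)) has_vector_derivative
      (\<Sum>j\<le>Suc k. of_nat (Suc k choose j) * (d j x * e (Suc k - j) x))) (at x)" for k x
  proof -
    have "((\<lambda>x. \<Sum>j\<le>k. of_nat (k choose j) * (d j x * e (k - j) x)) has_vector_derivative
       (\<Sum>j\<le>k. of_nat (k choose j) * (d j x * e (Suc (k - j)) x + d (Suc j) x * e (k - j) x))) (at x)"
      by (intro has_vector_derivative_sum has_vector_derivative_mult_right
            has_vector_derivative_mult df dg)
    moreover have "(\<Sum>j\<le>k. of_nat (k choose j) * (d j x * e (Suc (k - j)) x + d (Suc j) x * e (k - j) x))
        = (\<Sum>j\<le>Suc k. of_nat (Suc k choose j) * (d j x * e (Suc k - j) x))"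
    proof -
      \<comment> \<open>Pascal's rule: the term \<open>j = 0\<close> is split off and
        \<open>Suc k choose Suc j\<close> is expanded; regrouping one half with the split-off term
        creates a term \<open>j = Suc k\<close>, which vanishes because
        \<open>k choose Suc k = 0\<close>.\<close>
      have "(\<Sum>j\<le>Suc k. of_nat (Suc k choose j) * (d j x * e (Suc k - j) x))
          = d 0 x * e (Suc k) x + (\<Sum>j\<le>k. of_nat (Suc k choose Suc j) * (d (Suc j) x * e (k - j) x))"
        by (simp add: sum.atMost_Suc_shift del: sum.atMost_Suc binomial_Suc_Suc)
      also have "(\<Sum>j\<le>k. of_nat (Suc k choose Suc j) * (d (Suc j) x * e (k - j) x)) =
          (\<Sum>j\<le>k. of_nat (k choose j) * (d (Suc j) x * e (k - j) x)) +
          (\<Sum>j\<le>k. of_nat (k choose Suc j) * (d (Suc j) x * e (k - j) x))"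
        by (simp add: sum.distrib[symmetric] algebra_simps)
      also have "d 0 x * e (Suc k) x +
          ((\<Sum>j\<le>k. of_nat (k choose j) * (d (Suc j) x * e (k - j) x)) +
          (\<Sum>j\<le>k. of_nat (k choose Suc j) * (d (Suc j) x * e (k - j) x))) =
          (\<Sum>j\<le>k. of_nat (k choose j) * (d (Suc j) x * e (k - j) x)) +
          (\<Sum>j\<le>Suc k. of_nat (k choose j) * (d j x * e (Suc k - j) x))"
        by (simp add: sum.atMost_Suc_shift del: sum.atMost_Suc)
      also have "(\<Sum>j\<le>Suc k. of_nat (k choose j) * (d j x * e (Suc k - j) x)) =
          (\<Sum>j\<le>k. of_nat (k choose j) * (d j x * e (Suc (k - j)) x))"
        by (auto intro!: sum.cong simp: Suc_diff_le)
      finally show ?thesis by (simp add: sum.distrib algebra_simps)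
    qed
    ultimately show ?thesis by simp
  qed
  then show ?thesis using f g by (simp add: derivs_def)
qed

lemma smooth_add: "smooth u \<Longrightarrow> smooth v \<Longrightarrow> smooth (\<lambda>x. u x + v x)"
  by (rule derivs_imp_smooth[OF derivs_add[OF smooth_derivs smooth_derivs]])

lemma smooth_cmult: "smooth u \<Longrightarrow> smooth (\<lambda>x. c * u x)"
  by (rule derivs_imp_smooth[OF derivs_cmult[OF smooth_derivs]])

lemma smooth_mult: "smooth u \<Longrightarrow> smooth v \<Longrightarrow> smooth (\<lambda>x. u x * v x)"
  by (rule derivs_imp_smooth[OF derivs_mult[OF smooth_derivs smooth_derivs]])

text \<open>In Leibniz' formula the binomial coefficients sum to \<open>2 ^ k\<close>. The bounds
  are needed at the point \<open>x\<close> only, so that the lemma applies on a compact set to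
  factors without global bounds.\<close>

lemma nth_deriv_mult_bound:
  assumes "smooth f" "smooth g" and "\<And>j. j \<le> k \<Longrightarrow> norm (nth_deriv j f x) \<le> A"
    and "\<And>j. j \<le> k \<Longrightarrow> norm (nth_deriv j g x) \<le> B"
  shows "norm (nth_deriv k (\<lambda>x. f x * g x) x) \<le> 2 ^ k * (A * B)"
proof -
  have A: "0 \<le> A" using assms(3)[of 0] norm_ge_zero order_trans by blast
  have "norm (nth_deriv k (\<lambda>x. f x * g x) x) \<le>
      (\<Sum>j\<le>k. norm (of_nat (k choose j) * (nth_deriv j f x * nth_deriv (k - j) g x)))"
    unfolding derivs_nth_deriv_eq[OF derivs_mult[OF smooth_derivs smooth_derivs, OF assms(1,2)]]
    by (rule norm_sum)
  also have "\<dots> \<le> (\<Sum>j\<le>k. of_nat (k choose j) * (A * B))"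
    using assms A by (intro sum_mono) (auto simp: norm_mult intro!: mult_left_mono mult_mono)
  also have "\<dots> = 2 ^ k * (A * B)"
    by (simp add: sum_distrib_right[symmetric] choose_row_sum flip: of_nat_sum)
  finally show ?thesis .
qed

lemma derivs_exp: "derivs (\<lambda>x. exp (\<i> * of_real (a * x))) (\<lambda>k x. (\<i> * of_real a) ^ k * exp (\<i> * of_real (a * x)))"
proof -
  have "((\<lambda>x. exp (\<i> * of_real (a * x))) has_vector_derivative \<i> * of_real a * exp (\<i> * of_real (a * x))) (at x)" for x
  proof -
    have "((\<lambda>z. exp (\<i> * (of_real a * z))) has_field_derivative \<i> * of_real a * exp (\<i> * (of_real a * of_real x))) (at (of_real x))"
      by (auto intro!: derivative_eq_intros)
    from has_vector_derivative_real_field[OF this] show ?thesis by simp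
  qed
  from derivs_powers[OF this] show ?thesis by simp
qed

text \<open>Intended for Gamma and its reciprocal on vertical lines, which thereby become
  multipliers of test functions.\<close>

lemma derivs_holomorphic_line:
  assumes f: "f holomorphic_on S" and S: "open S" "\<And>x::real. a + b * of_real x \<in> S"
  shows "derivs (\<lambda>x. f (a + b * of_real x)) (\<lambda>k x. b ^ k * (deriv ^^ k) f (a + b * of_real x))"
proof -
  have "((\<lambda>x. (deriv ^^ k) f (a + b * of_real x)) has_vector_derivative
      b * (deriv ^^ Suc k) f (a + b * of_real x)) (at x)" for k x
  proof -
    have "((deriv ^^ k) f has_field_derivative (deriv ^^ Suc k) f (a + b * of_real x)) (at (a + b * of_real x))"
      using holomorphic_derivI[OF holomorphic_higher_deriv[OF f S(1)] S(1) S(2)] by simp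
    then have "((\<lambda>z. (deriv ^^ k) f (a + b * z)) has_field_derivative (deriv ^^ Suc k) f (a + b * of_real x) * b) (at (of_real x))"
      by (rule DERIV_chain2) (auto intro!: derivative_eq_intros)
    from has_vector_derivative_real_field[OF this] show ?thesis by (simp add: mult_ac)
  qed
  then show ?thesis using derivs_powers[of "\<lambda>k x. (deriv ^^ k) f (a + b * of_real x)" b] by simp
qed

section \<open>Test functions\<close>

lemma test_funs_in_interval: "u \<in> test_funs_in {-R..R} \<longleftrightarrow> smooth u \<and> (\<forall>x. R < \<bar>x\<bar> \<longrightarrow> u x = 0)"
proof -
  have "closure {x. u x \<noteq> 0} \<subseteq> {-R..R} \<longleftrightarrow> {x. u x \<noteq> 0} \<subseteq> {-R..R}"
    by (meson closed_atLeastAtMost closure_minimal closure_subset order_trans)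
  also have "\<dots> \<longleftrightarrow> (\<forall>x. R < \<bar>x\<bar> \<longrightarrow> u x = 0)"
    by (auto simp: abs_le_iff subset_iff) (metis abs_le_iff linorder_not_le minus_le_iff)+
  finally show ?thesis by (auto simp: test_funs_in_def)
qed

text \<open>Every compact set lies in a symmetric interval, so the intervals \<open>{-R..R}\<close>
  suffice in all that follows.\<close>

lemma test_funs_iff: "u \<in> test_funs \<longleftrightarrow> smooth u \<and> (\<exists>R. \<forall>x. R < \<bar>x\<bar> \<longrightarrow> u x = 0)"
proof
  assume "u \<in> test_funs"
  then obtain K where K: "compact K" "u \<in> test_funs_in K" by (auto simp: test_funs_def)
  obtain R where "\<And>x. x \<in> K \<Longrightarrow> \<bar>x\<bar> \<le> R"
    using compact_imp_bounded[OF K(1)] by (auto simp: bounded_iff)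
  then have "K \<subseteq> {-R..R}" by (auto simp: abs_le_iff) (metis minus_le_iff)
  then have "u \<in> test_funs_in {-R..R}" using K by (auto simp: test_funs_in_def)
  then show "smooth u \<and> (\<exists>R. \<forall>x. R < \<bar>x\<bar> \<longrightarrow> u x = 0)" by (auto simp: test_funs_in_interval)
next
  assume "smooth u \<and> (\<exists>R. \<forall>x. R < \<bar>x\<bar> \<longrightarrow> u x = 0)"
  then obtain R where "u \<in> test_funs_in {-R..R}" by (auto simp: test_funs_in_interval)
  then show "u \<in> test_funs" by (auto simp: test_funs_def)
qed

lemma test_funsE:
  assumes "u \<in> test_funs"
  obtains R where "R > 0" "u \<in> test_funs_in {-R..R}" "\<And>x. R < \<bar>x\<bar> \<Longrightarrow> u x = 0"
proof -
  obtain R where "smooth u" "\<forall>x. R < \<bar>x\<bar> \<longrightarrow> u x = 0" using assms by (auto simp: test_funs_iff)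
  then show ?thesis using that[of "max R 1"] by (auto simp: test_funs_in_interval)
qed

lemma test_funs_in_test_funs: "u \<in> test_funs_in {-R..R} \<Longrightarrow> u \<in> test_funs"
  by (auto simp: test_funs_in_interval test_funs_iff)

lemma test_funs_smooth: "u \<in> test_funs \<Longrightarrow> smooth u"
  by (simp add: test_funs_iff)

lemma test_funs_add: "u \<in> test_funs \<Longrightarrow> v \<in> test_funs \<Longrightarrow> (\<lambda>x. u x + v x) \<in> test_funs"
  unfolding test_funs_iff
proof (intro conjI, goal_cases)
  case 1 then show ?case by (simp add: smooth_add)
next
  case 2
  then obtain R S where "\<forall>x. R < \<bar>x\<bar> \<longrightarrow> u x = 0" "\<forall>x. S < \<bar>x\<bar> \<longrightarrow> v x = 0" by auto
  then show ?case by (intro exI[of _ "max R S"]) auto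
qed

lemma test_funs_in_mult:
  "u \<in> test_funs_in {-R..R} \<Longrightarrow> smooth v \<Longrightarrow> (\<lambda>x. u x * v x) \<in> test_funs_in {-R..R}"
  by (auto simp: test_funs_in_interval smooth_mult)

lemma test_funs_mult: "u \<in> test_funs \<Longrightarrow> smooth v \<Longrightarrow> (\<lambda>x. u x * v x) \<in> test_funs"
  by (auto simp: test_funs_iff smooth_mult)

lemma test_funs_mult': "u \<in> test_funs \<Longrightarrow> smooth v \<Longrightarrow> (\<lambda>x. v x * u x) \<in> test_funs"
  using test_funs_mult[of u v] by (simp add: mult.commute)

lemma test_funs_cmult: "u \<in> test_funs \<Longrightarrow> (\<lambda>x. c * u x) \<in> test_funs"
  by (auto simp: test_funs_iff smooth_cmult)

lemma nth_deriv_eq_0_outside: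
  assumes "\<forall>x. R < \<bar>x\<bar> \<longrightarrow> u x = 0" "R < \<bar>x\<bar>"
  shows "nth_deriv k u x = 0"
  using assms(2)
proof (induction k arbitrary: x)
  case 0 then show ?case using assms by simp
next
  case (Suc k)
  have "open {x. R < \<bar>x\<bar>}" by (intro open_Collect_less continuous_intros)
  then have "(nth_deriv k u has_vector_derivative 0) (at x)"
    using Suc by (intro has_vector_derivative_transform_within_open[OF has_vector_derivative_const]) auto
  then show ?case by (simp add: nth_deriv_Suc vector_derivative_at)
qed

lemma bounded_compact_support:
  fixes u :: "real \<Rightarrow> complex"
  assumes "continuous_on UNIV u" "\<And>x. R < \<bar>x\<bar> \<Longrightarrow> u x = 0"
  obtains B where "0 \<le> B" "\<And>x. norm (u x) \<le> B"
proof -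
  have "bounded (u ` {-R..R})"
    using assms(1) by (intro compact_imp_bounded compact_continuous_image) (auto intro: continuous_on_subset)
  then obtain B where B: "\<And>x. x \<in> {-R..R} \<Longrightarrow> norm (u x) \<le> B" unfolding bounded_iff by blast
  show ?thesis
  proof (rule that[of "max B 0"])
    fix x show "norm (u x) \<le> max B 0"
      using B[of x] assms(2)[of x] by (cases "x \<in> {-R..R}") (auto simp: abs_if split: if_splits)
  qed simp
qed

lemma bounded_nth_derivs:
  assumes "smooth u" "bounded X"
  obtains B where "0 \<le> B" "\<And>k x. k \<le> N \<Longrightarrow> x \<in> X \<Longrightarrow> norm (nth_deriv k u x) \<le> (B :: real)"
proof -
  have "\<exists>B. \<forall>x\<in>X. norm (nth_deriv k u x) \<le> B" for k
  proof -
    have "bounded (nth_deriv k u ` closure X)"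
      using assms by (intro compact_imp_bounded compact_continuous_image smooth_continuous_on) auto
    then show ?thesis using closure_subset[of X] by (auto simp: bounded_iff)
  qed
  then obtain B where B: "\<And>k x. x \<in> X \<Longrightarrow> norm (nth_deriv k u x) \<le> B k" by metis
  show ?thesis
  proof (rule that[of "\<Sum>k\<le>N. \<bar>B k\<bar>"])
    fix k x assume "k \<le> N" "x \<in> X"
    then have "norm (nth_deriv k u x) \<le> \<bar>B k\<bar>" using B[of x k] by simp
    also have "\<dots> \<le> (\<Sum>k\<le>N. \<bar>B k\<bar>)" using \<open>k \<le> N\<close> by (intro member_le_sum) auto
    finally show "norm (nth_deriv k u x) \<le> (\<Sum>k\<le>N. \<bar>B k\<bar>)" .
  qed (auto intro: sum_nonneg)
qed

lemma test_funs_bounded_nth_derivs: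
  assumes "u \<in> test_funs"
  obtains B where "0 \<le> B" "\<And>k x. k \<le> N \<Longrightarrow> norm (nth_deriv k u x) \<le> (B :: real)"
proof -
  obtain R where R: "R > 0" "u \<in> test_funs_in {-R..R}" "\<And>x. R < \<bar>x\<bar> \<Longrightarrow> u x = 0"
    using test_funsE[OF assms] by blast
  obtain B where B: "0 \<le> B" "\<And>k x. k \<le> N \<Longrightarrow> x \<in> {-R..R} \<Longrightarrow> norm (nth_deriv k u x) \<le> B"
    using bounded_nth_derivs[of u "{-R..R}" N] assms by (metis bounded_closed_interval test_funs_smooth)
  show ?thesis
  proof (rule that[OF B(1)])
    fix k x assume "k \<le> N"
    show "norm (nth_deriv k u x) \<le> B"
    proof (cases "x \<in> {-R..R}")
      case False
      then have "R < \<bar>x\<bar>" by (auto simp: abs_if split: if_splits)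
      then show ?thesis using nth_deriv_eq_0_outside[of R u x k] R(3) B(1) by simp
    qed (use B \<open>k \<le> N\<close> in auto)
  qed
qed

section \<open>Continuous functionals on test functions\<close>

lemma seminorm_on_add:
  "seminorm_on V p \<Longrightarrow> u \<in> V \<Longrightarrow> v \<in> V \<Longrightarrow> p (\<lambda>x. u x + v x) \<le> p u + p v"
  by (simp add: seminorm_on_def)

lemma seminorm_on_cmult: "seminorm_on V p \<Longrightarrow> u \<in> V \<Longrightarrow> p (\<lambda>x. c * u x) = norm c * p u"
  by (simp add: seminorm_on_def)

lemma seminorm_nonneg:
  assumes p: "seminorm_on test_funs p" and u: "u \<in> test_funs"
  shows "0 \<le> p u" and "p (\<lambda>x. 0) = 0"
proof -
  have "p (\<lambda>x. 0 * u x) = 0" using seminorm_on_cmult[OF p u, of 0] by simp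
  then show 0: "p (\<lambda>x. 0) = 0" by simp
  have m: "(\<lambda>x. - 1 * u x) \<in> test_funs" using u by (rule test_funs_cmult)
  have "p (\<lambda>x. u x + - 1 * u x) \<le> p u + p (\<lambda>x. - 1 * u x)"
    using seminorm_on_add[OF p u m] .
  also have "p (\<lambda>x. - 1 * u x) = norm (- 1 :: complex) * p u" by (rule seminorm_on_cmult[OF p u])
  finally show "0 \<le> p u" using 0 by simp
qed

text \<open>The ball of \<open>p + q\<close> lies in the balls of \<open>p\<close> and of
  \<open>q\<close>, so this replaces the intersection of two balls by a single ball. Constants enter
  through their absolute values, as nothing forces \<open>C\<close> to be nonnegative.\<close>

lemma test_seminorm_add:
  assumes "test_seminorm p" "test_seminorm q" shows "test_seminorm (\<lambda>u. p u + q u)"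
proof -
  have "\<exists>C N. \<forall>u\<in>test_funs_in K. p u + q u \<le> C * (\<Sum>k\<le>N. SUP x. norm (nth_deriv k u x))" if K: "compact K" for K
  proof -
    obtain C N C' N' where C: "\<forall>u\<in>test_funs_in K. p u \<le> C * (\<Sum>k\<le>N. SUP x. norm (nth_deriv k u x))"
       "\<forall>u\<in>test_funs_in K. q u \<le> C' * (\<Sum>k\<le>N'. SUP x. norm (nth_deriv k u x))"
      using assms K unfolding test_seminorm_def by meson
    have "p u + q u \<le> (\<bar>C\<bar> + \<bar>C'\<bar>) * (\<Sum>k\<le>N + N'. SUP x. norm (nth_deriv k u x))" if u: "u \<in> test_funs_in K" for u
    proof -
      have ut: "u \<in> test_funs" using u K by (auto simp: test_funs_def)
      \<comment> \<open>A real \<open>SUP\<close> says something only about sets bounded above; the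
        bound comes from the compact support.\<close>
      have nn: "0 \<le> (SUP x. norm (nth_deriv k u x))" for k
      proof -
        obtain B where "\<And>x. norm (nth_deriv k u x) \<le> B"
          using test_funs_bounded_nth_derivs[OF ut, of k] by (metis le_refl)
        then have "norm (nth_deriv k u 0) \<le> (SUP x. norm (nth_deriv k u x))"
          by (intro cSUP_upper) (auto intro!: bdd_aboveI)
        then show ?thesis by (meson norm_ge_zero order_trans)
      qed
      have m: "(\<Sum>k\<le>M. SUP x. norm (nth_deriv k u x)) \<le> (\<Sum>k\<le>N + N'. SUP x. norm (nth_deriv k u x))"
        if "M \<le> N + N'" for M using that nn by (intro sum_mono2) auto
      have n0: "0 \<le> (\<Sum>k\<le>M. SUP x. norm (nth_deriv k u x))" for M using nn by (intro sum_nonneg) auto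
      have "p u \<le> \<bar>C\<bar> * (\<Sum>k\<le>N + N'. SUP x. norm (nth_deriv k u x))"
        using bspec[OF C(1) u] mult_mono[OF abs_ge_self[of C] m[of N] abs_ge_zero n0] by simp
      moreover have "q u \<le> \<bar>C'\<bar> * (\<Sum>k\<le>N + N'. SUP x. norm (nth_deriv k u x))"
        using bspec[OF C(2) u] mult_mono[OF abs_ge_self[of C'] m[of N'] abs_ge_zero n0] by simp
      ultimately show ?thesis by (simp add: distrib_right)
    qed
    then show ?thesis by blast
  qed
  moreover have "seminorm_on test_funs (\<lambda>u. p u + q u)"
    unfolding seminorm_on_def
  proof (intro conjI ballI allI)
    fix u v assume uv: "u \<in> test_funs" "v \<in> test_funs"
    show "p (\<lambda>x. u x + v x) + q (\<lambda>x. u x + v x) \<le> p u + q u + (p v + q v)"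
      using seminorm_on_add[OF _ uv, of p] seminorm_on_add[OF _ uv, of q] assms
      unfolding test_seminorm_def by linarith
  next
    fix c u assume u: "u \<in> test_funs"
    show "p (\<lambda>x. c * u x) + q (\<lambda>x. c * u x) = norm c * (p u + q u)"
      using seminorm_on_cmult[OF _ u, of p] seminorm_on_cmult[OF _ u, of q] assms
      unfolding test_seminorm_def by (simp add: distrib_left)
  qed
  ultimately show ?thesis unfolding test_seminorm_def by blast
qed

text \<open>The balls are given merely as a subbase. By induction on the generation of open sets
  they form a neighbourhood base: intersections are handled by adding seminorms, and a ball about
  \<open>u\<close> contains, about each of its points \<open>z\<close>, the ball whose radius is
  smaller by \<open>p\<close> of \<open>z - u\<close>.\<close>

lemma openin_test_topology_seminorm:
  assumes "openin test_topology U" "z \<in> U"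
  obtains p r where "test_seminorm p" "r > 0" "{v \<in> test_funs. p (\<lambda>x. v x - z x) < r} \<subseteq> U"
proof -
  let ?B = "{{v \<in> test_funs. p (\<lambda>x. v x - u x) < r} | p u r. test_seminorm p \<and> u \<in> test_funs \<and> 0 < r}"
  have "generate_topology_on ?B U"
    using assms(1) unfolding test_topology_def by (rule openin_topology_generated_by)
  then have "\<forall>z\<in>U. \<exists>p r. test_seminorm p \<and> r > 0 \<and> {v \<in> test_funs. p (\<lambda>x. v x - z x) < r} \<subseteq> U"
  proof (induction rule: generate_topology_on.induct)
    case Empty then show ?case by simp
  next
    case (Int a b)
    show ?case
    proof
      fix z assume "z \<in> a \<inter> b"
      then obtain p r q s where *: "test_seminorm p" "r > 0" "{v \<in> test_funs. p (\<lambda>x. v x - z x) < r} \<subseteq> a"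
        "test_seminorm q" "s > 0" "{v \<in> test_funs. q (\<lambda>x. v x - z x) < s} \<subseteq> b"
        using Int.IH by (meson IntD1 IntD2)
      have zt: "z \<in> test_funs"
        using \<open>z \<in> a \<inter> b\<close> Int.hyps(1) topspace_test_topology openin_subset[of test_topology a]
        unfolding test_topology_def openin_topology_generated_by_iff by blast
      have "{v \<in> test_funs. p (\<lambda>x. v x - z x) + q (\<lambda>x. v x - z x) < min r s} \<subseteq> a \<inter> b"
      proof
        fix v assume v: "v \<in> {v \<in> test_funs. p (\<lambda>x. v x - z x) + q (\<lambda>x. v x - z x) < min r s}"
        have "(\<lambda>x. v x + - 1 * z x) \<in> test_funs" using v zt by (intro test_funs_add test_funs_cmult) auto
        then have d: "(\<lambda>x. v x - z x) \<in> test_funs" by simp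
        have "0 \<le> p (\<lambda>x. v x - z x)" "0 \<le> q (\<lambda>x. v x - z x)"
          using * seminorm_nonneg(1)[OF _ d] unfolding test_seminorm_def by auto
        then show "v \<in> a \<inter> b" using v * by auto
      qed
      then show "\<exists>p r. test_seminorm p \<and> r > 0 \<and> {v \<in> test_funs. p (\<lambda>x. v x - z x) < r} \<subseteq> a \<inter> b"
        using test_seminorm_add[OF *(1,4)] *(2,5)
        by (intro exI[of _ "\<lambda>u. p u + q u"] exI[of _ "min r s"]) auto
    qed
  next
    case (UN K)
    then show ?case by (meson Union_iff Union_upper order_trans)
  next
    case (Basis s)
    then obtain p u r where s: "s = {v \<in> test_funs. p (\<lambda>x. v x - u x) < r}" "test_seminorm p" "u \<in> test_funs" "0 < r"
      by auto
    show ?case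
    proof
      fix z assume z: "z \<in> s"
      have dt: "(\<lambda>x. v x - w x) \<in> test_funs" if "v \<in> test_funs" "w \<in> test_funs" for v w
        using test_funs_add[OF that(1) test_funs_cmult[OF that(2), of "-1"]] by simp
      have "{v \<in> test_funs. p (\<lambda>x. v x - z x) < r - p (\<lambda>x. z x - u x)} \<subseteq> s"
      proof
        fix v assume v: "v \<in> {v \<in> test_funs. p (\<lambda>x. v x - z x) < r - p (\<lambda>x. z x - u x)}"
        have "p (\<lambda>x. (v x - z x) + (z x - u x)) \<le> p (\<lambda>x. v x - z x) + p (\<lambda>x. z x - u x)"
          using s(2) dt[of v z] dt[of z u] v z s seminorm_on_add[of test_funs p "\<lambda>x. v x - z x" "\<lambda>x. z x - u x"]
          unfolding test_seminorm_def by auto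
        then show "v \<in> s" using v s by simp
      qed
      then show "\<exists>p r. test_seminorm p \<and> r > 0 \<and> {v \<in> test_funs. p (\<lambda>x. v x - z x) < r} \<subseteq> s"
        using s z by (intro exI[of _ p] exI[of _ "r - p (\<lambda>x. z x - u x)"]) auto
    qed
  qed
  then show ?thesis using assms(2) that by blast
qed

text \<open>Continuity of a linear functional in the inductive limit topology.\<close>

definition dist_bounded :: "((real \<Rightarrow> complex) \<Rightarrow> complex) \<Rightarrow> bool" where
  "dist_bounded T \<longleftrightarrow> (\<forall>R. \<exists>C\<ge>0. \<exists>N. \<forall>u\<in>test_funs_in {-R..R}. \<forall>\<beta>.
     (\<forall>k\<le>N. \<forall>x. norm (nth_deriv k u x) \<le> \<beta>) \<longrightarrow> norm (T u) \<le> C * \<beta>)"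

text \<open>A common bound \<open>\<beta>\<close> replaces the sum of suprema in
  \<open>test_seminorm\<close>, at the cost of the factor \<open>N + 1\<close>; estimates can then
  be made pointwise.\<close>

lemma dist_bounded_if_seminorm:
  assumes "test_seminorm p" and b: "\<And>u. u \<in> test_funs \<Longrightarrow> norm (b u) \<le> c * p u" and c: "0 \<le> c"
  shows "dist_bounded b"
  unfolding dist_bounded_def
proof
  fix R :: real
  obtain C N where C: "\<And>u. u \<in> test_funs_in {-R..R} \<Longrightarrow> p u \<le> C * (\<Sum>k\<le>N. SUP x. norm (nth_deriv k u x))"
    using assms(1) unfolding test_seminorm_def by (meson compact_Icc)
  have "norm (b u) \<le> (c * \<bar>C\<bar> * (N + 1)) * \<beta>"
    if u: "u \<in> test_funs_in {-R..R}" and \<beta>: "\<forall>k\<le>N. \<forall>x. norm (nth_deriv k u x) \<le> \<beta>" for u \<beta>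
  proof -
    have \<beta>0: "0 \<le> \<beta>" using \<beta> norm_ge_zero order_trans by blast
    have "norm (nth_deriv k u 0) \<le> (SUP x. norm (nth_deriv k u x))" if "k \<le> N" for k
      using \<beta> that by (intro cSUP_upper) (auto intro!: bdd_aboveI)
    then have nn: "0 \<le> (\<Sum>k\<le>N. SUP x. norm (nth_deriv k u x))"
      by (intro sum_nonneg) (meson atMost_iff norm_ge_zero order_trans)
    have "(\<Sum>k\<le>N. SUP x. norm (nth_deriv k u x)) \<le> (\<Sum>k\<le>N. \<beta>)"
      using \<beta> by (intro sum_mono cSUP_least) auto
    then have "p u \<le> \<bar>C\<bar> * ((N + 1) * \<beta>)"
      using C[OF u] mult_mono[OF abs_ge_self[of C] _ abs_ge_zero nn, of "(N + 1) * \<beta>"] by (simp add: algebra_simps)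
    then have "c * p u \<le> c * (\<bar>C\<bar> * ((N + 1) * \<beta>))" using c by (intro mult_left_mono) auto
    then show ?thesis using b[OF test_funs_in_test_funs[OF u]] by (simp add: mult_ac)
  qed
  then show "\<exists>C\<ge>0. \<exists>N. \<forall>u\<in>test_funs_in {-R..R}. \<forall>\<beta>.
     (\<forall>k\<le>N. \<forall>x. norm (nth_deriv k u x) \<le> \<beta>) \<longrightarrow> norm (b u) \<le> C * \<beta>"
    using c by (intro exI[of _ "c * \<bar>C\<bar> * (N + 1)"] conjI exI[of _ N]) auto
qed

text \<open>Homogeneity is required for norms only, so that the antilinear bracket is
  covered.\<close>

lemma continuous_imp_dist_bounded:
  assumes hom: "\<And>c u. u \<in> test_funs \<Longrightarrow> norm (b (\<lambda>x. c * u x)) = norm c * norm (b u)"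
    and op: "openin test_topology U" and z: "(\<lambda>x. 0) \<in> U" and U: "\<And>u. u \<in> U \<Longrightarrow> norm (b u :: complex) < 1"
  shows "dist_bounded b"
proof -
  obtain p r where p: "test_seminorm p" and r: "r > 0" and "{v \<in> test_funs. p (\<lambda>x. v x - 0) < r} \<subseteq> U"
    using openin_test_topology_seminorm[OF op z] .
  then have pb: "norm (b v) < 1" if "v \<in> test_funs" "p v < r" for v using U that by auto
  have "norm (b v) \<le> (1 / r) * p v" if v: "v \<in> test_funs" for v
  proof -
    have p0: "0 \<le> p v" using seminorm_nonneg(1)[OF _ v] p by (auto simp: test_seminorm_def)
    have "norm (b v) * r \<le> p v"
    proof (rule field_le_epsilon)
      fix \<delta> :: real assume \<delta>: "0 < \<delta>"
      \<comment> \<open>Scales \<open>v\<close> into the ball of radius \<open>r\<close>; the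
        summand \<open>\<delta>\<close> takes care of \<open>p v = 0\<close>.\<close>
      let ?s = "r / (p v + \<delta>)"
      have s: "?s > 0" using r p0 \<delta> by simp
      have "p (\<lambda>x. of_real ?s * v x) = ?s * p v"
        using p s seminorm_on_cmult[OF _ v, of p "of_real ?s"]
        unfolding test_seminorm_def by (simp only: norm_of_real abs_of_pos)
      also have "\<dots> < r" using r p0 \<delta> by (simp add: field_simps)
      finally have "norm (b (\<lambda>x. of_real ?s * v x)) < 1" using v by (intro pb test_funs_cmult)
      then have "?s * norm (b v) < 1" using hom[OF v, of "of_real ?s"] s by (simp only: norm_of_real abs_of_pos)
      then show "norm (b v) * r \<le> p v + \<delta>" using p0 \<delta> by (simp add: field_simps)
    qed
    then show ?thesis using r by (simp add: field_simps)
  qed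
  then show ?thesis using r by (intro dist_bounded_if_seminorm[OF p, of b "1 / r"]) auto
qed

section \<open>A bump function\<close>

text \<open>In the variable \<open>y = 1 / x\<close>, differentiation with respect to
  \<open>x\<close> sends \<open>P y * exp (- y)\<close> to
  \<open>y\<^sup>2 * (P y - P' y) * exp (- y)\<close>, which is the recursion.\<close>

primrec bump_poly :: "nat \<Rightarrow> real poly" where
  "bump_poly 0 = 1"
| "bump_poly (Suc k) = [:0, 0, 1:] * (bump_poly k - pderiv (bump_poly k))"

definition bump_deriv :: "nat \<Rightarrow> real \<Rightarrow> real" where
  "bump_deriv k x = (if 0 < x then poly (bump_poly k) (1 / x) * exp (- 1 / x) else 0)"

lemma poly_times_exp_tendsto_0: "((\<lambda>y. poly p y * exp (- y)) \<longlongrightarrow> (0 :: real)) at_top"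
proof -
  have "((\<lambda>y. \<Sum>i\<le>degree p. coeff p i * (y ^ i / exp y)) \<longlongrightarrow> (\<Sum>i\<le>degree p. coeff p i * 0)) at_top"
    by (intro tendsto_sum tendsto_mult tendsto_const tendsto_power_div_exp_0)
  then show ?thesis
    by (simp add: poly_altdef sum_distrib_right exp_minus divide_inverse mult.assoc)
qed

lemma bump_deriv_has_derivative:
  "(bump_deriv k has_real_derivative bump_deriv (Suc k) x) (at x)"
proof -
  consider "x > 0" | "x < 0" | "x = 0" by linarith
  then show ?thesis
  proof cases
    case 1
    have "((\<lambda>x. poly (bump_poly k) (1 / x) * exp (- 1 / x)) has_real_derivative bump_deriv (Suc k) x) (at x)"
      using 1 by (auto intro!: derivative_eq_intros poly_DERIV[THEN DERIV_chain2]
          simp: bump_deriv_def field_simps power2_eq_square)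
    then show ?thesis
      by (rule has_field_derivative_transform_within_open[of _ _ _ "{0<..}"])
         (use 1 in \<open>auto simp: bump_deriv_def\<close>)
  next
    case 2
    have "((\<lambda>x. 0) has_real_derivative bump_deriv (Suc k) x) (at x)"
      using 2 by (auto simp: bump_deriv_def)
    then show ?thesis
      by (rule has_field_derivative_transform_within_open[of _ _ _ "{..<0}"])
         (use 2 in \<open>auto simp: bump_deriv_def\<close>)
  next
    case 3
    have "((\<lambda>h. bump_deriv k h / h) \<longlongrightarrow> 0) (at 0)"
    proof (rule filterlim_split_at_real)
      show "((\<lambda>h. bump_deriv k h / h) \<longlongrightarrow> 0) (at_left 0)"
        by (rule tendsto_eventually) (auto simp: bump_deriv_def eventually_at_left_field intro!: exI[of _ "-1"])
      \<comment> \<open>At \<open>0\<close> the difference quotient has the same shape once more: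
        the division by \<open>h\<close> multiplies the polynomial in \<open>1 / h\<close> by
        \<open>[:0, 1:]\<close>.\<close>
      have "((\<lambda>h. poly ([:0, 1:] * bump_poly k) (inverse h) * exp (- inverse h)) \<longlongrightarrow> 0) (at_right 0)"
        by (rule filterlim_compose[OF poly_times_exp_tendsto_0 filterlim_inverse_at_top_right])
      then show "((\<lambda>h. bump_deriv k h / h) \<longlongrightarrow> 0) (at_right 0)"
        by (rule Lim_transform_eventually)
           (auto simp: bump_deriv_def eventually_at_right_field field_simps intro!: exI[of _ 1])
    qed
    then show ?thesis using 3 by (simp add: DERIV_def bump_deriv_def)
  qed
qed

lemma bump_test_function:
  obtains g where "g \<in> test_funs" "\<And>x. g x = of_real (Re (g x))" "\<And>x. 0 \<le> Re (g x)" "0 < Re (g (1 / 2))"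
proof -
  let ?f = "\<lambda>x. of_real (bump_deriv 0 x) :: complex"
  have f: "derivs ?f (\<lambda>k x. of_real (bump_deriv k x))"
    unfolding derivs_def using bump_deriv_has_derivative by (auto intro!: has_vector_derivative_of_real
      simp: has_real_derivative_iff_has_vector_derivative)
  \<comment> \<open>One factor vanishes for \<open>x \<le> 0\<close> and the other for
    \<open>x \<ge> 1\<close>.\<close>
  let ?g = "\<lambda>x. ?f x * ?f (- 1 * x + 1)"
  have "smooth ?g"
    using derivs_mult[OF f derivs_affine[OF f, of "-1" 1]] by (rule derivs_imp_smooth)
  then have "?g \<in> test_funs"
    by (auto simp: test_funs_iff bump_deriv_def intro!: exI[of _ 1])
  then show ?thesis by (rule that) (auto simp: bump_deriv_def)
qed

section \<open>Rapidly decreasing functions\<close>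

text \<open>Derivatives are left out, so that functions known by their size, such as
  \<open>gumbel\<close> or the square of a modulus, qualify at once; decay alone makes their Fourier
  integrals smooth.\<close>

definition rapid :: "(real \<Rightarrow> complex) \<Rightarrow> bool" where
  "rapid w \<longleftrightarrow> continuous_on UNIV w \<and> (\<forall>j. \<exists>C. \<forall>x. \<bar>x\<bar> ^ j * norm (w x) \<le> C)"

lemma integrable_inverse_1_plus_square_UNIV: "integrable lborel (\<lambda>x::real. 1 / (1 + x\<^sup>2))"
  using integrable_inverse_1_plus_square by (simp add: set_integrable_def divide_inverse)

lemma one_plus_power_le: "0 \<le> (t::real) \<Longrightarrow> (1 + t) ^ n \<le> 2 ^ n * (1 + t ^ n)"
proof -
  assume t: "0 \<le> t"
  have "(1 + t) ^ n \<le> (2 * max 1 t) ^ n" using t by (intro power_mono) auto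
  also have "\<dots> = 2 ^ n * (max 1 t) ^ n" by (simp add: power_mult_distrib)
  also have "(max 1 t) ^ n \<le> 1 + t ^ n" using t by (auto simp: max_def)
  finally show ?thesis by simp
qed

lemma one_plus_square_power_le: "(1 + x\<^sup>2) ^ m \<le> (1 + \<bar>x\<bar>) ^ (2 * m)" for x :: real
  unfolding power_mult by (intro power_mono) (auto simp: power2_eq_square algebra_simps abs_mult_self_eq)

lemma rapid_bound:
  assumes "rapid w" obtains C where "0 \<le> C" "\<And>x. (1 + x\<^sup>2) ^ m * norm (w x) \<le> C"
proof -
  obtain A B where AB: "\<And>x. \<bar>x\<bar> ^ 0 * norm (w x) \<le> A" "\<And>x. \<bar>x\<bar> ^ (2 * m) * norm (w x) \<le> B"
    using assms unfolding rapid_def by metis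
  have bd: "(1 + x\<^sup>2) ^ m * norm (w x) \<le> 2 ^ (2 * m) * (A + B)" for x
  proof -
    have "(1 + x\<^sup>2) ^ m * norm (w x) \<le> 2 ^ (2 * m) * (1 + \<bar>x\<bar> ^ (2 * m)) * norm (w x)"
      using order_trans[OF one_plus_square_power_le one_plus_power_le[of "\<bar>x\<bar>" "2 * m"]]
      by (intro mult_right_mono) auto
    also have "\<dots> = 2 ^ (2 * m) * (\<bar>x\<bar> ^ 0 * norm (w x) + \<bar>x\<bar> ^ (2 * m) * norm (w x))"
      by (simp add: algebra_simps)
    also have "\<dots> \<le> 2 ^ (2 * m) * (A + B)" using AB[of x] by (intro mult_left_mono add_mono) auto
    finally show ?thesis .
  qed
  show ?thesis
  proof (rule that[OF _ bd])
    show "0 \<le> 2 ^ (2 * m) * (A + B)" using order_trans[OF _ bd[of 0]] by simp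
  qed
qed

lemma rapid_bounded:
  assumes "rapid w" obtains C where "0 \<le> C" "\<And>x. norm (w x) \<le> C"
  using rapid_bound[OF assms, of 0] by auto

lemma integrable_if_decay:
  fixes w :: "real \<Rightarrow> 'a :: {banach, second_countable_topology}"
  assumes "w \<in> borel_measurable lborel" "\<And>x. (1 + x\<^sup>2) * norm (w x) \<le> C"
  shows "integrable lborel w"
proof (rule Bochner_Integration.integrable_bound)
  show "integrable lborel (\<lambda>x. C * (1 / (1 + x\<^sup>2)))"
    using integrable_inverse_1_plus_square_UNIV by (rule integrable_mult_right)
  show "AE x in lborel. norm (w x) \<le> norm (C * (1 / (1 + x\<^sup>2)))"
  proof (rule AE_I2)
    fix x :: real
    have p: "0 < 1 + x\<^sup>2" by (simp add: add_pos_nonneg)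
    have "norm (w x) \<le> C / (1 + x\<^sup>2)" using assms(2)[of x] p by (simp add: pos_le_divide_eq mult.commute)
    also have "\<dots> \<le> norm (C * (1 / (1 + x\<^sup>2)))" using abs_ge_self[of "C / (1 + x\<^sup>2)"] by simp
    finally show "norm (w x) \<le> norm (C * (1 / (1 + x\<^sup>2)))" .
  qed
qed (use assms in auto)

lemma borel_measurable_continuous_UNIV:
  "continuous_on UNIV f \<Longrightarrow> f \<in> borel_measurable lborel"
  by (simp add: borel_measurable_continuous_onI)

lemma rapid_measurable: "rapid w \<Longrightarrow> w \<in> borel_measurable lborel"
  unfolding rapid_def using borel_measurable_continuous_UNIV by blast

lemma rapid_times_power:
  assumes "rapid w" shows "rapid (\<lambda>x. (c * of_real x) ^ k * w x)"
  unfolding rapid_def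
proof (intro conjI allI)
  show "continuous_on UNIV (\<lambda>x. (c * of_real x) ^ k * w x)"
    using assms unfolding rapid_def by (intro continuous_intros) auto
  fix j
  obtain C where "\<And>x. \<bar>x\<bar> ^ (j + k) * norm (w x) \<le> C" using assms unfolding rapid_def by metis
  then have "\<bar>x\<bar> ^ j * norm ((c * of_real x) ^ k * w x) \<le> norm c ^ k * C" for x
    using mult_left_mono[of "\<bar>x\<bar> ^ (j + k) * norm (w x)" C "norm c ^ k"]
    by (simp add: norm_mult norm_power power_mult_distrib power_add mult_ac)
  then show "\<exists>C. \<forall>x. \<bar>x\<bar> ^ j * norm ((c * of_real x) ^ k * w x) \<le> C" by blast
qed

lemma rapid_integrable: "rapid w \<Longrightarrow> integrable lborel w"
  using rapid_bound[of w 1] integrable_if_decay[of w] rapid_measurable[of w] by (metis power_one_right)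

lemma rapid_uminus:
  assumes "rapid w" shows "rapid (\<lambda>x. w (- x))"
  unfolding rapid_def
proof (intro conjI allI)
  show "continuous_on UNIV (\<lambda>x. w (- x))"
    using assms unfolding rapid_def by (auto intro!: continuous_on_compose2[of UNIV w] continuous_intros)
  fix j
  obtain C where "\<And>x. \<bar>x\<bar> ^ j * norm (w x) \<le> C" using assms unfolding rapid_def by metis
  from this[of "- x" for x] show "\<exists>C. \<forall>x. \<bar>x\<bar> ^ j * norm (w (- x)) \<le> C" by auto
qed

lemma rapid_cmult:
  assumes "rapid w" shows "rapid (\<lambda>x. c * w x)"
  using assms unfolding rapid_def
proof (intro conjI allI)
  fix j assume "continuous_on UNIV w \<and> (\<forall>j. \<exists>C. \<forall>x. \<bar>x\<bar> ^ j * norm (w x) \<le> C)"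
  then obtain C where "\<And>x. \<bar>x\<bar> ^ j * norm (w x) \<le> C" by metis
  then have "\<bar>x\<bar> ^ j * norm (c * w x) \<le> norm c * C" for x
    using mult_left_mono[of "\<bar>x\<bar> ^ j * norm (w x)" C "norm c"] by (simp add: norm_mult mult_ac)
  then show "\<exists>C. \<forall>x. \<bar>x\<bar> ^ j * norm (c * w x) \<le> C" by blast
qed (auto intro!: continuous_intros)

lemma test_funs_rapid:
  assumes "u \<in> test_funs" shows "rapid u"
  unfolding rapid_def
proof (intro conjI allI)
  show c: "continuous_on UNIV u" using assms by (simp add: test_funs_smooth smooth_continuous_on_0)
  fix j
  obtain R where R: "R > 0" "\<And>x. R < \<bar>x\<bar> \<Longrightarrow> u x = 0" using test_funsE[OF assms] by metis
  obtain B where B: "0 \<le> B" "\<And>x. norm (u x) \<le> B" using bounded_compact_support[OF c R(2)] by blast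
  have "\<bar>x\<bar> ^ j * norm (u x) \<le> R ^ j * B" for x
  proof (cases "R < \<bar>x\<bar>")
    case True then show ?thesis using R B by simp
  next
    case False then show ?thesis using R B by (intro mult_mono power_mono) auto
  qed
  then show "\<exists>C. \<forall>x. \<bar>x\<bar> ^ j * norm (u x) \<le> C" by blast
qed

section \<open>Fourier integrals\<close>

text \<open>The sign is positive and there is no normalising factor: \<open>fourier\<close> is its
  reflection up to a constant, and the inverse of \<open>fourier\<close> is again \<open>osc\<close>
  up to a constant, so one function serves both directions.\<close>

definition osc :: "(real \<Rightarrow> complex) \<Rightarrow> real \<Rightarrow> complex" where
  "osc w \<xi> = (LINT x|lborel. exp (\<i> * of_real (x * \<xi>)) * w x)"

lemma fourier_osc: "fourier u \<xi> = of_real (1 / sqrt (2 * pi)) * osc u (- \<xi>)"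
  by (simp add: fourier_def osc_def)

lemma norm_exp_i_times_real [simp]: "norm (exp (\<i> * of_real x)) = 1"
  by simp

lemma integrable_exp_mult:
  assumes "integrable lborel w"
  shows "integrable lborel (\<lambda>x. exp (\<i> * of_real (x * \<xi>)) * w x)"
proof (rule Bochner_Integration.integrable_bound[OF assms])
  show "(\<lambda>x. exp (\<i> * of_real (x * \<xi>)) * w x) \<in> borel_measurable lborel"
    using assms by measurable
qed (simp add: norm_mult)

lemma norm_lebesgue_integral_le:
  fixes f :: "'a \<Rightarrow> 'b :: {banach, second_countable_topology}"
  assumes "integrable M g" "\<And>x. norm (f x) \<le> g x"
  shows "norm (LINT x|M. f x) \<le> (LINT x|M. g x)"
  using assms by (intro order_trans[OF integral_norm_bound] integral_mono') (auto intro: order_trans[OF norm_ge_zero])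

lemma osc_norm_le: "norm (osc w \<xi>) \<le> (LINT x|lborel. norm (w x))"
  unfolding osc_def using integral_norm_bound[of lborel "\<lambda>x. exp (\<i> * of_real (x * \<xi>)) * w x"]
  by (simp add: norm_mult)

lemma osc_add:
  assumes "integrable lborel u" "integrable lborel v"
  shows "osc (\<lambda>x. u x + v x) \<xi> = osc u \<xi> + osc v \<xi>"
  using integrable_exp_mult[OF assms(1)] integrable_exp_mult[OF assms(2)]
  by (simp add: osc_def distrib_left)

lemma osc_cmult: "osc (\<lambda>x. c * u x) \<xi> = c * osc u \<xi>"
  by (simp add: osc_def mult.left_commute)

lemma norm_exp_i_sub_le: "norm (exp (\<i> * of_real t) - 1 - \<i> * of_real t) \<le> t\<^sup>2 / 2"
  using iexp_approx1[of t 1] by (simp add: algebra_simps power2_eq_square abs_mult_self_eq)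

text \<open>The Taylor remainder of the exponential is at most half the square of its argument, so
  the second moment of \<open>w\<close> bounds the error by a multiple of \<open>h\<^sup>2\<close>;
  no limit is taken under the integral sign.\<close>

lemma osc_has_vector_derivative:
  assumes w: "integrable lborel w" "integrable lborel (\<lambda>x. of_real x * w x)"
    "integrable lborel (\<lambda>x. (of_real x)\<^sup>2 * w x)"
  shows "(osc w has_vector_derivative \<i> * osc (\<lambda>x. of_real x * w x) \<xi>) (at \<xi>)"
proof -
  define K where "K = (LINT x|lborel. norm ((of_real x)\<^sup>2 * w x))"
  have est: "norm (osc w (\<xi> + h) - osc w \<xi> - h *\<^sub>R (\<i> * osc (\<lambda>x. of_real x * w x) \<xi>)) \<le> h\<^sup>2 * K" for h
  proof -
    have "osc w (\<xi> + h) - osc w \<xi> - h *\<^sub>R (\<i> * osc (\<lambda>x. of_real x * w x) \<xi>) =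
       (LINT x|lborel. exp (\<i> * of_real (x * (\<xi> + h))) * w x - exp (\<i> * of_real (x * \<xi>)) * w x
          - of_real h * (\<i> * (exp (\<i> * of_real (x * \<xi>)) * (of_real x * w x))))"
      using integrable_exp_mult[OF w(1), of "\<xi> + h"] integrable_exp_mult[OF w(1), of \<xi>] integrable_exp_mult[OF w(2), of \<xi>]
      by (simp add: osc_def scaleR_conv_of_real del: of_real_mult of_real_add)
    also have "\<dots> = (LINT x|lborel. exp (\<i> * of_real (x * \<xi>)) *
        (exp (\<i> * of_real (x * h)) - 1 - \<i> * of_real (x * h)) * w x)"
      by (intro Bochner_Integration.integral_cong) (auto simp: algebra_simps exp_add)
    also have "norm \<dots> \<le> (LINT x|lborel. h\<^sup>2 * norm ((of_real x)\<^sup>2 * w x))"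
    proof (rule norm_lebesgue_integral_le)
      show "integrable lborel (\<lambda>x. h\<^sup>2 * norm ((of_real x)\<^sup>2 * w x))" using w(3) by simp
      fix x
      have "norm (exp (\<i> * of_real (x * h)) - 1 - \<i> * of_real (x * h)) * norm (w x) \<le> (x * h)\<^sup>2 / 2 * norm (w x)"
        by (intro mult_right_mono norm_exp_i_sub_le) auto
      also have "\<dots> \<le> h\<^sup>2 * norm ((of_real x)\<^sup>2 * w x)"
        by (simp add: norm_mult norm_power power_mult_distrib)
      finally show "norm (exp (\<i> * of_real (x * \<xi>)) *
        (exp (\<i> * of_real (x * h)) - 1 - \<i> * of_real (x * h)) * w x) \<le> h\<^sup>2 * norm ((of_real x)\<^sup>2 * w x)"
        by (simp add: norm_mult)
    qed
    finally show ?thesis by (simp add: K_def)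
  qed
  have "((\<lambda>h. norm (osc w (\<xi> + h) - osc w \<xi> - h *\<^sub>R (\<i> * osc (\<lambda>x. of_real x * w x) \<xi>)) / norm h) \<longlongrightarrow> 0) (at 0)"
  proof (rule Lim_null_comparison)
    show "\<forall>\<^sub>F h in at 0. norm (norm (osc w (\<xi> + h) - osc w \<xi> - h *\<^sub>R (\<i> * osc (\<lambda>x. of_real x * w x) \<xi>)) / norm h) \<le> \<bar>h\<bar> * K"
    proof (rule eventually_at_topological[THEN iffD2], intro exI[of _ UNIV] conjI ballI impI)
      fix h :: real assume "h \<noteq> 0"
      then show "norm (norm (osc w (\<xi> + h) - osc w \<xi> - h *\<^sub>R (\<i> * osc (\<lambda>x. of_real x * w x) \<xi>)) / norm h) \<le> \<bar>h\<bar> * K"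
        using est[of h] by (simp add: field_simps power2_eq_square abs_mult_self_eq)
    qed auto
    show "((\<lambda>h. \<bar>h\<bar> * K) \<longlongrightarrow> 0) (at 0)" by (auto intro!: tendsto_eq_intros)
  qed
  then show ?thesis
    unfolding has_vector_derivative_def has_derivative_at by (auto intro!: bounded_linear_scaleR_left)
qed

text \<open>Separate from \<open>rapid\<close>, which includes continuity, because truncations of a
  function to an interval have to be covered as well.\<close>

definition moments :: "(real \<Rightarrow> complex) \<Rightarrow> bool" where
  "moments w \<longleftrightarrow> (\<forall>k. integrable lborel (\<lambda>x. of_real x ^ k * w x))"

lemma rapid_moments: "rapid w \<Longrightarrow> moments w"
  unfolding moments_def using rapid_integrable rapid_times_power[of w 1] by auto

lemma osc_derivs:
  assumes "moments w"
  shows "derivs (osc w) (\<lambda>k. osc (\<lambda>x. (\<i> * of_real x) ^ k * w x))"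
proof -
  have i: "integrable lborel (\<lambda>x. of_real x ^ k * w x)" for k using assms by (simp add: moments_def)
  have "(osc (\<lambda>x. of_real x ^ k * w x) has_vector_derivative \<i> * osc (\<lambda>x. of_real x ^ Suc k * w x) \<xi>) (at \<xi>)" for k \<xi>
    using osc_has_vector_derivative[of "\<lambda>x. of_real x ^ k * w x" \<xi>] i[of k] i[of "Suc k"] i[of "Suc (Suc k)"]
    by (simp add: power2_eq_square mult.assoc)
  from derivs_powers[of "\<lambda>k. osc (\<lambda>x. of_real x ^ k * w x)" \<i>, OF this] show ?thesis
    by (simp add: power_mult_distrib mult.assoc osc_cmult[abs_def])
qed

lemma integrable_pair_mult_bounded:
  fixes p q :: "real \<Rightarrow> complex"
  assumes p: "integrable lborel p" and q: "integrable lborel q"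
    and k: "(\<lambda>(x, y). k x y) \<in> borel_measurable (lborel \<Otimes>\<^sub>M lborel)" and b: "\<And>x y. norm (k x y) \<le> B"
  shows "integrable (lborel \<Otimes>\<^sub>M lborel) (\<lambda>(x, y). p x * q y * (k x y :: complex))"
proof -
  have pq: "integrable (lborel \<Otimes>\<^sub>M lborel) (\<lambda>(x, y). p x * q y)"
  proof (rule lborel_pair.Fubini_integrable)
    show "(\<lambda>(x, y). p x * q y) \<in> borel_measurable (lborel \<Otimes>\<^sub>M lborel)" using p q by measurable
    show "integrable lborel (\<lambda>x. LINT y|lborel. norm (case (x, y) of (x, y) \<Rightarrow> p x * q y))"
      using p q by (simp add: norm_mult)
    show "AE x in lborel. integrable lborel (\<lambda>y. case (x, y) of (x, y) \<Rightarrow> p x * q y)"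
      using q by simp
  qed
  show ?thesis
  proof (rule Bochner_Integration.integrable_bound)
    show "integrable (lborel \<Otimes>\<^sub>M lborel) (\<lambda>x. B * norm (case x of (x, y) \<Rightarrow> p x * q y))"
      using pq by simp
    have m: "(\<lambda>z. k (fst z) (snd z)) \<in> borel_measurable (lborel \<Otimes>\<^sub>M lborel)"
      using k by (simp add: case_prod_beta)
    have "(\<lambda>z. p (fst z) * q (snd z) * k (fst z) (snd z)) \<in> borel_measurable (lborel \<Otimes>\<^sub>M lborel)"
      using p q m by measurable
    then show "(\<lambda>(x, y). p x * q y * k x y) \<in> borel_measurable (lborel \<Otimes>\<^sub>M lborel)"
      by (simp add: case_prod_beta)
    have "norm (p x * q y * k x y) \<le> norm (B * norm (p x * q y))" for x y
    proof -
      have "norm (p x * q y) * norm (k x y) \<le> norm (p x * q y) * B" by (intro mult_left_mono b) auto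
      then show ?thesis by (simp add: norm_mult mult_ac)
    qed
    then show "AE x in lborel \<Otimes>\<^sub>M lborel. norm (case x of (x, y) \<Rightarrow> p x * q y * k x y)
         \<le> norm (B * norm (case x of (x, y) \<Rightarrow> p x * q y))"
      by (intro AE_I2) (simp add: case_prod_beta)
  qed
qed

text \<open>The form in which Fubini's theorem is used for oscillating kernels: two integrable
  factors in separate variables and a bounded kernel joining them.\<close>

lemma Fubini_mult_bounded:
  fixes p q :: "real \<Rightarrow> complex"
  assumes p: "integrable lborel p" and q: "integrable lborel q"
    and k: "(\<lambda>(x, y). k x y) \<in> borel_measurable (lborel \<Otimes>\<^sub>M lborel)" and b: "\<And>x y. norm (k x y) \<le> B"
  shows "(LINT y|lborel. LINT x|lborel. p x * q y * k x y) = (LINT x|lborel. LINT y|lborel. p x * q y * (k x y :: complex))"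
  using lborel_pair.Fubini_integral[OF integrable_pair_mult_bounded[OF assms]] by simp

section \<open>The Gaussian integral and Fourier inversion\<close>

lemma gaussian_osc:
  assumes n: "0 < n"
  shows "(LINT \<xi>|lborel. exp (\<i> * of_real (s * \<xi>)) * of_real (exp (- (\<xi> / n)\<^sup>2 / 2))) =
    of_real (n * sqrt (2 * pi) * exp (- (s * n)\<^sup>2 / 2))"
proof -
  \<comment> \<open>The integral is the characteristic function of the standard normal distribution,
    up to rescaling by \<open>n\<close>.\<close>
  have "char std_normal_distribution (s * n) = (LINT z|lborel. std_normal_density z *\<^sub>R iexp (s * n * z))"
    unfolding char_def by (subst integral_density) (auto simp: normal_density_nonneg)
  then have *: "(LINT z|lborel. std_normal_density z *\<^sub>R iexp (s * n * z)) = of_real (exp (- (s * n)\<^sup>2 / 2))"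
    by (simp add: char_std_normal_distribution)
  have "(LINT \<xi>|lborel. exp (\<i> * of_real (s * \<xi>)) * of_real (exp (- (\<xi> / n)\<^sup>2 / 2))) =
     \<bar>n\<bar> *\<^sub>R (LINT z|lborel. exp (\<i> * of_real (s * (0 + n * z))) * of_real (exp (- ((0 + n * z) / n)\<^sup>2 / 2)))"
    using n by (intro lborel_integral_real_affine) auto
  also have "(LINT z|lborel. exp (\<i> * of_real (s * (0 + n * z))) * of_real (exp (- ((0 + n * z) / n)\<^sup>2 / 2))) =
     (LINT z|lborel. of_real (sqrt (2 * pi)) * (std_normal_density z *\<^sub>R iexp (s * n * z)))"
    using n by (intro Bochner_Integration.integral_cong)
      (auto simp: std_normal_density_def scaleR_conv_of_real mult_ac)
  also have "\<dots> = of_real (sqrt (2 * pi)) * of_real (exp (- (s * n)\<^sup>2 / 2))"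
    unfolding *[symmetric] by (rule integral_mult_right_zero)
  finally show ?thesis using n by (simp add: scaleR_conv_of_real)
qed

lemma gaussian_integral: "integrable lborel (\<lambda>z::real. exp (- z\<^sup>2 / 2))"
    "(LINT z|lborel. exp (- z\<^sup>2 / 2)) = sqrt (2 * pi)"
proof -
  have e: "exp (- z\<^sup>2 / 2) = sqrt (2 * pi) * std_normal_density z" for z :: real
    by (simp add: std_normal_density_def)
  show "integrable lborel (\<lambda>z::real. exp (- z\<^sup>2 / 2))" unfolding e by simp
  show "(LINT z|lborel. exp (- z\<^sup>2 / 2)) = sqrt (2 * pi)" unfolding e by simp
qed

text \<open>The divergent integral obtained by interchanging the integrations is regularised by the
  factor \<open>exp (- (\<xi> / n)\<^sup>2 / 2)\<close>.\<close>

theorem fourier_inversion: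
  assumes f: "integrable lborel f" "continuous_on UNIV f" "\<And>x. norm (f x) \<le> B"
    and F: "integrable lborel (\<lambda>\<xi>. osc f (- \<xi>))"
  shows "osc (\<lambda>\<xi>. osc f (- \<xi>)) x = of_real (2 * pi) * f x"
proof -
  \<comment> \<open>\<open>I n\<close> is evaluated twice as \<open>n\<close> grows: dominated
    convergence removes the Gaussian factor, while Fubini turns \<open>I n\<close> into an average
    of \<open>f\<close> near \<open>x\<close>.\<close>
  define I where "I n = (LINT \<xi>|lborel. exp (\<i> * of_real (\<xi> * x)) * osc f (- \<xi>) * of_real (exp (- (\<xi> / n)\<^sup>2 / 2)))" for n :: real
  have lim1: "(\<lambda>n. I (real (Suc n))) \<longlonglongrightarrow> osc (\<lambda>\<xi>. osc f (- \<xi>)) x"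
    unfolding I_def osc_def[of "\<lambda>\<xi>. osc f (- \<xi>)"]
  proof (rule integral_dominated_convergence)
    show "integrable lborel (\<lambda>\<xi>. norm (osc f (- \<xi>)))" using F by simp
    show "AE \<xi> in lborel. (\<lambda>n. exp (\<i> * of_real (\<xi> * x)) * osc f (- \<xi>) * of_real (exp (- (\<xi> / real (Suc n))\<^sup>2 / 2)))
        \<longlonglongrightarrow> exp (\<i> * of_real (\<xi> * x)) * osc f (- \<xi>)"
    proof (rule AE_I2)
      fix \<xi> :: real
      have "(\<lambda>n. \<xi> / real (Suc n)) \<longlonglongrightarrow> 0" by (rule LIMSEQ_Suc[OF lim_const_over_n])
      from tendsto_exp[OF tendsto_divide[OF tendsto_minus[OF tendsto_power[OF this, of 2]] tendsto_const, of 2]]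
      have "(\<lambda>n. exp (- (\<xi> / real (Suc n))\<^sup>2 / 2)) \<longlonglongrightarrow> exp (- 0\<^sup>2 / 2)" by simp
      then have "(\<lambda>n. exp (\<i> * of_real (\<xi> * x)) * osc f (- \<xi>) * of_real (exp (- (\<xi> / real (Suc n))\<^sup>2 / 2)))
        \<longlonglongrightarrow> exp (\<i> * of_real (\<xi> * x)) * osc f (- \<xi>) * of_real (exp (- 0\<^sup>2 / 2))"
        by (intro tendsto_mult tendsto_const tendsto_of_real)
      then show "(\<lambda>n. exp (\<i> * of_real (\<xi> * x)) * osc f (- \<xi>) * of_real (exp (- (\<xi> / real (Suc n))\<^sup>2 / 2)))
        \<longlonglongrightarrow> exp (\<i> * of_real (\<xi> * x)) * osc f (- \<xi>)" by simp
    qed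
    show "AE \<xi> in lborel. norm (exp (\<i> * of_real (\<xi> * x)) * osc f (- \<xi>) * of_real (exp (- (\<xi> / real (Suc n))\<^sup>2 / 2)))
       \<le> norm (osc f (- \<xi>))" for n
      by (intro AE_I2) (simp add: norm_mult mult_left_le)
    show "(\<lambda>\<xi>. exp (\<i> * of_real (\<xi> * x)) * osc f (- \<xi>)) \<in> borel_measurable lborel"
      using integrable_exp_mult[OF F] by measurable
    show "(\<lambda>\<xi>. exp (\<i> * of_real (\<xi> * x)) * osc f (- \<xi>) * of_real (exp (- (\<xi> / real (Suc n))\<^sup>2 / 2))) \<in> borel_measurable lborel" for n
      using F by measurable
  qed
  have I: "I (real (Suc n)) = of_real (sqrt (2 * pi)) * (LINT z|lborel. f (x + z / real (Suc n)) * of_real (exp (- z\<^sup>2 / 2)))" for n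
  proof -
    define N where "N = real (Suc n)"
    have N: "N > 0" by (simp add: N_def)
    have gi: "integrable lborel (\<lambda>\<xi>. complex_of_real (exp (- (\<xi> / N)\<^sup>2 / 2)))"
    proof -
      have "integrable lborel (\<lambda>\<xi>. exp (- (0 + (1 / N) * \<xi>)\<^sup>2 / 2))"
        using N gaussian_integral(1) by (subst lborel_integrable_real_affine_iff) auto
      then show ?thesis by (intro integrable_of_real) (simp add: mult.commute)
    qed
    have "I N = (LINT \<xi>|lborel. LINT y|lborel. f y * of_real (exp (- (\<xi> / N)\<^sup>2 / 2)) * exp (\<i> * of_real ((x - y) * \<xi>)))"
      unfolding I_def osc_def
      by (intro Bochner_Integration.integral_cong refl)
         (simp add: mult.commute[of _ "LINT x|lborel. _ x"] mult.commute[of "LINT x|lborel. _ x"] algebra_simps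
           flip: integral_mult_left_zero integral_mult_right_zero exp_add)
    also have "\<dots> = (LINT y|lborel. LINT \<xi>|lborel. f y * of_real (exp (- (\<xi> / N)\<^sup>2 / 2)) * exp (\<i> * of_real ((x - y) * \<xi>)))"
      by (rule Fubini_mult_bounded[OF f(1) gi, where B = 1]) auto
    also have "\<dots> = (LINT y|lborel. f y * of_real (N * sqrt (2 * pi) * exp (- ((x - y) * N)\<^sup>2 / 2)))"
      unfolding gaussian_osc[OF N, symmetric] integral_mult_right_zero[symmetric]
      by (simp only: mult_ac)
    \<comment> \<open>The substitution \<open>y = x + z / N\<close>: its Jacobian cancels the factor
      \<open>N\<close>, and the arguments of \<open>f\<close> concentrate at
      \<open>x\<close>.\<close>
    also have "\<dots> = \<bar>1 / N\<bar> *\<^sub>R (LINT z|lborel. f (x + (1 / N) * z) * of_real (N * sqrt (2 * pi) * exp (- ((x - (x + (1 / N) * z)) * N)\<^sup>2 / 2)))"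
      using N by (intro lborel_integral_real_affine) auto
    also have "\<dots> = of_real (sqrt (2 * pi)) * (LINT z|lborel. f (x + z / N) * of_real (exp (- z\<^sup>2 / 2)))"
    proof -
      have "(LINT z|lborel. f (x + (1 / N) * z) * of_real (N * sqrt (2 * pi) * exp (- ((x - (x + (1 / N) * z)) * N)\<^sup>2 / 2)))
        = (LINT z|lborel. of_real (N * sqrt (2 * pi)) * (f (x + z / N) * of_real (exp (- z\<^sup>2 / 2))))"
        using N by (intro Bochner_Integration.integral_cong) (auto simp: field_simps)
      then show ?thesis using N by (simp add: scaleR_conv_of_real)
    qed
    finally show ?thesis by (simp add: N_def)
  qed
  have lim2: "(\<lambda>n. LINT z|lborel. f (x + z / real (Suc n)) * of_real (exp (- z\<^sup>2 / 2))) \<longlonglongrightarrow> (LINT z|lborel. f x * of_real (exp (- z\<^sup>2 / 2)))"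
  proof (rule integral_dominated_convergence)
    show "integrable lborel (\<lambda>z::real. B * exp (- z\<^sup>2 / 2))" using gaussian_integral(1) by simp
    have fm: "f \<in> borel_measurable borel" using f(2) by (simp add: borel_measurable_continuous_onI)
    then show "(\<lambda>z. f (x + z / real (Suc n)) * of_real (exp (- z\<^sup>2 / 2))) \<in> borel_measurable lborel" for n
      by measurable
    show "AE z in lborel. (\<lambda>n. f (x + z / real (Suc n)) * of_real (exp (- z\<^sup>2 / 2))) \<longlonglongrightarrow> f x * of_real (exp (- z\<^sup>2 / 2))"
    proof (rule AE_I2)
      fix z :: real
      have "(\<lambda>n. x + z / real (Suc n)) \<longlonglongrightarrow> x + 0"
        by (intro tendsto_intros LIMSEQ_Suc[OF lim_const_over_n])
      moreover have "isCont f x" using f(2) by (simp add: continuous_on_eq_continuous_at)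
      ultimately have "(\<lambda>n. f (x + z / real (Suc n))) \<longlonglongrightarrow> f x"
        using isCont_tendsto_compose by fastforce
      then show "(\<lambda>n. f (x + z / real (Suc n)) * of_real (exp (- z\<^sup>2 / 2))) \<longlonglongrightarrow> f x * of_real (exp (- z\<^sup>2 / 2))"
        by (intro tendsto_intros)
    qed
    show "AE z in lborel. norm (f (x + z / real (Suc n)) * of_real (exp (- z\<^sup>2 / 2))) \<le> B * exp (- z\<^sup>2 / 2)" for n
      using f(3) by (intro AE_I2) (simp add: norm_mult)
  qed simp
  have val: "(LINT z|lborel. f x * of_real (exp (- z\<^sup>2 / 2))) = f x * of_real (sqrt (2 * pi))"
    unfolding gaussian_integral(2)[symmetric] integral_complex_of_real[symmetric] by (rule integral_mult_right_zero)
  have "osc (\<lambda>\<xi>. osc f (- \<xi>)) x = of_real (sqrt (2 * pi)) * (f x * of_real (sqrt (2 * pi)))"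
    using LIMSEQ_unique[OF lim1[unfolded I] tendsto_mult[OF tendsto_const lim2[unfolded val]]] .
  also have "\<dots> = of_real (sqrt (2 * pi) * sqrt (2 * pi)) * f x" by (simp only: of_real_mult mult_ac)
  finally show ?thesis by simp
qed

section \<open>The Paley-Wiener theorem\<close>

definition complex_osc :: "(real \<Rightarrow> complex) \<Rightarrow> complex \<Rightarrow> complex" where
  "complex_osc u z = (LINT x|lborel. exp (\<i> * z * of_real x) * u x)"

lemma complex_osc_of_real: "complex_osc u (of_real \<xi>) = osc u \<xi>"
  unfolding complex_osc_def osc_def by (simp add: mult_ac)

lemma integrable_compact_support:
  fixes f :: "real \<Rightarrow> complex"
  assumes "continuous_on UNIV f" "\<And>x. R < \<bar>x\<bar> \<Longrightarrow> f x = 0"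
  shows "integrable lborel f" "(LINT x|lborel. f x) = integral {-R..R} f"
proof -
  have f: "f = (\<lambda>x. indicator {-R..R} x *\<^sub>R f x)"
    using assms(2) by (auto simp: fun_eq_iff indicator_def abs_if split: if_splits)
  have "set_integrable lborel {-R..R} f"
    using assms(1) by (intro borel_integrable_atLeastAtMost') (auto intro: continuous_on_subset)
  then show "integrable lborel f" "(LINT x|lborel. f x) = integral {-R..R} f"
    using set_borel_integral_eq_integral(2)[of "{-R..R}" f]
    by (simp_all add: set_integrable_def set_lebesgue_integral_def f[symmetric])
qed

text \<open>As a gauge integral over a compact interval the transform admits differentiation under
  the integral sign and integration by parts.\<close>

lemma complex_osc_eq_integral:
  assumes "continuous_on UNIV u" "\<And>x. R < \<bar>x\<bar> \<Longrightarrow> u x = 0"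
  shows "complex_osc u z = integral {-R..R} (\<lambda>x. exp (\<i> * z * of_real x) * u x)"
  unfolding complex_osc_def using assms
  by (intro integrable_compact_support) (auto intro!: continuous_intros)

lemma complex_osc_holomorphic:
  assumes "u \<in> test_funs" shows "complex_osc u holomorphic_on UNIV"
proof -
  have c: "continuous_on UNIV u" using assms by (simp add: test_funs_smooth smooth_continuous_on_0)
  obtain R where R: "R > 0" "\<And>x. R < \<bar>x\<bar> \<Longrightarrow> u x = 0" using test_funsE[OF assms] by metis
  have "(\<lambda>z. integral (cbox (-R) R) (\<lambda>x. exp (\<i> * z * of_real x) * u x)) holomorphic_on UNIV"
  proof (rule leibniz_rule_holomorphic[where fx = "\<lambda>z x. \<i> * of_real x * exp (\<i> * z * of_real x) * u x"])
    show "((\<lambda>z. exp (\<i> * z * of_real x) * u x) has_field_derivative \<i> * of_real x * exp (\<i> * z * of_real x) * u x)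
      (at z within UNIV)" for z x
      by (auto intro!: derivative_eq_intros)
    show "(\<lambda>x. exp (\<i> * z * of_real x) * u x) integrable_on cbox (- R) R" for z
      using c by (intro integrable_continuous continuous_intros) (auto intro: continuous_on_subset)
    show "continuous_on (UNIV \<times> cbox (- R) R) (\<lambda>(z, x). \<i> * of_real x * exp (\<i> * z * of_real x) * u x)"
      unfolding split_beta by (intro continuous_intros continuous_on_compose2[OF c]) auto
  qed auto
  also have "(\<lambda>z. integral (cbox (-R) R) (\<lambda>x. exp (\<i> * z * of_real x) * u x)) = complex_osc u"
    using complex_osc_eq_integral[of u R] c R by (simp add: fun_eq_iff)
  finally show ?thesis .
qed

lemma holomorphic_on_minus_arg:
  assumes "f holomorphic_on UNIV" shows "(\<lambda>z. f (- z)) holomorphic_on UNIV"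
proof -
  have "(\<lambda>z::complex. - z) holomorphic_on UNIV" by (intro holomorphic_intros)
  from holomorphic_on_compose[OF this holomorphic_on_subset[OF assms]] show ?thesis by (simp add: o_def)
qed

lemma nth_deriv_test_funs:
  assumes "u \<in> test_funs" shows "nth_deriv k u \<in> test_funs"
proof -
  obtain R where R: "R > 0" "\<And>x. R < \<bar>x\<bar> \<Longrightarrow> u x = 0" using test_funsE[OF assms] by metis
  have "derivs (nth_deriv k u) (\<lambda>j. nth_deriv (k + j) u)"
    using smooth_has_vector_derivative[OF test_funs_smooth[OF assms]] by (simp add: derivs_def)
  then show ?thesis
    using R nth_deriv_eq_0_outside[of R u] derivs_imp_smooth unfolding test_funs_iff by blast
qed

lemma complex_osc_deriv:
  assumes "u \<in> test_funs"
  shows "z * complex_osc u z = \<i> * complex_osc (nth_deriv 1 u) z"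
proof -
  obtain R where R: "R > 0" "\<And>x. R < \<bar>x\<bar> \<Longrightarrow> u x = 0" using test_funsE[OF assms] by metis
  have s: "smooth u" using assms by (rule test_funs_smooth)
  have c: "continuous_on UNIV u" "continuous_on UNIV (nth_deriv 1 u)"
    using s by (auto intro: smooth_continuous_on smooth_continuous_on_0)
  \<comment> \<open>\<open>u\<close> is known to vanish only for \<open>\<bar>x\<bar> > R\<close>,
    so the interval is enlarged by \<open>1\<close> to make the boundary terms vanish at its end
    points.\<close>
  have u0: "\<And>x. R + 1 < \<bar>x\<bar> \<Longrightarrow> u x = 0" "\<And>x. R + 1 < \<bar>x\<bar> \<Longrightarrow> nth_deriv 1 u x = 0"
    using R nth_deriv_eq_0_outside[of R u] by auto
  let ?f = "\<lambda>x. \<i> * z * (exp (\<i> * z * of_real x) * u x) + exp (\<i> * z * of_real x) * nth_deriv 1 u x"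
  have "((\<lambda>x. exp (\<i> * z * of_real x) * u x) has_vector_derivative ?f x) (at x within {-(R+1)..R+1})" for x
  proof -
    have "((\<lambda>x. exp (\<i> * z * of_real x)) has_vector_derivative (\<i> * z * exp (\<i> * z * of_real x))) (at x)"
      by (intro has_vector_derivative_real_field) (auto intro!: derivative_eq_intros)
    from has_vector_derivative_mult[OF this smooth_has_vector_derivative[OF s, of 0 x]]
    have "((\<lambda>x. exp (\<i> * z * of_real x) * u x) has_vector_derivative ?f x) (at x)"
      by (simp add: algebra_simps)
    then show ?thesis by (rule has_vector_derivative_at_within)
  qed
  then have "(?f has_integral (exp (\<i> * z * of_real (R+1)) * u (R+1) - exp (\<i> * z * of_real (-(R+1))) * u (-(R+1)))) {-(R+1)..R+1}"
    using R by (intro fundamental_theorem_of_calculus) auto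
  then have "integral {-(R+1)..R+1} ?f = 0" using R(2)[of "R+1"] R(2)[of "-(R+1)"] R(1) by (simp add: integral_unique)
  also have "integral {-(R+1)..R+1} ?f =
     \<i> * z * integral {-(R+1)..R+1} (\<lambda>x. exp (\<i> * z * of_real x) * u x) +
     integral {-(R+1)..R+1} (\<lambda>x. exp (\<i> * z * of_real x) * nth_deriv 1 u x)"
  proof (subst Henstock_Kurzweil_Integration.integral_add)
    show "(\<lambda>x. exp (\<i> * z * of_real x) * nth_deriv 1 u x) integrable_on {- (R + 1)..R + 1}"
      "(\<lambda>x. \<i> * z * (exp (\<i> * z * of_real x) * u x)) integrable_on {- (R + 1)..R + 1}"
      by (intro integrable_continuous_interval continuous_intros continuous_on_subset[OF c(1)]
        continuous_on_subset[OF c(2)]; simp)+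
  qed simp
  also have "\<dots> = \<i> * z * complex_osc u z + complex_osc (nth_deriv 1 u) z"
    using complex_osc_eq_integral[OF c(1), of "R + 1" z] complex_osc_eq_integral[OF c(2), of "R + 1" z] u0 by simp
  finally have "\<i> * (z * complex_osc u z) = \<i> * (\<i> * complex_osc (nth_deriv 1 u) z)"
    by (simp add: algebra_simps eq_neg_iff_add_eq_0)
  then show ?thesis by (metis complex_i_not_zero mult_left_cancel)
qed

lemma complex_osc_power_deriv:
  assumes "u \<in> test_funs"
  shows "norm z ^ n * norm (complex_osc u z) = norm (complex_osc (nth_deriv n u) z)"
proof (induction n)
  case (Suc n)
  have "norm z ^ Suc n * norm (complex_osc u z) = norm (z * complex_osc (nth_deriv n u) z)"
    using Suc by (simp add: norm_mult)
  also have "\<dots> = norm (complex_osc (nth_deriv 1 (nth_deriv n u)) z)"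
    using complex_osc_deriv[OF nth_deriv_test_funs[OF assms], of z n] by (simp add: norm_mult)
  finally show ?case by (simp add: nth_deriv_Suc)
qed simp

lemma complex_osc_bound:
  assumes "u \<in> test_funs" "\<And>x. R < \<bar>x\<bar> \<Longrightarrow> u x = 0"
  obtains C where "0 \<le> C" "\<And>z. norm (complex_osc u z) \<le> C * exp (R * \<bar>Im z\<bar>)"
proof (rule that)
  have i: "integrable lborel u" using assms(1) by (intro rapid_integrable test_funs_rapid)
  show "0 \<le> (LINT x|lborel. norm (u x))" by simp
  show "norm (complex_osc u z) \<le> (LINT x|lborel. norm (u x)) * exp (R * \<bar>Im z\<bar>)" for z
  proof -
    have "norm (complex_osc u z) \<le> (LINT x|lborel. exp (R * \<bar>Im z\<bar>) * norm (u x))"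
      unfolding complex_osc_def
    proof (rule norm_lebesgue_integral_le)
      fix x
      show "norm (exp (\<i> * z * of_real x) * u x) \<le> exp (R * \<bar>Im z\<bar>) * norm (u x)"
      proof (cases "R < \<bar>x\<bar>")
        case False
        have "- (Im z * x) \<le> \<bar>x\<bar> * \<bar>Im z\<bar>" by (metis abs_ge_minus_self abs_mult mult.commute)
        also have "\<dots> \<le> R * \<bar>Im z\<bar>" using False by (intro mult_right_mono) auto
        finally show ?thesis by (auto simp: norm_mult intro!: mult_right_mono)
      qed (use assms in simp)
    qed (use i in simp)
    then show ?thesis by (simp add: mult.commute)
  qed
qed

lemma fourier_complex_osc: "fourier u \<xi> = of_real (1 / sqrt (2 * pi)) * complex_osc u (- of_real \<xi>)"
  using complex_osc_of_real[of u "- \<xi>"] by (simp add: fourier_osc)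

lemma complex_osc_decay:
  assumes "u \<in> test_funs"
  obtains C where "0 \<le> C" "\<And>\<xi>. \<bar>\<xi>\<bar> ^ j * norm (osc u \<xi>) \<le> C"
proof -
  obtain R where R: "R > 0" "\<And>x. R < \<bar>x\<bar> \<Longrightarrow> nth_deriv j u x = 0"
    using test_funsE[OF nth_deriv_test_funs[OF assms]] by metis
  obtain C where C: "0 \<le> C" "\<And>z. norm (complex_osc (nth_deriv j u) z) \<le> C * exp (R * \<bar>Im z\<bar>)"
    using complex_osc_bound[OF nth_deriv_test_funs[OF assms] R(2)] by blast
  show ?thesis
    using that[OF C(1)] complex_osc_power_deriv[OF assms, of "of_real \<xi>" j for \<xi>] C(2)[of "of_real \<xi>" for \<xi>]
    by (simp add: complex_osc_of_real)
qed

lemma moments_test: "u \<in> test_funs \<Longrightarrow> moments u"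
  by (intro rapid_moments test_funs_rapid)

lemma fourier_derivs:
  assumes "moments u"
  shows "derivs (fourier u) (\<lambda>k \<xi>. of_real (1 / sqrt (2 * pi)) * ((- 1) ^ k * osc (\<lambda>x. (\<i> * of_real x) ^ k * u x) (- \<xi>)))"
  using derivs_cmult[OF derivs_affine[OF osc_derivs[OF assms], of "-1" 0], of "of_real (1 / sqrt (2 * pi))"]
  by (simp add: fourier_osc[abs_def])

lemma polynomial_smooth: "smooth (\<lambda>x. (\<i> * of_real x) ^ k)"
proof (induction k)
  case 0 then show ?case using derivs_imp_smooth[OF smooth_const] by simp
next
  case (Suc k)
  have "derivs (\<lambda>x. \<i> * of_real x) (\<lambda>k x. if k = 0 then \<i> * of_real x else if k = 1 then \<i> else 0)"
    unfolding derivs_def by (auto intro!: derivative_eq_intros)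
  from smooth_mult[OF derivs_imp_smooth[OF this] Suc] show ?case by simp
qed

lemma fourier_schwartz:
  assumes "u \<in> test_funs" shows "schwartz (fourier u)"
  unfolding schwartz_def
proof (intro conjI allI)
  note d = fourier_derivs[OF moments_test[OF assms]]
  show "smooth (fourier u)" using d by (rule derivs_imp_smooth)
  fix j k
  have t: "(\<lambda>x. (\<i> * of_real x) ^ k * u x) \<in> test_funs" using assms polynomial_smooth by (rule test_funs_mult')
  obtain C where C: "0 \<le> C" "\<And>\<xi>. \<bar>\<xi>\<bar> ^ j * norm (osc (\<lambda>x. (\<i> * of_real x) ^ k * u x) \<xi>) \<le> C"
    using complex_osc_decay[OF t] by blast
  have "\<bar>x\<bar> ^ j * norm (nth_deriv k (fourier u) x) \<le> (1 / sqrt (2 * pi)) * C" for x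
    unfolding derivs_nth_deriv_eq[OF d]
    using mult_left_mono[OF C(2)[of "-x"], of "1 / sqrt (2 * pi)"] by (simp add: norm_mult norm_power mult_ac norm_divide)
  then show "\<exists>C. \<forall>x. \<bar>x\<bar> ^ j * norm (nth_deriv k (fourier u) x) \<le> C" by blast
qed

lemma schwartz_rapid: "schwartz \<phi> \<Longrightarrow> rapid \<phi>"
  unfolding schwartz_def rapid_def using smooth_continuous_on_0 by (metis nth_deriv_0)

lemma fourier_rapid: "u \<in> test_funs \<Longrightarrow> rapid (fourier u)"
  by (intro schwartz_rapid fourier_schwartz)

text \<open>The easy half of the Paley-Wiener theorem. Powers of \<open>z\<close> turn into
  derivatives of \<open>u\<close>, which keep the support and hence the exponential type
  \<open>R\<close>; order \<open>0\<close> and order \<open>n\<close> together control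
  \<open>(1 + norm z) ^ n\<close>.\<close>

lemma fourier_in_Z:
  assumes "u \<in> test_funs" shows "fourier u \<in> Z"
proof -
  obtain R where R: "R > 0" "\<And>x. R < \<bar>x\<bar> \<Longrightarrow> u x = 0" using test_funsE[OF assms] by metis
  let ?g = "\<lambda>z. of_real (1 / sqrt (2 * pi)) * complex_osc u (- z)"
  have "?g holomorphic_on UNIV"
    by (intro holomorphic_intros holomorphic_on_minus_arg complex_osc_holomorphic assms)
  moreover have "\<exists>C. \<forall>z. norm (?g z) \<le> C * (1 + norm z) powi (- int n) * exp (R * \<bar>Im z\<bar>)" for n
  proof -
    obtain A where A: "0 \<le> A" "\<And>z. norm (complex_osc u z) \<le> A * exp (R * \<bar>Im z\<bar>)"
      using complex_osc_bound[OF assms R(2)] by blast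
    have "\<And>x. R < \<bar>x\<bar> \<Longrightarrow> nth_deriv n u x = 0" using R nth_deriv_eq_0_outside by blast
    then obtain B where B: "0 \<le> B" "\<And>z. norm (complex_osc (nth_deriv n u) z) \<le> B * exp (R * \<bar>Im z\<bar>)"
      using complex_osc_bound[OF nth_deriv_test_funs[OF assms]] by blast
    have "norm (?g z) \<le> (1 / sqrt (2 * pi) * 2 ^ n * (A + B)) * (1 + norm z) powi (- int n) * exp (R * \<bar>Im z\<bar>)" for z
    proof -
      have p: "0 < (1 + norm z) ^ n" by (simp add: add_pos_nonneg)
      have "(1 + norm z) ^ n * norm (complex_osc u (- z)) \<le> 2 ^ n * (1 + norm z ^ n) * norm (complex_osc u (- z))"
        by (intro mult_right_mono one_plus_power_le) auto
      also have "\<dots> = 2 ^ n * (norm (complex_osc u (- z)) + norm (complex_osc (nth_deriv n u) (- z)))"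
        using complex_osc_power_deriv[OF assms, of "- z" n] by (simp add: algebra_simps)
      also have "\<dots> \<le> 2 ^ n * (A * exp (R * \<bar>Im z\<bar>) + B * exp (R * \<bar>Im z\<bar>))"
        using A(2)[of "- z"] B(2)[of "- z"] by (intro mult_left_mono add_mono) auto
      finally have "norm (complex_osc u (- z)) \<le> 2 ^ n * (A + B) * exp (R * \<bar>Im z\<bar>) / (1 + norm z) ^ n"
        using p by (simp add: pos_le_divide_eq algebra_simps)
      then have "1 / sqrt (2 * pi) * norm (complex_osc u (- z)) \<le>
          1 / sqrt (2 * pi) * (2 ^ n * (A + B) * exp (R * \<bar>Im z\<bar>) / (1 + norm z) ^ n)"
        by (intro mult_left_mono) auto
      moreover have "norm (complex_of_real (1 / sqrt (2 * pi))) = 1 / sqrt (2 * pi)" by (simp add: norm_divide)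
      ultimately show ?thesis
        by (simp only: norm_mult) (simp add: power_int_minus divide_inverse mult_ac)
    qed
    then show ?thesis by blast
  qed
  ultimately show ?thesis
    unfolding Z_def using fourier_schwartz[OF assms] R(1) fourier_complex_osc[of u]
    by (intro CollectI conjI exI[of _ ?g] exI[of _ R]) auto
qed

lemma tendsto_integral_truncated:
  fixes f :: "real \<Rightarrow> complex"
  assumes f: "integrable lborel f"
  shows "(\<lambda>n. LINT x|lborel. indicator {- real n..real n} x *\<^sub>R f x) \<longlonglongrightarrow> (LINT x|lborel. f x)"
proof (rule integral_dominated_convergence)
  show "integrable lborel (\<lambda>x. norm (f x))" using f by (rule integrable_norm)
  show "f \<in> borel_measurable lborel" using f by auto
  then show "(\<lambda>x. indicator {- real n..real n} x *\<^sub>R f x) \<in> borel_measurable lborel" for n by measurable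
  show "AE x in lborel. norm (indicator {- real n..real n} x *\<^sub>R f x) \<le> norm (f x)" for n
    by (intro AE_I2) (simp add: indicator_def)
  show "AE x in lborel. (\<lambda>n. indicator {- real n..real n} x *\<^sub>R f x) \<longlonglongrightarrow> f x"
  proof (intro AE_I2 tendsto_eventually)
    fix x :: real
    obtain N :: nat where "\<bar>x\<bar> \<le> real N" using real_arch_simple by blast
    then have "indicator {- real n..real n} x *\<^sub>R f x = f x" if "n \<ge> N" for n
      using that by (auto simp: indicator_def)
    then show "\<forall>\<^sub>F n in sequentially. indicator {- real n..real n} x *\<^sub>R f x = f x"
      by (auto simp: eventually_sequentially)
  qed
qed

text \<open>The contour of integration is moved to the line \<open>Im z = n\<close>, truncated at \<open>Re z = \<plusminus>n\<close>.\<close>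

lemma osc_eq_0_aux:
  assumes g: "g holomorphic_on UNIV" "\<And>x. g (complex_of_real x) = \<phi> x"
    and bd: "\<And>z. norm (g z) \<le> C * (1 + norm z) powi (- 2) * exp (r * \<bar>Im z\<bar>)"
    and i: "integrable lborel \<phi>" and \<zeta>: "\<zeta> > r" and r: "r > 0"
  shows "osc \<phi> \<zeta> = 0"
proof -
  let ?h = "\<lambda>z. g z * exp (\<i> * z * of_real \<zeta>)"
  have C: "0 \<le> C" using order_trans[OF norm_ge_zero bd[of 0]] by simp
  have gd: "\<exists>g'. (g has_field_derivative g') (at z)" for z
    using g(1) by (auto simp: holomorphic_on_def field_differentiable_def)
  have hol: "?h holomorphic_on UNIV" using g(1) by (intro holomorphic_intros)
  \<comment> \<open>A primitive of the entire integrand takes the place of Cauchy's theorem for the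
    rectangle: each side contributes a difference of values of \<open>P\<close>, estimated by the
    length of the side times a bound of the integrand.\<close>
  then obtain P where P: "\<And>z. (P has_field_derivative ?h z) (at z)"
    using holomorphic_convex_primitive'[of UNIV ?h] by auto
  have est: "norm (?h z) \<le> C * (1 + norm z) powi (- 2) * exp (- (\<zeta> - r) * Im z)" if "0 \<le> Im z" for z
  proof -
    have "norm (?h z) \<le> C * (1 + norm z) powi (- 2) * exp (r * \<bar>Im z\<bar>) * exp (- (Im z * \<zeta>))"
      using mult_right_mono[OF bd[of z], of "exp (- (Im z * \<zeta>))"] by (simp add: norm_mult)
    also have "\<dots> = C * (1 + norm z) powi (- 2) * exp (- (\<zeta> - r) * Im z)"
      using that by (simp add: mult_exp_exp algebra_simps)
    finally show ?thesis .
  qed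
  define a where "a n = Complex (- real n) 0" for n
  define b where "b n = Complex (real n) 0" for n
  define c where "c n = Complex (- real n) (real n)" for n
  define d where "d n = Complex (real n) (real n)" for n
  have seg: "norm (P w - P v) \<le> B * norm (w - v)" if "\<And>z. z \<in> closed_segment v w \<Longrightarrow> norm (?h z) \<le> B" for v w B
    by (rule field_differentiable_bound[OF convex_closed_segment, of v w P ?h])
       (use that P in \<open>auto intro: has_field_derivative_at_within\<close>)
  \<comment> \<open>On the vertical sides the exponential is at most \<open>1\<close>, and the
    quadratic decay in \<open>n\<close> outweighs the length \<open>n\<close>.\<close>
  have vert: "norm (P (Complex x n) - P (Complex x 0)) \<le> C / (1 + real n)\<^sup>2 * real n" if x: "\<bar>x\<bar> = real n" for x n
  proof -
    have "norm (P (Complex x n) - P (Complex x 0)) \<le> C / (1 + real n)\<^sup>2 * norm (Complex x n - Complex x 0)"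
    proof (rule seg)
      fix z assume "z \<in> closed_segment (Complex x 0) (Complex x n)"
      then obtain t where t: "0 \<le> t" "t \<le> 1" "z = (1 - t) *\<^sub>R Complex x 0 + t *\<^sub>R Complex x n" by (auto simp: in_segment)
      then have z: "z = Complex x (t * n)" by (simp add: complex_eq_iff algebra_simps)
      have nz: "real n \<le> norm z" using x abs_Re_le_cmod[of z] z by simp
      have "0 \<le> (\<zeta> - r) * Im z" using \<zeta> t by (simp add: z)
      then have e1: "exp (- (\<zeta> - r) * Im z) \<le> 1" by (simp only: exp_le_one_iff)
      have "norm (?h z) \<le> C * (1 + norm z) powi (- 2) * exp (- (\<zeta> - r) * Im z)" using t z by (intro est) simp
      also have "\<dots> \<le> C * (1 + norm z) powi (- 2) * 1"
        using C e1 by (intro mult_left_mono) auto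
      also have "\<dots> \<le> C / (1 + real n)\<^sup>2"
        using C nz by (auto simp: power_int_minus divide_inverse intro!: mult_left_mono le_imp_inverse_le power_mono add_pos_nonneg)
      finally show "norm (?h z) \<le> C / (1 + real n)\<^sup>2" .
    qed
    then show ?thesis by (simp add: cmod_def)
  qed
  \<comment> \<open>On the top side \<open>Im z = n\<close>, so the integrand is exponentially small
    because \<open>\<zeta>\<close> exceeds the type \<open>r\<close>.\<close>
  have horiz: "norm (P (d n) - P (c n)) \<le> C * exp (- (\<zeta> - r) * n) * (2 * n)" for n
  proof -
    have "norm (P (d n) - P (c n)) \<le> C * exp (- (\<zeta> - r) * n) * norm (d n - c n)"
    proof (rule seg)
      fix z assume "z \<in> closed_segment (c n) (d n)"
      then obtain t where t: "0 \<le> t" "t \<le> 1" "z = (1 - t) *\<^sub>R c n + t *\<^sub>R d n" by (auto simp: in_segment)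
      then have z: "Im z = n" by (simp add: c_def d_def) (simp add: algebra_simps)
      have "norm (?h z) \<le> C * (1 + norm z) powi (- 2) * exp (- (\<zeta> - r) * Im z)" using z by (intro est) simp
      also have "\<dots> \<le> C * 1 * exp (- (\<zeta> - r) * n)"
        unfolding z using C by (intro mult_right_mono mult_left_mono) (auto simp: power_int_minus inverse_le_1_iff)
      finally show "norm (?h z) \<le> C * exp (- (\<zeta> - r) * n)" by simp
    qed
    moreover have "norm (d n - c n) = 2 * n" by (simp add: d_def c_def cmod_def real_sqrt_mult)
    ultimately show ?thesis by simp
  qed
  have bnd: "norm (P (b n) - P (a n)) \<le> C * exp (- (\<zeta> - r) * n) * (2 * n) + 2 * (C / (1 + real n)\<^sup>2 * real n)" for n
  proof -
    have "P (b n) - P (a n) = (P (d n) - P (c n)) - (P (d n) - P (b n)) + (P (c n) - P (a n))" by simp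
    also have "norm \<dots> \<le> norm (P (d n) - P (c n)) + norm (P (d n) - P (b n)) + norm (P (c n) - P (a n))"
      by (meson add_mono norm_triangle_ineq norm_triangle_ineq4 order_refl order_trans)
    finally show ?thesis
      using horiz[of n] vert[of "real n" n] vert[of "- real n" n] by (simp add: a_def b_def c_def d_def)
  qed
  have lim: "(\<lambda>n. C * exp (- (\<zeta> - r) * real n) * (2 * real n) + 2 * (C / (1 + real n)\<^sup>2 * real n)) \<longlonglongrightarrow> 0"
    using \<zeta> by real_asymp
  have "(\<lambda>n. P (b n) - P (a n)) \<longlonglongrightarrow> 0"
    using bnd by (intro Lim_null_comparison[OF always_eventually[OF allI] lim]) simp
  moreover have "(\<lambda>n. P (b n) - P (a n)) \<longlonglongrightarrow> osc \<phi> \<zeta>"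
  proof -
    have "P (b n) - P (a n) = (LINT x|lborel. indicator {- real n..real n} x *\<^sub>R ?h (of_real x))" for n
    proof (subst integral_FTC_Icc[where F = "\<lambda>x. P (of_real x)"])
      show "((\<lambda>x. P (complex_of_real x)) has_vector_derivative ?h (of_real x)) (at x within {- real n..real n})" for x
        by (rule has_vector_derivative_at_within[OF has_vector_derivative_real_field[OF P]])
      show "continuous_on {- real n..real n} (\<lambda>x. ?h (of_real x))"
        by (intro continuous_intros continuous_on_compose2[OF holomorphic_on_imp_continuous_on[OF g(1)]]) auto
      have "complex_of_real (real n) = Complex (real n) 0" "complex_of_real (- real n) = Complex (- real n) 0"
        by (auto simp: complex_eq_iff)
      then show "P (b n) - P (a n) = P (complex_of_real (real n)) - P (complex_of_real (- real n))"
        by (simp add: a_def b_def)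
    qed simp
    moreover have "(\<lambda>n. LINT x|lborel. indicator {- real n..real n} x *\<^sub>R ?h (of_real x)) \<longlonglongrightarrow> (LINT x|lborel. ?h (of_real x))"
    proof (rule tendsto_integral_truncated)
      have "(\<lambda>x. ?h (of_real x)) = (\<lambda>x. exp (\<i> * of_real (x * \<zeta>)) * \<phi> x)" by (simp add: g(2) mult_ac fun_eq_iff)
      then show "integrable lborel (\<lambda>x. ?h (of_real x))" using integrable_exp_mult[OF i] by simp
    qed
    ultimately show ?thesis by (simp add: osc_def g(2) mult_ac)
  qed
  ultimately show ?thesis by (metis LIMSEQ_unique)
qed

lemma osc_uminus: "osc (\<lambda>x. w (- x)) \<xi> = osc w (- \<xi>)"
  unfolding osc_def by (subst lborel_integral_real_affine[of "-1" _ 0]) auto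

lemma osc_osc:
  assumes "rapid f" "integrable lborel (osc f)"
  shows "osc (osc f) x = of_real (2 * pi) * f (- x)"
proof -
  obtain B where B: "\<And>x. norm (f x) \<le> B" using rapid_bounded[OF assms(1)] by metis
  have "integrable lborel (\<lambda>\<xi>. osc (\<lambda>y. f (- y)) (- \<xi>))" using assms(2) by (simp add: osc_uminus)
  moreover have "rapid (\<lambda>y. f (- y))" using assms(1) by (rule rapid_uminus)
  ultimately have "osc (\<lambda>\<xi>. osc (\<lambda>y. f (- y)) (- \<xi>)) x = of_real (2 * pi) * f (- x)"
    by (intro fourier_inversion[where B = B]) (auto simp: rapid_integrable B rapid_def)
  then show ?thesis by (simp add: osc_uminus)
qed

lemma sqrt_2pi_square: "complex_of_real (1 / sqrt (2 * pi)) * (of_real (1 / sqrt (2 * pi)) * (of_real (2 * pi) * z)) = z"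
proof -
  have "complex_of_real (1 / sqrt (2 * pi)) * (of_real (1 / sqrt (2 * pi)) * (of_real (2 * pi) * z)) =
     of_real (1 / sqrt (2 * pi) * (1 / sqrt (2 * pi)) * (2 * pi)) * z"
    by (simp only: of_real_mult mult.assoc)
  also have "1 / sqrt (2 * pi) * (1 / sqrt (2 * pi)) * (2 * pi) = 1" by (simp add: field_simps)
  finally show ?thesis by simp
qed

lemma fourier_osc_inverse:
  assumes "rapid f" "integrable lborel (osc f)"
  shows "fourier (\<lambda>\<xi>. of_real (1 / sqrt (2 * pi)) * osc f \<xi>) x = f x"
  unfolding fourier_osc osc_cmult osc_osc[OF assms] by (subst sqrt_2pi_square) simp

text \<open>Exhibits a test function as a superposition of exponentials with the rapidly decreasing
  density \<open>fourier u\<close>, the form to which \<open>T_osc\<close> applies.\<close>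

lemma osc_fourier:
  assumes "u \<in> test_funs"
  shows "of_real (1 / sqrt (2 * pi)) * osc (fourier u) x = u x"
proof -
  have "rapid (osc u)"
  proof -
    have "rapid (\<lambda>x. of_real (sqrt (2 * pi)) * fourier u (- x))"
      by (intro rapid_cmult rapid_uminus fourier_rapid assms)
    also have "(\<lambda>x. of_real (sqrt (2 * pi)) * fourier u (- x)) = osc u"
      by (simp add: fourier_osc fun_eq_iff)
    finally show ?thesis .
  qed
  then have i: "integrable lborel (osc u)" by (rule rapid_integrable)
  have "osc (fourier u) x = of_real (1 / sqrt (2 * pi)) * osc (\<lambda>\<xi>. osc u (- \<xi>)) x"
    unfolding fourier_osc[abs_def] by (rule osc_cmult)
  also have "osc (\<lambda>\<xi>. osc u (- \<xi>)) x = of_real (2 * pi) * u x"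
    unfolding osc_uminus osc_osc[OF test_funs_rapid[OF assms] i] by simp
  finally show ?thesis by (simp only: sqrt_2pi_square)
qed

text \<open>The preimage is \<open>osc \<phi>\<close> up to a constant. Shifting the contour upwards
  shows that it vanishes to the right of the exponential type \<open>r\<close>; the same argument
  for the reflection of \<open>\<phi>\<close> deals with the left. Smoothness follows from rapid
  decrease on the real line.\<close>

theorem paley_wiener:
  assumes "\<phi> \<in> Z" obtains u where "u \<in> test_funs" "fourier u = \<phi>"
proof -
  obtain g r where sch: "schwartz \<phi>" and g: "g holomorphic_on UNIV" "\<And>x. g (complex_of_real x) = \<phi> x" and r: "0 < r"
    and "\<And>n::nat. \<exists>C. \<forall>z. norm (g z) \<le> C * (1 + norm z) powi (- int n) * exp (r * \<bar>Im z\<bar>)"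
    using assms unfolding Z_def by blast
  from this(5)[of 2] obtain C where C: "\<And>z. norm (g z) \<le> C * (1 + norm z) powi (- 2) * exp (r * \<bar>Im z\<bar>)" by auto
  have rap: "rapid \<phi>" using sch by (rule schwartz_rapid)
  have pos: "osc \<phi> \<zeta> = 0" if "\<zeta> > r" for \<zeta>
    using osc_eq_0_aux[OF g C rapid_integrable[OF rap] that r] .
  have neg: "osc \<phi> (- \<zeta>) = 0" if "\<zeta> > r" for \<zeta>
  proof -
    have "osc (\<lambda>x. \<phi> (- x)) \<zeta> = 0"
    proof (rule osc_eq_0_aux[of "\<lambda>z. g (- z)" _ C r])
      show "(\<lambda>z. g (- z)) holomorphic_on UNIV"
        using g(1) by (rule holomorphic_on_minus_arg)
      show "g (- complex_of_real x) = \<phi> (- x)" for x using g(2)[of "- x"] by simp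
      show "norm (g (- z)) \<le> C * (1 + norm z) powi - 2 * exp (r * \<bar>Im z\<bar>)" for z using C[of "- z"] by simp
    qed (use rapid_integrable[OF rapid_uminus[OF rap]] that r in auto)
    then show ?thesis by (simp add: osc_uminus)
  qed
  have supp: "osc \<phi> \<zeta> = 0" if "r < \<bar>\<zeta>\<bar>" for \<zeta>
    using pos[of \<zeta>] neg[of "- \<zeta>"] that by (cases "0 \<le> \<zeta>") auto
  have s: "smooth (osc \<phi>)" using osc_derivs[OF rapid_moments[OF rap]] by (rule derivs_imp_smooth)
  then have t: "osc \<phi> \<in> test_funs" using supp by (auto simp: test_funs_iff)
  then have i: "integrable lborel (osc \<phi>)" by (intro rapid_integrable test_funs_rapid)
  show ?thesis
  proof (rule that)
    show "(\<lambda>\<xi>. of_real (1 / sqrt (2 * pi)) * osc \<phi> \<xi>) \<in> test_funs" using t by (rule test_funs_cmult)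
    show "fourier (\<lambda>\<xi>. of_real (1 / sqrt (2 * pi)) * osc \<phi> \<xi>) = \<phi>"
      using fourier_osc_inverse[OF rap i] by (simp add: fun_eq_iff)
  qed
qed

section \<open>The Laplace convolution\<close>

lemma lborel_change_variables:
  fixes f :: "real \<Rightarrow> complex" and g g' :: "real \<Rightarrow> real"
  assumes g: "\<And>x. (g has_real_derivative g' x) (at x)" and inj: "inj g" and S: "range g = S" "S \<in> sets borel"
    and f: "f \<in> borel_measurable borel" and g': "g' \<in> borel_measurable borel"
  shows "integrable lborel (\<lambda>x. \<bar>g' x\<bar> *\<^sub>R f (g x)) \<longleftrightarrow> set_integrable lborel S f"
    and "(LINT x|lborel. \<bar>g' x\<bar> *\<^sub>R f (g x)) = (LINT x:S|lborel. f x)"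
proof -
  have gm: "g \<in> borel_measurable borel"
    using g DERIV_continuous by (intro borel_measurable_continuous_onI continuous_at_imp_continuous_on) blast
  have m1: "(\<lambda>x. \<bar>g' x\<bar> *\<^sub>R f (g x)) \<in> borel_measurable lborel"
    using f g' gm by measurable
  have m2: "(\<lambda>x. indicator S x *\<^sub>R f x) \<in> borel_measurable lborel"
    using f S(2) by measurable
  \<comment> \<open>The substitution rule concerns absolute integrability for the completed measure;
    Borel measurability of the integrands leads back to \<open>lborel\<close>.\<close>
  have a1: "(\<lambda>x. \<bar>g' x\<bar> *\<^sub>R f (g x)) absolutely_integrable_on UNIV \<longleftrightarrow> integrable lborel (\<lambda>x. \<bar>g' x\<bar> *\<^sub>R f (g x))"
    using integrable_completion[OF m1] by (simp add: set_integrable_def)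
  have a2: "f absolutely_integrable_on S \<longleftrightarrow> set_integrable lborel S f"
    using integrable_completion[OF m2] by (simp add: set_integrable_def)
  have cv: "(\<lambda>x. \<bar>g' x\<bar> *\<^sub>R f (g x)) absolutely_integrable_on UNIV \<and> integral UNIV (\<lambda>x. \<bar>g' x\<bar> *\<^sub>R f (g x)) = b
          \<longleftrightarrow> f absolutely_integrable_on S \<and> integral S f = b" for b
    using has_absolute_integral_change_of_variables_real[of UNIV g g' f b] g inj S by simp
  show iff: "integrable lborel (\<lambda>x. \<bar>g' x\<bar> *\<^sub>R f (g x)) \<longleftrightarrow> set_integrable lborel S f"
    using cv a1 a2 by metis
  show "(LINT x|lborel. \<bar>g' x\<bar> *\<^sub>R f (g x)) = (LINT x:S|lborel. f x)"
  proof (cases "set_integrable lborel S f")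
    case True
    have "(LINT x|lborel. \<bar>g' x\<bar> *\<^sub>R f (g x)) = (LINT x|lebesgue. \<bar>g' x\<bar> *\<^sub>R f (g x))"
      using integral_completion[OF m1] by simp
    also have "\<dots> = integral UNIV (\<lambda>x. \<bar>g' x\<bar> *\<^sub>R f (g x))"
      using set_lebesgue_integral_eq_integral(2)[of UNIV "\<lambda>x. \<bar>g' x\<bar> *\<^sub>R f (g x)"] True iff a1
      by (simp add: set_lebesgue_integral_def)
    also have "\<dots> = integral S f" using cv True iff a1 by metis
    also have "\<dots> = (LINT x:S|lebesgue. f x)"
      using set_lebesgue_integral_eq_integral(2)[of S f] True a2 by simp
    also have "\<dots> = (LINT x:S|lborel. f x)"
      using integral_completion[OF m2] by (simp add: set_lebesgue_integral_def)
    finally show ?thesis .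
  next
    \<comment> \<open>Neither integral exists, and both have the default value
      \<open>0\<close>.\<close>
    case False
    then show ?thesis using iff
      by (simp add: not_integrable_integral_eq set_lebesgue_integral_def set_integrable_def)
  qed
qed

lemma of_real_exp_powr: "complex_of_real (exp y) powr z = exp (z * of_real y)"
  by (simp add: powr_def Ln_of_real)

lemma range_exp_real: "range (exp :: real \<Rightarrow> real) = {0<..}"
  using exp_gt_zero by (auto simp: image_iff) (metis exp_ln)

text \<open>Euler's integral after the substitution \<open>t = exp y\<close>.\<close>

lemma Gamma_integral_exp:
  assumes "Re z > 0"
  shows "integrable lborel (\<lambda>y. exp (z * of_real y - of_real (exp y)))"
    and "(LINT y|lborel. exp (z * of_real y - of_real (exp y))) = Gamma z"
proof -
  let ?f = "\<lambda>t. complex_of_real t powr (z - 1) / of_real (exp t)"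
  have m: "?f \<in> borel_measurable borel" by measurable
  have m2: "(\<lambda>x. indicator {0<..} x *\<^sub>R ?f x) \<in> borel_measurable lborel" by measurable
  have e: "\<bar>exp y\<bar> *\<^sub>R ?f (exp y) = exp (z * of_real y - of_real (exp y))" for y
  proof -
    have "\<bar>exp y\<bar> *\<^sub>R ?f (exp y) = exp (of_real y) * exp ((z - 1) * of_real y) / exp (of_real (exp y))"
      unfolding of_real_exp_powr scaleR_conv_of_real by (simp add: exp_of_real)
    also have "\<dots> = exp (z * of_real y - of_real (exp y))"
      by (simp only: mult_exp_exp exp_diff[symmetric]) (simp add: algebra_simps)
    finally show ?thesis .
  qed
  have ai: "?f absolutely_integrable_on {0<..}" by (rule absolutely_integrable_Gamma_integral'[OF assms])
  then have si: "set_integrable lborel {0<..} ?f"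
    using integrable_completion[OF m2] by (simp add: set_integrable_def)
  note cv = lborel_change_variables[of exp exp "{0<..}" ?f, OF DERIV_exp _ range_exp_real _ m, unfolded e]
  show "integrable lborel (\<lambda>y. exp (z * of_real y - of_real (exp y)))"
    using cv(1) si by (auto simp: inj_def)
  have "(LINT y|lborel. exp (z * of_real y - of_real (exp y))) = (LINT x:{0<..}|lborel. ?f x)"
    using cv(2) by (auto simp: inj_def)
  also have "\<dots> = (LINT x:{0<..}|lebesgue. ?f x)"
    using integral_completion[OF m2] by (simp add: set_lebesgue_integral_def)
  also have "\<dots> = integral {0<..} ?f" using ai by (rule set_lebesgue_integral_eq_integral(2))
  also have "\<dots> = Gamma z" using Gamma_integral_complex'[OF assms] by (rule integral_unique)
  finally show "(LINT y|lborel. exp (z * of_real y - of_real (exp y))) = Gamma z" .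
qed

lemma integral_shift: "(LINT y|lborel. f (y + a)) = (LINT y|lborel. f (y :: real) :: 'a :: euclidean_space)"
  using lborel_integral_real_affine[of 1 f a] by (simp add: add.commute)

lemma integrable_shift: "integrable lborel f \<Longrightarrow> integrable lborel (\<lambda>y. f (y + a :: real) :: 'a :: euclidean_space)"
  using lborel_integrable_real_affine_iff[of 1 f a] by (simp add: add.commute)

lemma integrable_pair_shift:
  fixes p q m :: "real \<Rightarrow> complex"
  assumes p: "integrable lborel p" and q: "integrable lborel q"
    and m: "m \<in> borel_measurable borel" and b: "\<And>y. norm (m y) \<le> B"
  shows "integrable (lborel \<Otimes>\<^sub>M lborel) (\<lambda>(x, y). p x * q (x + y) * m y)"
proof (rule lborel_pair.Fubini_integrable)
  have pm: "p \<in> borel_measurable borel" "q \<in> borel_measurable borel" using p q by auto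
  show "(\<lambda>(x, y). p x * q (x + y) * m y) \<in> borel_measurable (lborel \<Otimes>\<^sub>M lborel)"
    using pm m by measurable
  have qi: "integrable lborel (\<lambda>y. q (x + y) * m y)" for x
  proof (rule Bochner_Integration.integrable_bound)
    show "integrable lborel (\<lambda>y. B * norm (q (x + y)))"
      using integrable_shift[OF integrable_norm[OF q], of x] by (simp add: add.commute)
    show "(\<lambda>y. q (x + y) * m y) \<in> borel_measurable lborel" using pm m by measurable
    have "norm (q (x + y)) * norm (m y) \<le> norm (q (x + y)) * B" for y by (intro mult_left_mono b) auto
    then have "norm (q (x + y) * m y) \<le> norm (B * norm (q (x + y)))" for y
      using order_trans[OF norm_ge_zero b[of 0]] by (simp add: norm_mult mult.commute)
    then show "AE y in lborel. norm (q (x + y) * m y) \<le> norm (B * norm (q (x + y)))" by simp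
  qed
  show "AE x in lborel. integrable lborel (\<lambda>y. case (x, y) of (x, y) \<Rightarrow> p x * q (x + y) * m y)"
    using qi by (simp add: mult.assoc)
  show "integrable lborel (\<lambda>x. LINT y|lborel. norm (case (x, y) of (x, y) \<Rightarrow> p x * q (x + y) * m y))"
  proof (rule Bochner_Integration.integrable_bound)
    show "integrable lborel (\<lambda>x. norm (p x) * (LINT y|lborel. B * norm (q y)))" using p by simp
    show "(\<lambda>x. LINT y|lborel. norm (case (x, y) of (x, y) \<Rightarrow> p x * q (x + y) * m y)) \<in> borel_measurable lborel"
      using pm m by measurable
    show "AE x in lborel. norm (LINT y|lborel. norm (case (x, y) of (x, y) \<Rightarrow> p x * q (x + y) * m y))
        \<le> norm (norm (p x) * (LINT y|lborel. B * norm (q y)))"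
    proof (rule AE_I2)
      fix x
      have "(LINT y|lborel. norm (q (x + y) * m y)) \<le> (LINT y|lborel. B * norm (q (x + y)))"
      proof (rule integral_mono')
        show "integrable lborel (\<lambda>y. B * norm (q (x + y)))"
          using integrable_shift[OF integrable_norm[OF q], of x] by (simp add: add.commute)
        have "0 \<le> B" using order_trans[OF norm_ge_zero b[of 0]] .
        then show "0 \<le> B * norm (q (x + y))" for y by simp
        show "norm (q (x + y) * m y) \<le> B * norm (q (x + y))" for y
          using mult_left_mono[OF b[of y], of "norm (q (x + y))"] by (simp add: norm_mult mult.commute)
      qed
      also have "\<dots> = (LINT y|lborel. B * norm (q y))"
        using integral_shift[of "\<lambda>y. B * norm (q y)" x] by (simp add: add.commute)
      finally have "norm (p x) * (LINT y|lborel. norm (q (x + y) * m y)) \<le> norm (p x) * (LINT y|lborel. B * norm (q y))"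
        by (intro mult_left_mono) auto
      then show "norm (LINT y|lborel. norm (case (x, y) of (x, y) \<Rightarrow> p x * q (x + y) * m y))
        \<le> norm (norm (p x) * (LINT y|lborel. B * norm (q y)))"
        by (simp add: norm_mult mult.assoc del: integral_mult_right_zero integral_mult_left_zero)
           (simp add: norm_mult mult.assoc)
    qed
  qed
qed

text \<open>Translating the inner variable by \<open>x\<close> removes \<open>x\<close> from the
  argument of \<open>m\<close>; with \<open>p\<close> the conjugate of \<open>g\<close> and
  \<open>q = g\<close>, the inner integral that remains is an autocorrelation.\<close>

lemma Fubini_shift:
  fixes p q m :: "real \<Rightarrow> complex"
  assumes "integrable lborel p" "integrable lborel q" "m \<in> borel_measurable borel" "\<And>y. norm (m y) \<le> B"
  shows "(LINT x|lborel. p x * (LINT y|lborel. q y * m (y - x))) = (LINT y|lborel. (LINT x|lborel. p x * q (x + y)) * m y)"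
proof -
  have "(LINT x|lborel. p x * (LINT y|lborel. q y * m (y - x))) = (LINT x|lborel. LINT y|lborel. p x * q (x + y) * m y)"
  proof (intro Bochner_Integration.integral_cong refl)
    fix x
    have "(LINT y|lborel. q y * m (y - x)) = (LINT y|lborel. q (x + y) * m y)"
      using integral_shift[of "\<lambda>y. q y * m (y - x)" x] by (simp add: add.commute)
    then show "p x * (LINT y|lborel. q y * m (y - x)) = (LINT y|lborel. p x * q (x + y) * m y)"
      by (simp add: mult.assoc)
  qed
  also have "\<dots> = (LINT y|lborel. LINT x|lborel. p x * q (x + y) * m y)"
    using lborel_pair.Fubini_integral[OF integrable_pair_shift[OF assms]] by simp
  finally show ?thesis by simp
qed

text \<open>In the double integral for \<open>Gamma a * Gamma b\<close> only translations of the variables are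
  needed.\<close>

lemma Beta_integral_exp:
  assumes a: "Re a > 0" and b: "Re b > 0"
  shows "integrable lborel (\<lambda>y. exp (b * of_real y) * exp (- (a + b) * of_real (ln (1 + exp y))))"
    and "(LINT y|lborel. exp (b * of_real y) * exp (- (a + b) * of_real (ln (1 + exp y)))) =
      Gamma a * Gamma b * rGamma (a + b)"
proof -
  let ?G = "\<lambda>z y. exp (z * of_real y - of_real (exp y)) :: complex"
  have ab: "Re (a + b) > 0" using a b by simp
  have "a + b \<notin> \<int>\<^sub>\<le>\<^sub>0"
    using ab by (auto elim!: nonpos_Ints_cases simp del: plus_complex.sel)
  then have G0: "Gamma (a + b) \<noteq> 0" by (simp add: Gamma_eq_zero_iff)
  \<comment> \<open>\<open>exp x + exp (x + y)\<close> is \<open>exp (x + ln (1 + exp y))\<close>,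
    so the two double exponentials merge into one Gamma integrand, translated by
    \<open>ln (1 + exp y)\<close>; integration over \<open>x\<close> does not see the
    translation.\<close>
  have e: "?G a x * ?G b (x + y) = exp (b * of_real y) * exp (- (a + b) * of_real (ln (1 + exp y))) *
      ?G (a + b) (x + ln (1 + exp y))" for x y :: real
  proof -
    have p: "0 < 1 + exp y" by (simp add: add_pos_pos)
    have "exp (x + ln (1 + exp y)) = exp x + exp (x + y)" using p by (simp add: exp_add distrib_left)
    then show ?thesis by (simp add: mult_exp_exp algebra_simps)
  qed
  have pi: "integrable (lborel \<Otimes>\<^sub>M lborel) (\<lambda>(x, y). ?G a x * ?G b (x + y) * 1)"
    by (rule integrable_pair_shift[OF Gamma_integral_exp(1)[OF a] Gamma_integral_exp(1)[OF b], where B = 1]) auto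
  have inner: "(LINT x|lborel. ?G a x * ?G b (x + y)) =
     exp (b * of_real y) * exp (- (a + b) * of_real (ln (1 + exp y))) * Gamma (a + b)" for y
    unfolding e integral_mult_right_zero integral_shift[of "?G (a + b)"] Gamma_integral_exp(2)[OF ab] ..
  have "integrable lborel (\<lambda>y. LINT x|lborel. ?G a x * ?G b (x + y))"
    using lborel_pair.integrable_snd[OF pi] by simp
  then have "integrable lborel (\<lambda>y. exp (b * of_real y) * exp (- (a + b) * of_real (ln (1 + exp y))) * Gamma (a + b))"
    unfolding inner .
  then show "integrable lborel (\<lambda>y. exp (b * of_real y) * exp (- (a + b) * of_real (ln (1 + exp y))))"
    using integrable_mult_left[of "inverse (Gamma (a + b))" lborel "\<lambda>y. exp (b * of_real y) * exp (- (a + b) * of_real (ln (1 + exp y))) * Gamma (a + b)"]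
    by (simp only: mult.assoc right_inverse[OF G0] mult_1_right simp_thms)
  have "Gamma a * Gamma b = (LINT x|lborel. ?G a x * (LINT y|lborel. ?G b y * 1))"
    using Gamma_integral_exp(2)[OF a] Gamma_integral_exp(2)[OF b] by simp
  also have "\<dots> = (LINT y|lborel. (LINT x|lborel. ?G a x * ?G b (x + y)) * 1)"
    by (rule Fubini_shift[OF Gamma_integral_exp(1)[OF a] Gamma_integral_exp(1)[OF b], where B = 1]) auto
  also have "\<dots> = (LINT y|lborel. exp (b * of_real y) * exp (- (a + b) * of_real (ln (1 + exp y)))) * Gamma (a + b)"
    unfolding inner mult_1_right by (rule integral_mult_left_zero)
  finally show "(LINT y|lborel. exp (b * of_real y) * exp (- (a + b) * of_real (ln (1 + exp y)))) =
      Gamma a * Gamma b * rGamma (a + b)"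
    using G0 by (simp add: rGamma_inverse_Gamma)
qed

section \<open>Autocorrelations\<close>

definition corr :: "(real \<Rightarrow> complex) \<Rightarrow> real \<Rightarrow> complex" where
  "corr g \<zeta> = (LINT \<xi>|lborel. cnj (g \<xi>) * g (\<xi> + \<zeta>))"

lemma rapid_norm_square:
  assumes "rapid w" shows "rapid (\<lambda>x. of_real ((norm (w x))\<^sup>2))"
  unfolding rapid_def
proof (intro conjI allI)
  show "continuous_on UNIV (\<lambda>x. complex_of_real ((norm (w x))\<^sup>2))"
    using assms unfolding rapid_def by (intro continuous_intros) auto
  fix j
  obtain B where B: "\<And>x. norm (w x) \<le> B" using rapid_bounded[OF assms] by metis
  obtain C where C: "\<And>x. \<bar>x\<bar> ^ j * norm (w x) \<le> C" using assms unfolding rapid_def by metis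
  have "\<bar>x\<bar> ^ j * norm (complex_of_real ((norm (w x))\<^sup>2)) \<le> C * B" for x
  proof -
    have "(\<bar>x\<bar> ^ j * norm (w x)) * norm (w x) \<le> C * B"
      using order_trans[OF _ C[of x]] by (intro mult_mono B C) auto
    then show ?thesis by (simp add: power2_eq_square norm_mult mult.assoc)
  qed
  then show "\<exists>C. \<forall>x. \<bar>x\<bar> ^ j * norm (complex_of_real ((norm (w x))\<^sup>2)) \<le> C" by blast
qed

lemma cnj_lebesgue_integral: "cnj (LINT x|M. f x) = (LINT x|M. cnj (f x))"
  by simp

text \<open>Inserting Fourier inversion for the shifted factor leaves the transform of a conjugate,
  so the modulus of \<open>fourier g\<close> is squared. The gain is smoothness of
  \<open>corr g\<close>: under the integral only the exponential depends on
  \<open>\<zeta>\<close>.\<close>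

lemma corr_eq_osc:
  assumes g: "g \<in> test_funs"
  shows "corr g \<zeta> = osc (\<lambda>x. of_real ((norm (fourier g x))\<^sup>2)) \<zeta>"
proof -
  let ?c = "complex_of_real (1 / sqrt (2 * pi))"
  have gi: "integrable lborel g" using g by (intro rapid_integrable test_funs_rapid)
  have Fi: "integrable lborel (fourier g)" using g by (intro rapid_integrable fourier_rapid)
  have Fm: "fourier g \<in> borel_measurable borel" "g \<in> borel_measurable borel" using Fi gi by auto
  have "corr g \<zeta> = (LINT \<xi>|lborel. cnj (g \<xi>) * (?c * osc (fourier g) (\<xi> + \<zeta>)))"
    unfolding corr_def osc_fourier[OF g] ..
  also have "\<dots> = (LINT \<xi>|lborel. LINT x|lborel. cnj (g \<xi>) * fourier g x * (?c * exp (\<i> * of_real (x * (\<xi> + \<zeta>)))))"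
    unfolding osc_def integral_mult_right_zero[symmetric] by (simp only: mult_ac)
  also have "\<dots> = (LINT x|lborel. LINT \<xi>|lborel. cnj (g \<xi>) * fourier g x * (?c * exp (\<i> * of_real (x * (\<xi> + \<zeta>)))))"
    by (rule Fubini_mult_bounded[symmetric, where B = "norm ?c"])
       (use gi Fi in \<open>auto simp: norm_mult norm_divide simp del: of_real_mult of_real_add\<close>)
  also have "\<dots> = (LINT x|lborel. exp (\<i> * of_real (x * \<zeta>)) * of_real ((norm (fourier g x))\<^sup>2))"
  proof (intro Bochner_Integration.integral_cong refl)
    fix x
    have "(LINT \<xi>|lborel. cnj (g \<xi>) * fourier g x * (?c * exp (\<i> * of_real (x * (\<xi> + \<zeta>))))) =
        (LINT \<xi>|lborel. (exp (\<i> * of_real (x * \<zeta>)) * fourier g x * ?c) * (exp (\<i> * of_real (\<xi> * x)) * cnj (g \<xi>)))"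
      by (intro Bochner_Integration.integral_cong) (auto simp: exp_add algebra_simps)
    also have "\<dots> = (exp (\<i> * of_real (x * \<zeta>)) * fourier g x * ?c) * (LINT \<xi>|lborel. exp (\<i> * of_real (\<xi> * x)) * cnj (g \<xi>))"
      by (rule integral_mult_right_zero)
    also have "(LINT \<xi>|lborel. exp (\<i> * of_real (\<xi> * x)) * cnj (g \<xi>)) = cnj (osc g (- x))"
      unfolding osc_def cnj_lebesgue_integral by (simp add: exp_cnj)
    also have "exp (\<i> * of_real (x * \<zeta>)) * fourier g x * ?c * cnj (osc g (- x)) =
       exp (\<i> * of_real (x * \<zeta>)) * (fourier g x * cnj (fourier g x))"
      by (simp add: fourier_osc)
    finally show "(LINT \<xi>|lborel. cnj (g \<xi>) * fourier g x * (?c * exp (\<i> * of_real (x * (\<xi> + \<zeta>))))) =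
       exp (\<i> * of_real (x * \<zeta>)) * of_real ((norm (fourier g x))\<^sup>2)"
      by (simp only: complex_norm_square)
  qed
  finally show ?thesis by (simp add: osc_def)
qed

lemma corr_support:
  assumes "\<And>x. R < \<bar>x\<bar> \<Longrightarrow> g x = 0" "2 * R < \<bar>\<zeta>\<bar>"
  shows "corr g \<zeta> = 0"
proof -
  have "cnj (g \<xi>) * g (\<xi> + \<zeta>) = 0" for \<xi>
  proof (cases "R < \<bar>\<xi>\<bar>")
    case False
    then have "R < \<bar>\<xi> + \<zeta>\<bar>" using assms(2) by arith
    then show ?thesis using assms(1) by simp
  qed (use assms(1) in simp)
  then show ?thesis unfolding corr_def by (simp only: Bochner_Integration.integral_zero)
qed

lemma corr_test_funs:
  assumes g: "g \<in> test_funs" shows "corr g \<in> test_funs"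
proof -
  obtain R where R: "R > 0" "\<And>x. R < \<bar>x\<bar> \<Longrightarrow> g x = 0" using test_funsE[OF g] by metis
  have "smooth (corr g)"
    using derivs_imp_smooth[OF osc_derivs[OF rapid_moments[OF rapid_norm_square[OF fourier_rapid[OF g]]]]]
    by (simp add: corr_eq_osc[OF g, abs_def])
  then show ?thesis using corr_support[of R g] R by (auto simp: test_funs_iff)
qed

lemma fourier_corr:
  assumes g: "g \<in> test_funs"
  shows "fourier (corr g) x = of_real (sqrt (2 * pi) * (norm (fourier g x))\<^sup>2)"
proof -
  let ?f = "\<lambda>x. complex_of_real ((norm (fourier g x))\<^sup>2)" and ?c = "complex_of_real (1 / sqrt (2 * pi))"
  have f: "rapid ?f" using g by (intro rapid_norm_square fourier_rapid)
  have e: "corr g = osc ?f" by (simp add: corr_eq_osc[OF g] fun_eq_iff)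
  have "integrable lborel (corr g)" using g by (intro rapid_integrable test_funs_rapid corr_test_funs)
  then have "fourier (\<lambda>\<xi>. ?c * osc ?f \<xi>) x = ?f x" unfolding e by (rule fourier_osc_inverse[OF f])
  then have "?c * fourier (corr g) x = ?f x" unfolding e fourier_osc osc_cmult .
  then have "of_real (sqrt (2 * pi)) * (?c * fourier (corr g) x) = of_real (sqrt (2 * pi)) * ?f x" by simp
  moreover have "of_real (sqrt (2 * pi)) * (?c * fourier (corr g) x) = fourier (corr g) x"
  proof -
    have "of_real (sqrt (2 * pi)) * (?c * fourier (corr g) x) = of_real (sqrt (2 * pi) * (1 / sqrt (2 * pi))) * fourier (corr g) x"
      by (simp only: of_real_mult mult.assoc)
    then show ?thesis by simp
  qed
  ultimately show ?thesis by simp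
qed

text \<open>In logarithmic variables the inverse Mellin transform is \<open>fourier\<close>; it takes the test functions
  onto \<open>D\<close> and \<open>Zplus\<close>.\<close>

definition mellin_D :: "(real \<Rightarrow> complex) \<Rightarrow> real \<Rightarrow> complex" where
  "mellin_D v t = (if 0 < t then of_real (t powr (- 1 / 2)) * fourier v (ln t) else 0)"

definition mellin_Z :: "(real \<Rightarrow> complex) \<Rightarrow> real \<Rightarrow> complex" where
  "mellin_Z u t = (if 0 < t then fourier u (ln t) else 0)"

lemma mellin_D_in_D:
  assumes "v \<in> test_funs" shows "mellin_D v \<in> D"
proof -
  have "complex_of_real (exp (x / 2)) * mellin_D v (exp x) = fourier v x" for x
  proof -
    have "exp (x / 2) * exp x powr (- 1 / 2) = 1" by (simp add: exp_powr_real mult_exp_exp)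
    then have "complex_of_real (exp (x / 2)) * of_real (exp x powr (- 1 / 2)) = 1"
      by (metis of_real_1 of_real_mult)
    then show ?thesis by (simp add: mellin_D_def mult.assoc[symmetric])
  qed
  then show ?thesis
    unfolding D_def mem_Collect_eq using fourier_in_Z[OF assms] by (simp only:) (simp add: mellin_D_def)
qed

lemma mellin_Z_exp: "mellin_Z u (exp x) = fourier u x"
  by (simp add: mellin_Z_def)

lemma mellin_Z_in_Zplus: "u \<in> test_funs \<Longrightarrow> mellin_Z u \<in> Zplus"
  using fourier_in_Z[of u] by (simp add: Zplus_def mellin_Z_def)

lemma Zplus_eq_mellin_Z:
  assumes "F \<in> Zplus" obtains u where "u \<in> test_funs" "F = mellin_Z u"
proof -
  obtain u where u: "u \<in> test_funs" "fourier u = (\<lambda>x. F (exp x))"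
    using paley_wiener assms unfolding Zplus_def by blast
  have "F t = mellin_Z u t" for t
    using assms fun_cong[OF u(2), of "ln t"] by (cases "0 < t") (auto simp: Zplus_def mellin_Z_def)
  then show ?thesis using that u by blast
qed

lemma fourier_measurable: "v \<in> test_funs \<Longrightarrow> fourier v \<in> borel_measurable borel"
  using rapid_measurable[OF fourier_rapid] by simp

text \<open>The substitution \<open>s = t / (1 + exp y)\<close> maps the line onto
  \<open>(0, t)\<close> and makes both logarithms explicit, with \<open>t - s = s * exp y\<close>.
  The Jacobian and the two inverse square roots combine to \<open>exp (y / 2) / (1 + exp y)\<close>,
  which is free of \<open>t\<close>.\<close>

lemma laplace_conv_mellin_aux:
  assumes v: "v \<in> test_funs" and t: "0 < t"
  shows "((\<lambda>s. cnj (mellin_D v s)) \<star> mellin_D v) t =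
    (LINT y|lborel. of_real (exp (y / 2) / (1 + exp y)) *
       (cnj (fourier v (ln t - ln (1 + exp y))) * fourier v (ln t + y - ln (1 + exp y))))"
proof -
  let ?f = "mellin_D v"
  let ?F = "\<lambda>s. cnj (?f s) * ?f (t - s)"
  define G where "G y = t / (1 + exp y)" for y :: real
  define G' where "G' y = - t * exp y / (1 + exp y)\<^sup>2" for y :: real
  have p: "0 < 1 + exp y" "1 + exp y \<noteq> 0" for y :: real using exp_gt_zero[of y] by linarith+
  have der: "(G has_real_derivative G' y) (at y)" for y
    unfolding G_def[abs_def] G'_def using p[of y] by (auto intro!: derivative_eq_intros simp: power2_eq_square)
  have inj: "inj G" using t p by (auto simp: inj_def G_def field_simps)
  have rng: "range G = {0<..<t}"
  proof
    show "range G \<subseteq> {0<..<t}" using t p by (auto simp: G_def field_simps)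
    show "{0<..<t} \<subseteq> range G"
    proof
      fix s assume s: "s \<in> {0<..<t}"
      then have "G (ln (t / s - 1)) = s" by (simp add: G_def field_simps)
      then show "s \<in> range G" by (metis rangeI)
    qed
  qed
  have fm: "?f \<in> borel_measurable borel"
    unfolding mellin_D_def[abs_def] using fourier_measurable[OF v] by measurable
  \<comment> \<open>At \<open>s = 0\<close> and \<open>s = t\<close> the integrand is zero because
    \<open>mellin_D v\<close> is extended by zero, so the closed interval may be replaced by the
    open one.\<close>
  have "((\<lambda>s. cnj (?f s)) \<star> ?f) t = (LINT s:{0<..<t}|lborel. ?F s)"
    unfolding laplace_conv_def set_lebesgue_integral_def
    by (intro Bochner_Integration.integral_cong) (auto simp: indicator_def mellin_D_def)
  also have "\<dots> = (LINT y|lborel. \<bar>G' y\<bar> *\<^sub>R ?F (G y))"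
  proof (rule lborel_change_variables(2)[symmetric])
    show "?F \<in> borel_measurable borel"
      by (intro borel_measurable_times measurable_compose[OF _ fm] measurable_compose[OF fm borel_measurable_continuous_onI])
         (auto intro!: continuous_intros)
    show "G' \<in> borel_measurable borel" unfolding G'_def[abs_def] by measurable
  qed (use der inj rng in auto)
  also have "\<dots> = (LINT y|lborel. of_real (exp (y / 2) / (1 + exp y)) *
       (cnj (fourier v (ln t - ln (1 + exp y))) * fourier v (ln t + y - ln (1 + exp y))))"
  proof (intro Bochner_Integration.integral_cong refl)
    fix y :: real
    have G: "0 < G y" "t - G y = t * exp y / (1 + exp y)" "0 < t - G y"
      using t p[of y] by (auto simp: G_def field_simps)
    have l1: "ln (G y) = ln t - ln (1 + exp y)" unfolding G_def using t p[of y] by (simp add: ln_div)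
    have l2: "ln (t - G y) = ln t + y - ln (1 + exp y)" unfolding G(2) using t p[of y] by (simp add: ln_div ln_mult)
    have "\<bar>G' y\<bar> * (G y powr (- 1 / 2) * (t - G y) powr (- 1 / 2)) = exp (y / 2) / (1 + exp y)"
    proof -
      have "\<bar>G' y\<bar> = exp (ln t + y - 2 * ln (1 + exp y))"
      proof -
        have "exp (ln t + y - 2 * ln (1 + exp y)) = exp (ln t) * exp y / (exp (ln (1 + exp y)) * exp (ln (1 + exp y)))"
          unfolding mult_2 exp_diff exp_add ..
        also have "\<dots> = t * exp y / (1 + exp y)\<^sup>2"
          unfolding exp_ln[OF t] exp_ln[OF p(1)] power2_eq_square ..
        also have "\<dots> = \<bar>G' y\<bar>" using t by (simp add: G'_def abs_mult)
        finally show ?thesis ..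
      qed
      moreover have "G y powr (- 1 / 2) = exp (- (ln t - ln (1 + exp y)) / 2)"
        "(t - G y) powr (- 1 / 2) = exp (- (ln t + y - ln (1 + exp y)) / 2)"
        unfolding l1[symmetric] l2[symmetric] using G(1,3) by (simp_all add: powr_def)
      ultimately have "\<bar>G' y\<bar> * (G y powr (- 1 / 2) * (t - G y) powr (- 1 / 2)) = exp (y / 2 - ln (1 + exp y))"
        by (simp only: mult_exp_exp) (rule arg_cong[of _ _ exp], simp add: field_simps)
      also have "\<dots> = exp (y / 2) / exp (ln (1 + exp y))" by (rule exp_diff)
      finally show ?thesis unfolding exp_ln[OF p(1)] .
    qed
    then have c: "complex_of_real \<bar>G' y\<bar> * (of_real (G y powr (- 1 / 2)) * of_real ((t - G y) powr (- 1 / 2))) = of_real (exp (y / 2) / (1 + exp y))"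
      by (metis of_real_mult)
    have "?f (G y) = of_real (G y powr (- 1 / 2)) * fourier v (ln t - ln (1 + exp y))"
      unfolding mellin_D_def l1[symmetric] using G(1) by simp
    moreover have "?f (t - G y) = of_real ((t - G y) powr (- 1 / 2)) * fourier v (ln t + y - ln (1 + exp y))"
      unfolding mellin_D_def l2[symmetric] using G(3) by simp
    ultimately show "\<bar>G' y\<bar> *\<^sub>R ?F (G y) = of_real (exp (y / 2) / (1 + exp y)) *
       (cnj (fourier v (ln t - ln (1 + exp y))) * fourier v (ln t + y - ln (1 + exp y)))"
      by (simp only: c[symmetric] scaleR_conv_of_real complex_cnj_mult complex_cnj_complex_of_real mult_ac)
  qed
  finally show ?thesis .
qed

lemma Gamma_line_smooth:
  assumes "0 < a"
  shows "smooth (\<lambda>x. Gamma (of_real a - \<i> * of_real x))" "smooth (\<lambda>x. rGamma (of_real a - \<i> * of_real x))"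
proof -
  let ?S = "{z. 0 < Re z}"
  have S: "open ?S" "?S \<inter> \<int>\<^sub>\<le>\<^sub>0 = {}"
    by (auto simp: open_halfspace_Re_gt elim!: nonpos_Ints_cases)
  have G: "Gamma holomorphic_on ?S" using S(2) by (rule holomorphic_Gamma)
  have r: "(rGamma :: complex \<Rightarrow> complex) holomorphic_on ?S" by (rule holomorphic_rGamma)
  show "smooth (\<lambda>x. Gamma (of_real a - \<i> * of_real x))"
    using derivs_imp_smooth[OF derivs_holomorphic_line[OF G S(1), of "of_real a" "- \<i>"]] assms by simp
  show "smooth (\<lambda>x. rGamma (of_real a - \<i> * of_real x))"
    using derivs_imp_smooth[OF derivs_holomorphic_line[OF r S(1), of "of_real a" "- \<i>"]] assms by simp
qed

text \<open>For fixed frequencies \<open>\<xi>\<close> and \<open>\<eta>\<close> of the two factors,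
  the integral over \<open>y\<close> is the Beta integral with
  \<open>a = 1 / 2 + \<i> * \<xi>\<close> and \<open>b = 1 / 2 - \<i> * \<eta>\<close>. Two Gammas
  are absorbed into \<open>g\<close>; the reciprocal Gamma depends on \<open>\<eta> - \<xi>\<close>
  only, and what is left to integrate is an autocorrelation.\<close>

theorem laplace_conv_mellin:
  assumes v: "v \<in> test_funs"
  defines "g \<equiv> \<lambda>\<eta>. Gamma (1 / 2 - \<i> * of_real \<eta>) * v \<eta>"
  shows "(\<lambda>s. cnj (mellin_D v s)) \<star> mellin_D v =
    mellin_Z (\<lambda>\<zeta>. of_real (1 / sqrt (2 * pi)) * (rGamma (1 - \<i> * of_real \<zeta>) * corr g \<zeta>))"
    (is "_ = mellin_Z ?a")
proof
  fix t :: real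
  let ?c = "complex_of_real (1 / sqrt (2 * pi))"
  have gt: "g \<in> test_funs"
    unfolding g_def using test_funs_mult'[OF v Gamma_line_smooth(1)[of "1 / 2"]] by simp
  obtain R where R: "R > 0" "\<And>x. R < \<bar>x\<bar> \<Longrightarrow> v x = 0" using test_funsE[OF v] by metis
  then have Rg: "\<And>x. R < \<bar>x\<bar> \<Longrightarrow> g x = 0" by (simp add: g_def)
  show "((\<lambda>s. cnj (mellin_D v s)) \<star> mellin_D v) t = mellin_Z ?a t"
  proof (cases "0 < t")
    case False
    have "((\<lambda>s. cnj (mellin_D v s)) \<star> mellin_D v) t = (LINT s|(lborel :: real measure). 0)"
      unfolding laplace_conv_def set_lebesgue_integral_def
      by (intro Bochner_Integration.integral_cong) (use False in \<open>auto simp: indicator_def mellin_D_def\<close>)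
    then show ?thesis using False by (simp add: mellin_Z_def)
  next
    case True
    define \<tau> where "\<tau> = ln t"
    define L where "L y = ln (1 + exp y)" for y :: real
    define \<kappa> where "\<kappa> y = complex_of_real (exp (y / 2) / (1 + exp y))" for y :: real
    define \<Phi> where "\<Phi> = fourier v"
    have Lm [measurable]: "L \<in> borel_measurable borel" unfolding L_def[abs_def] by measurable
    have \<Phi>m [measurable]: "\<Phi> \<in> borel_measurable borel" unfolding \<Phi>_def by (rule fourier_measurable[OF v])
    obtain B where B: "\<And>x. norm (\<Phi> x) \<le> B" using rapid_bounded[OF fourier_rapid[OF v]] unfolding \<Phi>_def by metis
    have \<kappa>e: "\<kappa> y = exp (1 / 2 * of_real y) * exp (- of_real (L y))" for y
    proof -
      have "exp (y / 2) / (1 + exp y) = exp (y / 2) * exp (- L y)"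
        using exp_ln[of "1 + exp y"] add_pos_pos[OF zero_less_one exp_gt_zero[of y]]
        unfolding L_def exp_minus divide_inverse by (simp only:)
      then have "\<kappa> y = of_real (exp (y / 2)) * of_real (exp (- L y))" unfolding \<kappa>_def by (metis of_real_mult)
      then show ?thesis by (simp only: exp_of_real[symmetric]) simp
    qed
    have \<kappa>i: "integrable lborel \<kappa>"
      using Beta_integral_exp(1)[of "1 / 2" "1 / 2"] by (simp add: \<kappa>e[abs_def] L_def)
    have vi: "integrable lborel v" "integrable lborel (\<lambda>x. cnj (v x))"
      using v by (auto intro!: rapid_integrable test_funs_rapid)
    have gi: "integrable lborel g" "integrable lborel (\<lambda>x. cnj (g x))"
      using gt by (auto intro!: rapid_integrable test_funs_rapid)
    have F1: "cnj (fourier v (\<tau> - L y)) = (LINT \<xi>|lborel. cnj (v \<xi>) * (?c * exp (\<i> * of_real (\<xi> * (\<tau> - L y)))))" for y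
    proof -
      have "cnj (fourier v (\<tau> - L y)) = ?c * (LINT \<xi>|lborel. cnj (exp (\<i> * of_real (\<xi> * - (\<tau> - L y))) * v \<xi>))"
      proof -
        have "cnj (fourier v (\<tau> - L y)) = cnj ?c * cnj (LINT \<xi>|lborel. exp (\<i> * of_real (\<xi> * - (\<tau> - L y))) * v \<xi>)"
          unfolding fourier_osc osc_def by (rule complex_cnj_mult)
        then show ?thesis by (simp only: complex_cnj_complex_of_real cnj_lebesgue_integral)
      qed
      also have "\<dots> = (LINT \<xi>|lborel. ?c * cnj (exp (\<i> * of_real (\<xi> * - (\<tau> - L y))) * v \<xi>))"
        by (rule integral_mult_right_zero[symmetric])
      also have "\<dots> = (LINT \<xi>|lborel. cnj (v \<xi>) * (?c * exp (\<i> * of_real (\<xi> * (\<tau> - L y)))))"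
        by (intro Bochner_Integration.integral_cong refl) (simp add: exp_cnj algebra_simps)
      finally show ?thesis .
    qed
    have F2: "\<Phi> x = (LINT \<eta>|lborel. v \<eta> * (?c * exp (\<i> * of_real (- (\<eta> * x)))))" for x
      unfolding \<Phi>_def fourier_osc osc_def integral_mult_right_zero[symmetric]
      by (intro Bochner_Integration.integral_cong refl) simp
    define k where "k y \<xi> = ?c * exp (\<i> * of_real (\<xi> * (\<tau> - L y))) * \<Phi> (\<tau> + y - L y)" for y \<xi>
    \<comment> \<open>The reciprocal Gamma is unbounded on the line, whereas
      \<open>Fubini_shift\<close> asks for a bounded factor. The cut-off is harmless: differences of
      points of \<open>{-R..R}\<close> do not leave \<open>{- 2 * R..2 * R}\<close>.\<close>
    define m where "m \<zeta> = indicator {- 2 * R..2 * R} \<zeta> *\<^sub>R (?c * ?c * (exp (\<i> * of_real (- (\<tau> * \<zeta>))) * rGamma (1 - \<i> * of_real \<zeta>)))" for \<zeta>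
    have inner: "(LINT y|lborel. \<kappa> y * v \<eta> * (cnj (v \<xi>) * ?c * exp (\<i> * of_real (\<xi> * (\<tau> - L y))) *
         (?c * exp (\<i> * of_real (- (\<eta> * (\<tau> + y - L y))))))) = cnj (g \<xi>) * (g \<eta> * m (\<eta> - \<xi>))" for \<xi> \<eta>
    proof (cases "R < \<bar>\<xi>\<bar> \<or> R < \<bar>\<eta>\<bar>")
      case True
      then have "v \<xi> = 0 \<or> v \<eta> = 0" using R by auto
      then show ?thesis by (auto simp: g_def)
    next
      case False
      let ?A = "1 / 2 + \<i> * of_real \<xi>" and ?B = "1 / 2 - \<i> * of_real \<eta>"
      have "(LINT y|lborel. \<kappa> y * v \<eta> * (cnj (v \<xi>) * ?c * exp (\<i> * of_real (\<xi> * (\<tau> - L y))) *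
         (?c * exp (\<i> * of_real (- (\<eta> * (\<tau> + y - L y))))))) =
         (LINT y|lborel. (cnj (v \<xi>) * v \<eta> * (?c * ?c) * exp (\<i> * of_real (- (\<tau> * (\<eta> - \<xi>))))) *
            (exp (?B * of_real y) * exp (- (?A + ?B) * of_real (ln (1 + exp y)))))"
      proof (intro Bochner_Integration.integral_cong refl)
        fix y
        have "exp (1 / 2 * of_real y) * exp (- of_real (L y)) * (exp (\<i> * of_real (\<xi> * (\<tau> - L y))) * exp (\<i> * of_real (- (\<eta> * (\<tau> + y - L y)))))
          = exp (\<i> * of_real (- (\<tau> * (\<eta> - \<xi>)))) * (exp (?B * of_real y) * exp (- (?A + ?B) * of_real (L y)))"
          unfolding mult_exp_exp by (intro arg_cong[of _ _ exp]) (simp add: algebra_simps)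
        then have "(cnj (v \<xi>) * v \<eta> * (?c * ?c)) * (exp (1 / 2 * of_real y) * exp (- of_real (L y)) * (exp (\<i> * of_real (\<xi> * (\<tau> - L y))) * exp (\<i> * of_real (- (\<eta> * (\<tau> + y - L y))))))
          = (cnj (v \<xi>) * v \<eta> * (?c * ?c)) * (exp (\<i> * of_real (- (\<tau> * (\<eta> - \<xi>)))) * (exp (?B * of_real y) * exp (- (?A + ?B) * of_real (L y))))"
          by (rule arg_cong)
        then show "\<kappa> y * v \<eta> * (cnj (v \<xi>) * ?c * exp (\<i> * of_real (\<xi> * (\<tau> - L y))) *
           (?c * exp (\<i> * of_real (- (\<eta> * (\<tau> + y - L y)))))) = (cnj (v \<xi>) * v \<eta> * (?c * ?c) * exp (\<i> * of_real (- (\<tau> * (\<eta> - \<xi>))))) *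
            (exp (?B * of_real y) * exp (- (?A + ?B) * of_real (ln (1 + exp y))))"
          unfolding \<kappa>e L_def by (simp only: mult_ac)
      qed
      also have "\<dots> = (cnj (v \<xi>) * v \<eta> * (?c * ?c) * exp (\<i> * of_real (- (\<tau> * (\<eta> - \<xi>))))) * (Gamma ?A * Gamma ?B * rGamma (?A + ?B))"
        by (subst integral_mult_right_zero, subst Beta_integral_exp(2)) auto
      also have "\<dots> = cnj (g \<xi>) * (g \<eta> * m (\<eta> - \<xi>))"
      proof -
        have "cnj (g \<xi>) = Gamma ?A * cnj (v \<xi>)" unfolding g_def by (simp add: cnj_Gamma)
        moreover have "?A + ?B = 1 - \<i> * of_real (\<eta> - \<xi>)" by (simp add: algebra_simps)
        moreover have "\<eta> - \<xi> \<in> {- 2 * R..2 * R}" using False by auto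
        then have "m (\<eta> - \<xi>) = ?c * ?c * (exp (\<i> * of_real (- (\<tau> * (\<eta> - \<xi>)))) * rGamma (1 - \<i> * of_real (\<eta> - \<xi>)))"
          unfolding m_def by (simp only: indicator_simps scaleR_one)
        ultimately show ?thesis unfolding g_def by (simp only: mult_ac)
      qed
      finally show ?thesis .
    qed
    have "((\<lambda>s. cnj (mellin_D v s)) \<star> mellin_D v) t = (LINT y|lborel. \<kappa> y * (cnj (fourier v (\<tau> - L y)) * \<Phi> (\<tau> + y - L y)))"
      unfolding laplace_conv_mellin_aux[OF v True] \<kappa>_def \<tau>_def L_def \<Phi>_def ..
    \<comment> \<open>The Fourier integrals are opened one at a time, so that each interchange
      involves only \<open>y\<close> and one frequency, with the integrable weight
      \<open>\<kappa>\<close> and a bounded kernel.\<close>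
    also have "\<dots> = (LINT y|lborel. LINT \<xi>|lborel. \<kappa> y * cnj (v \<xi>) * k y \<xi>)"
    proof (intro Bochner_Integration.integral_cong refl)
      fix y
      have "\<kappa> y * (cnj (fourier v (\<tau> - L y)) * \<Phi> (\<tau> + y - L y)) =
         (\<kappa> y * \<Phi> (\<tau> + y - L y)) * (LINT \<xi>|lborel. cnj (v \<xi>) * (?c * exp (\<i> * of_real (\<xi> * (\<tau> - L y)))))"
        unfolding F1 by (simp only: mult_ac)
      also have "\<dots> = (LINT \<xi>|lborel. (\<kappa> y * \<Phi> (\<tau> + y - L y)) * (cnj (v \<xi>) * (?c * exp (\<i> * of_real (\<xi> * (\<tau> - L y))))))"
        by (rule integral_mult_right_zero[symmetric])
      finally show "\<kappa> y * (cnj (fourier v (\<tau> - L y)) * \<Phi> (\<tau> + y - L y)) = (LINT \<xi>|lborel. \<kappa> y * cnj (v \<xi>) * k y \<xi>)"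
        unfolding k_def by (simp only: mult_ac)
    qed
    also have "\<dots> = (LINT \<xi>|lborel. LINT y|lborel. \<kappa> y * cnj (v \<xi>) * k y \<xi>)"
    proof (rule Fubini_mult_bounded[symmetric, OF \<kappa>i vi(2)])
      show "(\<lambda>(y, \<xi>). k y \<xi>) \<in> borel_measurable (lborel \<Otimes>\<^sub>M lborel)" unfolding k_def by measurable
      show "norm (k y \<xi>) \<le> norm ?c * B" for y \<xi>
        unfolding k_def norm_mult norm_exp_i_times_real mult_1_right by (intro mult_left_mono B) auto
    qed
    also have "\<dots> = (LINT \<xi>|lborel. cnj (g \<xi>) * (LINT \<eta>|lborel. g \<eta> * m (\<eta> - \<xi>)))"
    proof (intro Bochner_Integration.integral_cong refl)
      fix \<xi>
      let ?K = "\<lambda>y \<eta>. cnj (v \<xi>) * ?c * exp (\<i> * of_real (\<xi> * (\<tau> - L y))) *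
         (?c * exp (\<i> * of_real (- (\<eta> * (\<tau> + y - L y)))))"
      have "(LINT y|lborel. \<kappa> y * cnj (v \<xi>) * k y \<xi>) = (LINT y|lborel. LINT \<eta>|lborel. \<kappa> y * v \<eta> * ?K y \<eta>)"
      proof (intro Bochner_Integration.integral_cong refl)
        fix y
        have "\<kappa> y * cnj (v \<xi>) * k y \<xi> = (\<kappa> y * (cnj (v \<xi>) * ?c * exp (\<i> * of_real (\<xi> * (\<tau> - L y))))) *
           (LINT \<eta>|lborel. v \<eta> * (?c * exp (\<i> * of_real (- (\<eta> * (\<tau> + y - L y))))))"
          unfolding k_def F2 by (simp only: mult_ac)
        also have "\<dots> = (LINT \<eta>|lborel. (\<kappa> y * (cnj (v \<xi>) * ?c * exp (\<i> * of_real (\<xi> * (\<tau> - L y))))) *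
           (v \<eta> * (?c * exp (\<i> * of_real (- (\<eta> * (\<tau> + y - L y)))))))"
          by (rule integral_mult_right_zero[symmetric])
        finally show "\<kappa> y * cnj (v \<xi>) * k y \<xi> = (LINT \<eta>|lborel. \<kappa> y * v \<eta> * ?K y \<eta>)"
          by (simp only: mult_ac)
      qed
      also have "\<dots> = (LINT \<eta>|lborel. LINT y|lborel. \<kappa> y * v \<eta> * ?K y \<eta>)"
      proof (rule Fubini_mult_bounded[symmetric, OF \<kappa>i vi(1)])
        show "(\<lambda>(y, \<eta>). ?K y \<eta>) \<in> borel_measurable (lborel \<Otimes>\<^sub>M lborel)" by measurable
        show "norm (?K y \<eta>) \<le> norm (v \<xi>) * norm ?c * norm ?c" for y \<eta>
          unfolding norm_mult norm_exp_i_times_real mult_1_right complex_mod_cnj by (simp add: mult.assoc)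
      qed
      also have "\<dots> = cnj (g \<xi>) * (LINT \<eta>|lborel. g \<eta> * m (\<eta> - \<xi>))"
        unfolding inner by (rule integral_mult_right_zero)
      finally show "(LINT y|lborel. \<kappa> y * cnj (v \<xi>) * k y \<xi>) = cnj (g \<xi>) * (LINT \<eta>|lborel. g \<eta> * m (\<eta> - \<xi>))" .
    qed
    also have "\<dots> = (LINT \<zeta>|lborel. corr g \<zeta> * m \<zeta>)"
    proof -
      have mc: "continuous_on UNIV (\<lambda>\<zeta>. ?c * ?c * (exp (\<i> * of_real (- (\<tau> * \<zeta>))) * rGamma (1 - \<i> * of_real \<zeta>)))"
        using smooth_continuous_on_0[OF Gamma_line_smooth(2)[of 1]] by (intro continuous_intros) auto
      have mm: "m \<in> borel_measurable borel"
        unfolding m_def[abs_def]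
        by (intro borel_measurable_scaleR borel_measurable_continuous_onI mc borel_measurable_indicator) auto
      have "bounded ((\<lambda>\<zeta>. ?c * ?c * (exp (\<i> * of_real (- (\<tau> * \<zeta>))) * rGamma (1 - \<i> * of_real \<zeta>))) ` {- 2 * R..2 * R})"
        by (intro compact_imp_bounded compact_continuous_image continuous_on_subset[OF mc]) auto
      then obtain K where K: "\<And>\<zeta>. \<zeta> \<in> {- 2 * R..2 * R} \<Longrightarrow>
          norm (?c * ?c * (exp (\<i> * of_real (- (\<tau> * \<zeta>))) * rGamma (1 - \<i> * of_real \<zeta>))) \<le> K"
        unfolding bounded_iff by blast
      have "norm (m \<zeta>) \<le> max K 0" for \<zeta>
      proof (cases "\<zeta> \<in> {- 2 * R..2 * R}")
        case True
        then have "norm (m \<zeta>) \<le> K" unfolding m_def using K by (simp only: indicator_simps scaleR_one)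
        then show ?thesis by simp
      qed (simp add: m_def)
      then show ?thesis unfolding corr_def by (intro Fubini_shift gi mm)
    qed
    also have "\<dots> = (LINT \<zeta>|lborel. ?c * (exp (\<i> * of_real (\<zeta> * - \<tau>)) * ?a \<zeta>))"
    proof (intro Bochner_Integration.integral_cong refl)
      fix \<zeta>
      show "corr g \<zeta> * m \<zeta> = ?c * (exp (\<i> * of_real (\<zeta> * - \<tau>)) * ?a \<zeta>)"
      proof (cases "\<zeta> \<in> {- 2 * R..2 * R}")
        case True
        then have "m \<zeta> = ?c * ?c * (exp (\<i> * of_real (- (\<tau> * \<zeta>))) * rGamma (1 - \<i> * of_real \<zeta>))"
          unfolding m_def by (simp only: indicator_simps scaleR_one)
        moreover have "- (\<tau> * \<zeta>) = \<zeta> * - \<tau>" by simp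
        ultimately show ?thesis by (simp only: mult_ac)
      next
        case False
        then have "2 * R < \<bar>\<zeta>\<bar>" by auto
        then show ?thesis using corr_support[of R g \<zeta>] Rg by simp
      qed
    qed
    also have "\<dots> = fourier ?a \<tau>"
      unfolding fourier_osc osc_def by (rule integral_mult_right_zero)
    finally show ?thesis using True by (simp add: mellin_Z_def \<tau>_def)
  qed
qed

section \<open>Distributions applied to superpositions of exponentials\<close>

definition wave :: "real \<Rightarrow> real \<Rightarrow> complex" where
  "wave y x = exp (\<i> * of_real (y * x))"

lemma wave_derivs: "derivs (wave y) (\<lambda>k x. (\<i> * of_real y) ^ k * wave y x)"
  using derivs_exp[of y] unfolding wave_def[abs_def] .

lemma wave_smooth: "smooth (wave y)"
  using wave_derivs by (rule derivs_imp_smooth)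

lemma norm_wave [simp]: "norm (wave y x) = 1"
  unfolding wave_def by (rule norm_exp_i_times_real)

lemma power_abs_le: "k \<le> N \<Longrightarrow> \<bar>y :: real\<bar> ^ k \<le> (1 + y\<^sup>2) ^ N"
proof -
  assume k: "k \<le> N"
  have "0 \<le> (\<bar>y\<bar> - 1)\<^sup>2" by simp
  then have "\<bar>y\<bar> \<le> 1 + y\<^sup>2" by (simp add: power2_diff)
  then have "\<bar>y\<bar> ^ k \<le> (1 + y\<^sup>2) ^ k" by (intro power_mono) auto
  also have "\<dots> \<le> (1 + y\<^sup>2) ^ N" using k by (intro power_increasing) auto
  finally show ?thesis .
qed

lemma wave_deriv_bound: "k \<le> N \<Longrightarrow> norm (nth_deriv k (wave y) x) \<le> (1 + y\<^sup>2) ^ N"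
  unfolding derivs_nth_deriv_eq[OF wave_derivs] using power_abs_le[of k N y]
  by (simp add: norm_mult norm_power)

text \<open>The expressions compared are the derivatives of order \<open>k\<close> in
  \<open>x\<close> of \<open>wave y x * w y\<close>; so this is continuity of the family in the
  norms that control a functional on \<open>{-R..R}\<close>. It comes from uniform continuity on a
  compact rectangle.\<close>

lemma wave_family_continuous:
  fixes w :: "real \<Rightarrow> complex"
  assumes w: "continuous_on UNIV w" and \<eta>: "0 < \<eta>"
  shows "\<exists>\<delta>>0. \<forall>y. \<bar>y - c\<bar> < \<delta> \<longrightarrow> (\<forall>k\<le>N. \<forall>x\<in>{-R..R}.
    norm ((\<i> * of_real y) ^ k * wave y x * w y - (\<i> * of_real c) ^ k * wave c x * w c) \<le> \<eta>)"
proof (induction N)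
  have single: "\<exists>\<delta>>0. \<forall>y. \<bar>y - c\<bar> < \<delta> \<longrightarrow> (\<forall>x\<in>{-R..R}.
    norm ((\<i> * of_real y) ^ k * wave y x * w y - (\<i> * of_real c) ^ k * wave c x * w c) \<le> \<eta>)" for k
  proof -
    let ?Q = "\<lambda>z. (\<i> * of_real (fst z)) ^ k * exp (\<i> * of_real (fst z * snd z)) * w (fst z)"
    have "continuous_on ({c-1..c+1} \<times> {-R..R}) ?Q"
      by (intro continuous_intros continuous_on_compose2[OF w]) auto
    then have "uniformly_continuous_on ({c-1..c+1} \<times> {-R..R}) ?Q"
      by (intro compact_uniformly_continuous compact_Times) auto
    then obtain d where d: "d > 0" "\<And>z z'. z \<in> {c-1..c+1} \<times> {-R..R} \<Longrightarrow> z' \<in> {c-1..c+1} \<times> {-R..R} \<Longrightarrow>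
        dist z' z < d \<Longrightarrow> dist (?Q z') (?Q z) < \<eta>"
      using \<eta> unfolding uniformly_continuous_on_def by metis
    have "norm ((\<i> * of_real y) ^ k * wave y x * w y - (\<i> * of_real c) ^ k * wave c x * w c) \<le> \<eta>"
      if "\<bar>y - c\<bar> < min d 1" "x \<in> {-R..R}" for y x
    proof -
      have "dist (?Q (y, x)) (?Q (c, x)) < \<eta>"
        using that by (intro d(2)) (auto simp: dist_Pair_Pair dist_real_def)
      then show ?thesis by (simp add: dist_norm wave_def)
    qed
    then show ?thesis using d(1) by (intro exI[of _ "min d 1"]) auto
  qed
  case 0 then show ?case using single[of 0] by auto
  case (Suc N)
  then obtain \<delta> where \<delta>: "\<delta> > 0" "\<And>y k x. \<bar>y - c\<bar> < \<delta> \<Longrightarrow> k \<le> N \<Longrightarrow> x \<in> {-R..R} \<Longrightarrow>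
    norm ((\<i> * of_real y) ^ k * wave y x * w y - (\<i> * of_real c) ^ k * wave c x * w c) \<le> \<eta>" by metis
  obtain \<delta>' where \<delta>': "\<delta>' > 0" "\<And>y x. \<bar>y - c\<bar> < \<delta>' \<Longrightarrow> x \<in> {-R..R} \<Longrightarrow>
    norm ((\<i> * of_real y) ^ Suc N * wave y x * w y - (\<i> * of_real c) ^ Suc N * wave c x * w c) \<le> \<eta>"
    using single[of "Suc N"] by metis
  show ?case
  proof (intro exI[of _ "min \<delta> \<delta>'"] conjI allI impI ballI)
    fix y k x assume "\<bar>y - c\<bar> < min \<delta> \<delta>'" "k \<le> Suc N" "x \<in> {-R..R}"
    then show "norm ((\<i> * of_real y) ^ k * wave y x * w y - (\<i> * of_real c) ^ k * wave c x * w c) \<le> \<eta>"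
      using \<delta>(2)[of y k x] \<delta>'(2)[of y x] by (cases "k = Suc N") auto
  qed (use \<delta> \<delta>' in auto)
qed

locale test_functional =
  fixes T :: "(real \<Rightarrow> complex) \<Rightarrow> complex"
  assumes T_add: "u \<in> test_funs \<Longrightarrow> v \<in> test_funs \<Longrightarrow> T (\<lambda>x. u x + v x) = T u + T v"
    and T_cmult: "u \<in> test_funs \<Longrightarrow> T (\<lambda>x. c * u x) = c * T u"
    and T_bounded: "dist_bounded T"
begin

lemma T_mult_add:
  assumes "\<theta> \<in> test_funs" "smooth u" "smooth v"
  shows "T (\<lambda>x. \<theta> x * (u x + c * v x)) = T (\<lambda>x. \<theta> x * u x) + c * T (\<lambda>x. \<theta> x * v x)"
proof -
  have "T (\<lambda>x. \<theta> x * u x + c * (\<theta> x * v x)) = T (\<lambda>x. \<theta> x * u x) + T (\<lambda>x. c * (\<theta> x * v x))"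
    using assms by (intro T_add test_funs_cmult test_funs_mult)
  also have "T (\<lambda>x. c * (\<theta> x * v x)) = c * T (\<lambda>x. \<theta> x * v x)"
    using assms by (intro T_cmult test_funs_mult)
  finally show ?thesis by (simp add: algebra_simps)
qed

text \<open>The cut-off \<open>\<theta>\<close> lets \<open>T\<close> act on smooth functions of
  arbitrary support, and by Leibniz' formula only their derivatives on \<open>{-R..R}\<close>
  count.\<close>

lemma T_mult_bound:
  assumes \<theta>: "\<theta> \<in> test_funs_in {-R..R}" and R: "0 \<le> R"
  shows "\<exists>C N. 0 \<le> C \<and> (\<forall>v \<beta>. smooth v \<longrightarrow>
    (\<forall>k x. k \<le> N \<longrightarrow> x \<in> {-R..R} \<longrightarrow> norm (nth_deriv k v x) \<le> \<beta>) \<longrightarrow> norm (T (\<lambda>x. \<theta> x * v x)) \<le> C * \<beta>)"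
proof -
  obtain C N where C: "0 \<le> C" "\<forall>u\<in>test_funs_in {-R..R}. \<forall>\<beta>.
     (\<forall>k\<le>N. \<forall>x. norm (nth_deriv k u x) \<le> \<beta>) \<longrightarrow> norm (T u) \<le> C * \<beta>"
    using T_bounded unfolding dist_bounded_def by blast
  obtain B where B: "0 \<le> B" "\<And>k x. k \<le> N \<Longrightarrow> norm (nth_deriv k \<theta> x) \<le> B"
    using test_funs_bounded_nth_derivs[OF test_funs_in_test_funs[OF \<theta>], of N] by blast
  have \<theta>s: "smooth \<theta>" "\<forall>x. R < \<bar>x\<bar> \<longrightarrow> \<theta> x = 0" using \<theta> by (auto simp: test_funs_in_interval)
  show ?thesis
  proof (intro exI[of _ "C * (2 ^ N * B)"] exI[of _ N] conjI allI impI)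
    show "0 \<le> C * (2 ^ N * B)" using C B by simp
    fix v \<beta>
    assume v: "smooth v" and b: "\<forall>k x. k \<le> N \<longrightarrow> x \<in> {-R..R} \<longrightarrow> norm (nth_deriv k v x) \<le> \<beta>"
    \<comment> \<open>The assumption on \<open>R\<close> puts \<open>0\<close> into the interval, so
      \<open>\<beta>\<close> bounds at least one norm.\<close>
    have \<beta>: "0 \<le> \<beta>" using b[rule_format, of 0 0] R order_trans[OF norm_ge_zero] by fastforce
    have "norm (nth_deriv k (\<lambda>x. \<theta> x * v x) x) \<le> 2 ^ N * (B * \<beta>)" if k: "k \<le> N" for k x
    proof (cases "x \<in> {-R..R}")
      case True
      have "norm (nth_deriv k (\<lambda>x. \<theta> x * v x) x) \<le> 2 ^ k * (B * \<beta>)"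
        using k B b True by (intro nth_deriv_mult_bound \<theta>s v) auto
      also have "\<dots> \<le> 2 ^ N * (B * \<beta>)" using k B \<beta> by (intro mult_right_mono power_increasing) auto
      finally show ?thesis .
    next
      case False
      then have "nth_deriv k (\<lambda>x. \<theta> x * v x) x = 0"
        using \<theta>s by (intro nth_deriv_eq_0_outside[of R]) (auto simp: abs_if split: if_splits)
      then show ?thesis using B \<beta> by simp
    qed
    then have "norm (T (\<lambda>x. \<theta> x * v x)) \<le> C * (2 ^ N * (B * \<beta>))"
      using C(2) test_funs_in_mult[OF \<theta> v] by blast
    then show "norm (T (\<lambda>x. \<theta> x * v x)) \<le> C * (2 ^ N * B) * \<beta>" by (simp add: mult.assoc)
  qed
qed

text \<open>Each derivative of \<open>wave y\<close> costs a factor \<open>y\<close>, so the order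
  of \<open>T\<close> on the support of \<open>\<theta>\<close> becomes polynomial growth in
  \<open>y\<close>.\<close>

lemma T_wave_bound:
  assumes "\<theta> \<in> test_funs"
  obtains C N where "0 \<le> C" "\<And>y. norm (T (\<lambda>x. \<theta> x * wave y x)) \<le> C * (1 + y\<^sup>2) ^ N"
proof -
  obtain R where R: "R > 0" "\<theta> \<in> test_funs_in {-R..R}" using test_funsE[OF assms] by metis
  obtain C N where C: "0 \<le> C" "\<And>v \<beta>. smooth v \<Longrightarrow>
    (\<And>k x. k \<le> N \<Longrightarrow> x \<in> {-R..R} \<Longrightarrow> norm (nth_deriv k v x) \<le> \<beta>) \<Longrightarrow> norm (T (\<lambda>x. \<theta> x * v x)) \<le> C * \<beta>"
    using T_mult_bound[OF R(2) less_imp_le[OF R(1)]] by blast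
  show ?thesis using that[OF C(1)] C(2)[OF wave_smooth] wave_deriv_bound by metis
qed

text \<open>Supplies the measurability of this function of \<open>y\<close> and the continuous
  integrand for the fundamental theorem of calculus in \<open>T_osc\<close>.\<close>

lemma T_wave_continuous:
  assumes "\<theta> \<in> test_funs" shows "continuous_on UNIV (\<lambda>y. T (\<lambda>x. \<theta> x * wave y x))"
proof -
  obtain R where R: "R > 0" "\<theta> \<in> test_funs_in {-R..R}" using test_funsE[OF assms] by metis
  obtain C N where C: "0 \<le> C" "\<And>v \<beta>. smooth v \<Longrightarrow>
    (\<And>k x. k \<le> N \<Longrightarrow> x \<in> {-R..R} \<Longrightarrow> norm (nth_deriv k v x) \<le> \<beta>) \<Longrightarrow> norm (T (\<lambda>x. \<theta> x * v x)) \<le> C * \<beta>"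
    using T_mult_bound[OF R(2) less_imp_le[OF R(1)]] by blast
  show ?thesis unfolding continuous_on_iff
  proof (intro ballI allI impI)
    fix c e :: real assume e: "0 < e"
    define \<eta> where "\<eta> = e / (C + 1) / 2"
    have \<eta>: "0 < \<eta>" using e C by (simp add: \<eta>_def)
    obtain \<delta> where \<delta>: "\<delta> > 0" "\<And>y k x. \<bar>y - c\<bar> < \<delta> \<Longrightarrow> k \<le> N \<Longrightarrow> x \<in> {-R..R} \<Longrightarrow>
      norm ((\<i> * of_real y) ^ k * wave y x * 1 - (\<i> * of_real c) ^ k * wave c x * 1) \<le> \<eta>"
      using wave_family_continuous[of "\<lambda>_. 1", OF _ \<eta>, of c N R] continuous_on_const by metis
    have "dist (T (\<lambda>x. \<theta> x * wave y x)) (T (\<lambda>x. \<theta> x * wave c x)) < e" if y: "\<bar>y - c\<bar> < \<delta>" for y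
    proof -
      have "norm (T (\<lambda>x. \<theta> x * (wave y x + (- 1) * wave c x))) \<le> C * \<eta>"
      proof (rule C(2))
        show "smooth (\<lambda>x. wave y x + (- 1) * wave c x)" by (intro smooth_add smooth_cmult wave_smooth)
        fix k x assume "k \<le> N" "x \<in> {-R..R}"
        then show "norm (nth_deriv k (\<lambda>x. wave y x + (- 1) * wave c x) x) \<le> \<eta>"
          using \<delta>(2)[OF y, of k x] derivs_nth_deriv_eq[OF derivs_add[OF wave_derivs derivs_cmult[OF wave_derivs]], of k y "- 1" c]
          by simp
      qed
      also have "T (\<lambda>x. \<theta> x * (wave y x + (- 1) * wave c x)) = T (\<lambda>x. \<theta> x * wave y x) + (- 1) * T (\<lambda>x. \<theta> x * wave c x)"
        by (intro T_mult_add assms wave_smooth)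
      also have "C * \<eta> < e"
      proof -
        have "C * \<eta> \<le> (C + 1) * \<eta>" using \<eta> by (simp add: distrib_right)
        also have "(C + 1) * \<eta> = e / 2" using C(1) by (simp add: \<eta>_def field_simps)
        finally show ?thesis using e by simp
      qed
      finally show ?thesis by (simp add: dist_norm)
    qed
    then show "\<exists>d>0. \<forall>y\<in>UNIV. dist y c < d \<longrightarrow> dist (T (\<lambda>x. \<theta> x * wave y x)) (T (\<lambda>x. \<theta> x * wave c x)) < e"
      using \<delta>(1) by (auto simp: dist_real_def)
  qed
qed

text \<open>The integral over \<open>(-n, Y]\<close> is differentiable in \<open>Y\<close> with respect to all the norms that bound
  \<open>T\<close>, so \<open>T\<close> may be applied under the integral sign.\<close>

theorem T_osc:
  assumes \<theta>: "\<theta> \<in> test_funs" and w: "rapid w"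
  shows "integrable lborel (\<lambda>y. w y * T (\<lambda>x. \<theta> x * wave y x))"
    and "(LINT y|lborel. w y * T (\<lambda>x. \<theta> x * wave y x)) = T (\<lambda>x. \<theta> x * osc w x)"
proof -
  define \<rho> where "\<rho> y = T (\<lambda>x. \<theta> x * wave y x)" for y
  have wc: "continuous_on UNIV w" using w by (simp add: rapid_def)
  have \<rho>c: "continuous_on UNIV \<rho>" unfolding \<rho>_def using \<theta> by (rule T_wave_continuous)
  obtain A M where A: "0 \<le> A" "\<And>y. norm (\<rho> y) \<le> A * (1 + y\<^sup>2) ^ M"
    using T_wave_bound[OF \<theta>] unfolding \<rho>_def by metis
  obtain K where K: "\<And>y. (1 + y\<^sup>2) ^ Suc M * norm (w y) \<le> K" using rapid_bound[OF w] by metis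
  show i: "integrable lborel (\<lambda>y. w y * T (\<lambda>x. \<theta> x * wave y x))"
    unfolding \<rho>_def[symmetric]
  proof (rule integrable_if_decay[where C = "A * K"])
    show "(\<lambda>y. w y * \<rho> y) \<in> borel_measurable lborel"
      by (intro borel_measurable_continuous_UNIV continuous_intros wc \<rho>c)
    fix y
    have "(1 + y\<^sup>2) * norm (w y * \<rho> y) \<le> (1 + y\<^sup>2) * (norm (w y) * (A * (1 + y\<^sup>2) ^ M))"
      unfolding norm_mult by (intro mult_left_mono A) auto
    also have "\<dots> = A * ((1 + y\<^sup>2) ^ Suc M * norm (w y))" by simp
    also have "\<dots> \<le> A * K" using A K by (intro mult_left_mono)
    finally show "(1 + y\<^sup>2) * norm (w y * \<rho> y) \<le> A * K" .
  qed
  obtain R where R: "R > 0" "\<theta> \<in> test_funs_in {-R..R}" using test_funsE[OF \<theta>] by metis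
  obtain C N where C: "0 \<le> C" "\<And>v \<beta>. smooth v \<Longrightarrow>
    (\<And>k x. k \<le> N \<Longrightarrow> x \<in> {-R..R} \<Longrightarrow> norm (nth_deriv k v x) \<le> \<beta>) \<Longrightarrow> norm (T (\<lambda>x. \<theta> x * v x)) \<le> C * \<beta>"
    using T_mult_bound[OF R(2) less_imp_le[OF R(1)]] by blast
  \<comment> \<open>With half-open intervals, truncations to adjacent intervals add up without
    exception at the common end point.\<close>
  define W where "W a b y = indicator {a<..b} y *\<^sub>R w y" for a b y :: real
  have wm: "integrable lborel (\<lambda>y. of_real y ^ k * w y)" for k
    using rapid_moments[OF w] by (simp add: moments_def)
  have Wint: "integrable lborel (\<lambda>y. of_real y ^ k * W a b y)" for k a b
  proof -
    have "integrable lborel (\<lambda>y. indicator {a<..b} y *\<^sub>R (of_real y ^ k * w y))"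
      using wm by (intro integrable_mult_indicator) auto
    then show ?thesis unfolding W_def by (simp add: mult_scaleR_right)
  qed
  then have Wmom: "moments (W a b)" for a b by (simp add: moments_def)
  have Wd: "derivs (osc (W a b)) (\<lambda>k. osc (\<lambda>y. (\<i> * of_real y) ^ k * W a b y))" for a b
    using Wmom by (rule osc_derivs)
  have Ws: "smooth (osc (W a b))" for a b using Wd by (rule derivs_imp_smooth)
  have split: "osc (W a c) x = osc (W a b) x + osc (W b c) x" if "a \<le> b" "b \<le> c" for a b c x
  proof -
    have "W a c = (\<lambda>y. W a b y + W b c y)" using that by (auto simp: W_def indicator_def fun_eq_iff)
    then show ?thesis using osc_add[of "W a b" "W b c"] Wint[of 0] by simp
  qed
  define \<Delta> where "\<Delta> a b = T (\<lambda>x. \<theta> x * osc (W a b) x)" for a b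
  have \<Delta>_split: "\<Delta> a c = \<Delta> a b + \<Delta> b c" if "a \<le> b" "b \<le> c" for a b c
    unfolding \<Delta>_def split[OF that] using T_mult_add[OF \<theta> Ws Ws, of _ _ 1] by simp
  \<comment> \<open>Over a short interval containing \<open>c\<close> the increment of
    \<open>\<Delta>\<close> is \<open>w c * \<rho> c\<close> times the length, up to
    \<open>e\<close> times the length. Allowing \<open>c\<close> anywhere in the interval covers
    both one-sided derivatives.\<close>
  have small: "\<exists>\<delta>>0. \<forall>a b. a \<le> c \<and> c \<le> b \<and> b - a < \<delta> \<longrightarrow> norm (\<Delta> a b - of_real (b - a) * (w c * \<rho> c)) \<le> e * (b - a)"
    if e: "0 < e" for c e
  proof -
    define \<eta> where "\<eta> = e / (C + 1)"
    have \<eta>: "0 < \<eta>" "C * \<eta> \<le> e" using e C by (auto simp: \<eta>_def field_simps)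
    obtain \<delta> where \<delta>: "\<delta> > 0" "\<And>y k x. \<bar>y - c\<bar> < \<delta> \<Longrightarrow> k \<le> N \<Longrightarrow> x \<in> {-R..R} \<Longrightarrow>
      norm ((\<i> * of_real y) ^ k * wave y x * w y - (\<i> * of_real c) ^ k * wave c x * w c) \<le> \<eta>"
      using wave_family_continuous[OF wc \<eta>(1), of c N R] by metis
    have "norm (\<Delta> a b - of_real (b - a) * (w c * \<rho> c)) \<le> e * (b - a)" if ab: "a \<le> c" "c \<le> b" "b - a < \<delta>" for a b
    proof -
      \<comment> \<open>\<open>V\<close> is the integral over \<open>(a, b]\<close> of the
        difference between the family at \<open>y\<close> and at \<open>c\<close>; all its
        derivatives up to order \<open>N\<close> are at most \<open>\<eta> * (b - a)\<close> on
        \<open>{-R..R}\<close>.\<close>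
      define V where "V x = osc (W a b) x + (- of_real (b - a) * w c) * wave c x" for x
      have Vd: "derivs V (\<lambda>k x. osc (\<lambda>y. (\<i> * of_real y) ^ k * W a b y) x + (- of_real (b - a) * w c) * ((\<i> * of_real c) ^ k * wave c x))"
        unfolding V_def[abs_def] by (intro derivs_add derivs_cmult Wd wave_derivs)
      have "norm (T (\<lambda>x. \<theta> x * V x)) \<le> C * (\<eta> * (b - a))"
      proof (rule C(2))
        show "smooth V" using Vd by (rule derivs_imp_smooth)
        fix k x assume kx: "k \<le> N" "x \<in> {-R..R}"
        let ?q = "\<lambda>y. (\<i> * of_real y) ^ k * wave y x * w y"
        have i1: "integrable lborel (\<lambda>y. indicator {a<..b} y *\<^sub>R ?q y)"
        proof -
          have "integrable lborel (\<lambda>y. \<i> ^ k * (exp (\<i> * of_real (y * x)) * (of_real y ^ k * W a b y)))"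
            using integrable_exp_mult[OF Wint[of k a b], of x] by (rule integrable_mult_right)
          also have "(\<lambda>y. \<i> ^ k * (exp (\<i> * of_real (y * x)) * (of_real y ^ k * W a b y))) = (\<lambda>y. indicator {a<..b} y *\<^sub>R ?q y)"
            by (simp add: fun_eq_iff W_def wave_def power_mult_distrib mult_scaleR_right mult_ac)
          finally show ?thesis .
        qed
        have ind: "integrable lborel (indicator {a<..b} :: real \<Rightarrow> real)"
          by (rule integrable_real_indicator) (use ab in auto)
        have i2: "integrable lborel (\<lambda>y. indicator {a<..b} y *\<^sub>R ?q c)" using ind by (rule integrable_scaleR_left)
        have i3: "integrable lborel (\<lambda>y. indicator {a<..b} y * \<eta>)" using ind by (rule integrable_mult_left)
        have "nth_deriv k V x = osc (\<lambda>y. (\<i> * of_real y) ^ k * W a b y) x + (- of_real (b - a) * w c) * ((\<i> * of_real c) ^ k * wave c x)"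
          using derivs_nth_deriv_eq[OF Vd] by simp
        also have "osc (\<lambda>y. (\<i> * of_real y) ^ k * W a b y) x = (LINT y|lborel. indicator {a<..b} y *\<^sub>R ?q y)"
          unfolding osc_def W_def wave_def
          by (intro Bochner_Integration.integral_cong refl) (simp add: mult_scaleR_right mult_ac)
        also have "(- of_real (b - a) * w c) * ((\<i> * of_real c) ^ k * wave c x) = - (LINT y|lborel. indicator {a<..b} y *\<^sub>R ?q c)"
          using ab by (simp add: scaleR_conv_of_real mult_ac) (simp add: algebra_simps)
        also have "(LINT y|lborel. indicator {a<..b} y *\<^sub>R ?q y) + - (LINT y|lborel. indicator {a<..b} y *\<^sub>R ?q c) =
           (LINT y|lborel. indicator {a<..b} y *\<^sub>R ?q y - indicator {a<..b} y *\<^sub>R ?q c)"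
          using Bochner_Integration.integral_diff[OF i1 i2] by simp
        also have "norm \<dots> \<le> (LINT y|lborel. indicator {a<..b} y * \<eta>)"
        proof (rule norm_lebesgue_integral_le[OF i3])
          fix y
          show "norm (indicator {a<..b} y *\<^sub>R ?q y - indicator {a<..b} y *\<^sub>R ?q c) \<le> indicator {a<..b} y * \<eta>"
            using \<delta>(2)[of y k x] kx ab by (auto simp: indicator_def)
        qed
        also have "\<dots> = \<eta> * (b - a)" using ab by simp
        finally show "norm (nth_deriv k V x) \<le> \<eta> * (b - a)" .
      qed
      also have "T (\<lambda>x. \<theta> x * V x) = \<Delta> a b - of_real (b - a) * (w c * \<rho> c)"
        unfolding V_def T_mult_add[OF \<theta> Ws wave_smooth] \<Delta>_def \<rho>_def by (simp add: algebra_simps)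
      also have "C * (\<eta> * (b - a)) \<le> e * (b - a)"
        using mult_right_mono[OF \<eta>(2), of "b - a"] ab by (simp add: mult.assoc)
      finally show ?thesis .
    qed
    then show ?thesis using \<delta>(1) by blast
  qed
  have fin: "\<Delta> (- real n) (real n) = (LINT y|lborel. indicator {- real n..real n} y *\<^sub>R (w y * \<rho> y))" for n
  proof -
    have der: "((\<lambda>Y. \<Delta> (- real n) Y) has_vector_derivative w Y * \<rho> Y) (at Y within {- real n..real n})"
      if Y: "Y \<in> {- real n..real n}" for Y
      unfolding has_vector_derivative_def has_derivative_within_alt
    proof (intro conjI allI impI)
      show "bounded_linear (\<lambda>x. x *\<^sub>R (w Y * \<rho> Y))" by (rule bounded_linear_scaleR_left)
      fix e :: real assume e: "0 < e"
      obtain \<delta> where \<delta>: "\<delta> > 0" "\<And>a b. a \<le> Y \<Longrightarrow> Y \<le> b \<Longrightarrow> b - a < \<delta> \<Longrightarrow>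
          norm (\<Delta> a b - of_real (b - a) * (w Y * \<rho> Y)) \<le> e * (b - a)" using small[OF e, of Y] by blast
      have "norm (\<Delta> (- real n) Y' - \<Delta> (- real n) Y - (Y' - Y) *\<^sub>R (w Y * \<rho> Y)) \<le> e * norm (Y' - Y)"
        if Y': "Y' \<in> {- real n..real n}" "norm (Y' - Y) < \<delta>" for Y'
      proof (cases "Y \<le> Y'")
        case True
        then have "\<Delta> (- real n) Y' - \<Delta> (- real n) Y - (Y' - Y) *\<^sub>R (w Y * \<rho> Y) = \<Delta> Y Y' - of_real (Y' - Y) * (w Y * \<rho> Y)"
          using \<Delta>_split[of "- real n" Y Y'] Y by (simp add: scaleR_conv_of_real)
        then show ?thesis using \<delta>(2)[of Y Y'] True Y' by simp
      next
        case False
        then have "\<Delta> (- real n) Y' - \<Delta> (- real n) Y - (Y' - Y) *\<^sub>R (w Y * \<rho> Y) = - (\<Delta> Y' Y - of_real (Y - Y') * (w Y * \<rho> Y))"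
          using \<Delta>_split[of "- real n" Y' Y] Y' by (simp add: scaleR_conv_of_real algebra_simps)
        then show ?thesis using \<delta>(2)[of Y' Y] False Y' by (simp only: norm_minus_cancel) simp
      qed
      then show "\<exists>d>0. \<forall>Y'\<in>{- real n..real n}. norm (Y' - Y) < d \<longrightarrow>
         norm (\<Delta> (- real n) Y' - \<Delta> (- real n) Y - (Y' - Y) *\<^sub>R (w Y * \<rho> Y)) \<le> e * norm (Y' - Y)"
        using \<delta>(1) by blast
    qed
    have "(LINT y|lborel. indicator {- real n..real n} y *\<^sub>R (w y * \<rho> y)) = \<Delta> (- real n) (real n) - \<Delta> (- real n) (- real n)"
      by (rule integral_FTC_Icc) (use der in \<open>auto intro!: continuous_intros continuous_on_subset[OF wc] continuous_on_subset[OF \<rho>c]\<close>)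
    \<comment> \<open>Additivity with three equal end points gives
      \<open>\<Delta> = \<Delta> + \<Delta>\<close>.\<close>
    also have "\<Delta> (- real n) (- real n) = 0" using \<Delta>_split[of "- real n" "- real n" "- real n"] by simp
    finally show ?thesis by simp
  qed
  have "(\<lambda>n. \<Delta> (- real n) (real n)) \<longlonglongrightarrow> (LINT y|lborel. w y * \<rho> y)"
    unfolding fin by (rule tendsto_integral_truncated) (use i in \<open>simp add: \<rho>_def\<close>)
  moreover have "(\<lambda>n. \<Delta> (- real n) (real n)) \<longlonglongrightarrow> T (\<lambda>x. \<theta> x * osc w x)"
  proof -
    \<comment> \<open>The weight dominates the powers of \<open>y\<close> of degree up to
      \<open>N\<close> that differentiation brings down, so one integral controls all the norms in
      question.\<close>
    define tail where "tail n = (LINT y|lborel. norm (((1 + y\<^sup>2) ^ N) *\<^sub>R (w y - W (- real n) (real n) y)))" for n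
    obtain K' where K': "\<And>y. (1 + y\<^sup>2) ^ Suc N * norm (w y) \<le> K'" using rapid_bound[OF w] by metis
    have wN: "integrable lborel (\<lambda>y. ((1 + y\<^sup>2) ^ N) *\<^sub>R w y)"
    proof (rule integrable_if_decay[where C = K'])
      show "(\<lambda>y. ((1 + y\<^sup>2) ^ N) *\<^sub>R w y) \<in> borel_measurable lborel"
        by (intro borel_measurable_continuous_UNIV continuous_intros wc)
      show "(1 + y\<^sup>2) * norm (((1 + y\<^sup>2) ^ N) *\<^sub>R w y) \<le> K'" for y using K'[of y] by (simp add: mult.assoc abs_of_nonneg)
    qed
    have Wm: "W a b \<in> borel_measurable lborel" for a b
      using Wint[of 0 a b] by auto
    have Wle: "norm (w y - W a b y) \<le> norm (w y)" for a b y by (simp add: W_def indicator_def)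
    have tail0: "tail \<longlonglongrightarrow> (LINT y|lborel. norm (((1 + y\<^sup>2) ^ N) *\<^sub>R (0 :: complex)))"
      unfolding tail_def
    proof (rule integral_dominated_convergence)
      show "integrable lborel (\<lambda>y. norm (((1 + y\<^sup>2) ^ N) *\<^sub>R w y))" using wN by (rule integrable_norm)
      show "(\<lambda>y. norm (((1 + y\<^sup>2) ^ N) *\<^sub>R (w y - W (- real n) (real n) y))) \<in> borel_measurable lborel" for n
        using Wm rapid_measurable[OF w] by measurable
      show "AE y in lborel. norm (norm (((1 + y\<^sup>2) ^ N) *\<^sub>R (w y - W (- real n) (real n) y))) \<le> norm (((1 + y\<^sup>2) ^ N) *\<^sub>R w y)" for n
        using Wle by (intro AE_I2) (simp add: mult_left_mono)
      show "AE y in lborel. (\<lambda>n. norm (((1 + y\<^sup>2) ^ N) *\<^sub>R (w y - W (- real n) (real n) y))) \<longlonglongrightarrow> norm (((1 + y\<^sup>2) ^ N) *\<^sub>R (0 :: complex))"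
      proof (intro AE_I2 tendsto_eventually)
        fix y :: real
        obtain n0 :: nat where "\<bar>y\<bar> < real n0" using reals_Archimedean2 by blast
        then have "w y - W (- real n) (real n) y = 0" if "n \<ge> n0" for n using that by (auto simp: W_def indicator_def)
        then show "\<forall>\<^sub>F n in sequentially. norm (((1 + y\<^sup>2) ^ N) *\<^sub>R (w y - W (- real n) (real n) y)) = norm (((1 + y\<^sup>2) ^ N) *\<^sub>R (0 :: complex))"
          unfolding eventually_sequentially by (intro exI[of _ n0]) simp
      qed
    qed simp
    have wd: "derivs (osc w) (\<lambda>k. osc (\<lambda>y. (\<i> * of_real y) ^ k * w y))" by (rule osc_derivs[OF rapid_moments[OF w]])
    have bd: "norm (T (\<lambda>x. \<theta> x * osc w x) - \<Delta> (- real n) (real n)) \<le> C * tail n" for n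
    proof -
      let ?W = "W (- real n) (real n)"
      define V where "V x = osc w x + (- 1) * osc ?W x" for x
      have Vd: "derivs V (\<lambda>k x. osc (\<lambda>y. (\<i> * of_real y) ^ k * w y) x + (- 1) * osc (\<lambda>y. (\<i> * of_real y) ^ k * ?W y) x)"
        unfolding V_def[abs_def] by (intro derivs_add derivs_cmult Wd wd)
      have "norm (T (\<lambda>x. \<theta> x * V x)) \<le> C * tail n"
      proof (rule C(2))
        show "smooth V" using Vd by (rule derivs_imp_smooth)
        fix k x assume kx: "k \<le> N" "x \<in> {-R..R}"
        have i1: "integrable lborel (\<lambda>y. (\<i> * of_real y) ^ k * w y)"
          using integrable_mult_right[OF wm[of k], of "\<i> ^ k"] by (simp add: power_mult_distrib mult.assoc)
        have i2: "integrable lborel (\<lambda>y. - 1 * ((\<i> * of_real y) ^ k * ?W y))"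
          using integrable_mult_right[OF Wint[of k], of "- 1 * \<i> ^ k"] by (simp add: power_mult_distrib mult.assoc)
        have "nth_deriv k V x = osc (\<lambda>y. (\<i> * of_real y) ^ k * w y) x + (- 1) * osc (\<lambda>y. (\<i> * of_real y) ^ k * ?W y) x"
          using derivs_nth_deriv_eq[OF Vd] by simp
        also have "\<dots> = osc (\<lambda>y. (\<i> * of_real y) ^ k * w y + (- 1) * ((\<i> * of_real y) ^ k * ?W y)) x"
          unfolding osc_add[OF i1 i2] osc_cmult ..
        also have "norm \<dots> \<le> (LINT y|lborel. norm ((\<i> * of_real y) ^ k * w y + (- 1) * ((\<i> * of_real y) ^ k * ?W y)))"
          by (rule osc_norm_le)
        also have "\<dots> \<le> tail n"
          unfolding tail_def
        proof (rule integral_mono')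
          show "integrable lborel (\<lambda>y. norm (((1 + y\<^sup>2) ^ N) *\<^sub>R (w y - ?W y)))"
            using wN Wle Wm rapid_measurable[OF w]
            by (intro integrable_norm Bochner_Integration.integrable_bound[OF wN]) (auto intro!: AE_I2 mult_left_mono)
          fix y
          have "(\<i> * of_real y) ^ k * w y + (- 1) * ((\<i> * of_real y) ^ k * ?W y) = (\<i> * of_real y) ^ k * (w y - ?W y)"
            by (simp add: algebra_simps)
          also have "norm \<dots> \<le> (1 + y\<^sup>2) ^ N * norm (w y - ?W y)"
            unfolding norm_mult using power_abs_le[OF kx(1), of y] by (intro mult_right_mono) (auto simp: norm_power norm_mult)
          finally show "norm ((\<i> * of_real y) ^ k * w y + (- 1) * ((\<i> * of_real y) ^ k * ?W y)) \<le> norm (((1 + y\<^sup>2) ^ N) *\<^sub>R (w y - ?W y))"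
            by (simp add: abs_of_nonneg)
        qed simp
        finally show "norm (nth_deriv k V x) \<le> tail n" .
      qed
      also have "T (\<lambda>x. \<theta> x * V x) = T (\<lambda>x. \<theta> x * osc w x) - \<Delta> (- real n) (real n)"
        unfolding V_def T_mult_add[OF \<theta> derivs_imp_smooth[OF wd] Ws] \<Delta>_def by simp
      finally show ?thesis .
    qed
    have "(\<lambda>n. T (\<lambda>x. \<theta> x * osc w x) - \<Delta> (- real n) (real n)) \<longlonglongrightarrow> 0"
    proof (rule Lim_null_comparison)
      show "(\<lambda>n. C * tail n) \<longlonglongrightarrow> 0" using tendsto_mult_left[OF tail0, of C] by simp
    qed (use bd in simp)
    from tendsto_diff[OF tendsto_const[of "T (\<lambda>x. \<theta> x * osc w x)"] this] show ?thesis by simp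
  qed
  ultimately show "(LINT y|lborel. w y * T (\<lambda>x. \<theta> x * wave y x)) = T (\<lambda>x. \<theta> x * osc w x)"
    unfolding \<rho>_def by (rule LIMSEQ_unique)
qed

end

section \<open>The Bochner-Schwartz theorem\<close>

text \<open>The two phases combine to one that is free of \<open>\<xi>\<close>. Hence a functional
  that is nonnegative on autocorrelations is nonnegative on \<open>wave y\<close> times an
  autocorrelation, which makes the transform of \<open>\<theta> n\<close> times \<open>T\<close>
  nonnegative at every \<open>y\<close>.\<close>

lemma corr_wave: "corr (\<lambda>\<xi>. wave y \<xi> * g \<xi>) \<zeta> = wave y \<zeta> * corr g \<zeta>"
proof -
  have "cnj (wave y \<xi> * g \<xi>) * (wave y (\<xi> + \<zeta>) * g (\<xi> + \<zeta>)) = wave y \<zeta> * (cnj (g \<xi>) * g (\<xi> + \<zeta>))" for \<xi>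
  proof -
    have "cnj (wave y \<xi>) * wave y (\<xi> + \<zeta>) = wave y \<zeta>"
      unfolding wave_def exp_cnj mult_exp_exp by (rule arg_cong[of _ _ exp]) (simp add: algebra_simps)
    then have "cnj (g \<xi>) * g (\<xi> + \<zeta>) * (cnj (wave y \<xi>) * wave y (\<xi> + \<zeta>)) = cnj (g \<xi>) * g (\<xi> + \<zeta>) * wave y \<zeta>"
      by simp
    then show ?thesis by (simp only: complex_cnj_mult mult_ac)
  qed
  then show ?thesis unfolding corr_def by (simp only: integral_mult_right_zero)
qed

text \<open>The factor \<open>sqrt \<epsilon>\<close> preserves the L2 norm; so the dilates of an
  autocorrelation are autocorrelations with unchanged value at \<open>0\<close>, and they can serve
  as multipliers tending to \<open>1\<close>.\<close>

lemma corr_dilation: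
  assumes "0 < \<epsilon>"
  shows "corr (\<lambda>\<xi>. of_real (sqrt \<epsilon>) * g (\<epsilon> * \<xi>)) \<zeta> = corr g (\<epsilon> * \<zeta>)"
proof -
  have "corr g (\<epsilon> * \<zeta>) = \<bar>\<epsilon>\<bar> *\<^sub>R (LINT \<xi>|lborel. cnj (g (0 + \<epsilon> * \<xi>)) * g (0 + \<epsilon> * \<xi> + \<epsilon> * \<zeta>))"
    unfolding corr_def using assms by (intro lborel_integral_real_affine) auto
  also have "\<dots> = (LINT \<xi>|lborel. of_real \<epsilon> * (cnj (g (\<epsilon> * \<xi>)) * g (\<epsilon> * (\<xi> + \<zeta>))))"
    using assms by (simp add: scaleR_conv_of_real distrib_left)
  also have "\<dots> = corr (\<lambda>\<xi>. of_real (sqrt \<epsilon>) * g (\<epsilon> * \<xi>)) \<zeta>"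
    unfolding corr_def
  proof (intro Bochner_Integration.integral_cong refl)
    fix \<xi>
    have "complex_of_real \<epsilon> = of_real (sqrt \<epsilon>) * of_real (sqrt \<epsilon>)"
      using assms by (simp flip: of_real_mult)
    then show "of_real \<epsilon> * (cnj (g (\<epsilon> * \<xi>)) * g (\<epsilon> * (\<xi> + \<zeta>))) =
      cnj (of_real (sqrt \<epsilon>) * g (\<epsilon> * \<xi>)) * (of_real (sqrt \<epsilon>) * g (\<epsilon> * (\<xi> + \<zeta>)))"
      by (simp only: complex_cnj_mult complex_cnj_complex_of_real mult_ac)
  qed
  finally show ?thesis ..
qed

lemma dilation_test_funs:
  assumes "0 < \<epsilon>" "g \<in> test_funs" shows "(\<lambda>\<xi>. g (\<epsilon> * \<xi>)) \<in> test_funs"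
proof -
  obtain R where R: "R > 0" "\<And>x. R < \<bar>x\<bar> \<Longrightarrow> g x = 0" using test_funsE[OF assms(2)] by metis
  have "smooth (\<lambda>\<xi>. g (\<epsilon> * \<xi>))"
    using derivs_imp_smooth[OF derivs_affine[OF smooth_derivs[OF test_funs_smooth[OF assms(2)]], of \<epsilon> 0]] by simp
  moreover have "g (\<epsilon> * x) = 0" if "R / \<epsilon> < \<bar>x\<bar>" for x
    using that assms(1) by (intro R(2)) (simp add: abs_mult field_simps)
  ultimately show ?thesis by (auto simp: test_funs_iff)
qed

lemma fourier_wave: "fourier (\<lambda>x. wave s x * u x) \<xi> = fourier u (\<xi> - s)"
proof -
  have "exp (- \<i> * of_real (x * \<xi>)) * wave s x = exp (- \<i> * of_real (x * (\<xi> - s)))" for x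
    unfolding wave_def mult_exp_exp by (rule arg_cong[of _ _ exp]) (simp add: algebra_simps)
  then show ?thesis unfolding fourier_def by (simp only: mult.assoc[symmetric])
qed

text \<open>\<open>corr g 0\<close> is the squared L2 norm, which is positive because a continuous
  function that is nonzero somewhere is nonzero on an open set.\<close>

lemma normalised_test_function:
  obtains g where "g \<in> test_funs" "corr g 0 = 1"
proof -
  obtain g where g: "g \<in> test_funs" "0 < Re (g (1 / 2))" using bump_test_function by metis
  have c: "continuous_on UNIV g" using g(1) by (simp add: test_funs_smooth smooth_continuous_on_0)
  define K where "K = (LINT x|lborel. (norm (g x))\<^sup>2)"
  have i: "integrable lborel (\<lambda>x. (norm (g x))\<^sup>2)"
    using rapid_integrable[OF rapid_norm_square[OF test_funs_rapid[OF g(1)]]]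
    by (simp only: complex_of_real_integrable_eq)
  have "K \<noteq> 0"
  proof
    assume "K = 0"
    then have "AE x in lborel. (norm (g x))\<^sup>2 = 0"
      unfolding K_def using integral_nonneg_eq_0_iff_AE[OF i] by simp
    then have "AE x in lborel. g x = 0" by simp
    then have "{x. g x \<noteq> 0} \<in> null_sets lborel"
    proof (subst AE_iff_null_sets)
      show "{x. g x \<noteq> 0} \<in> sets lborel"
        using c by (simp add: borel_open open_Collect_neq)
    qed simp
    then have "negligible {x. g x \<noteq> 0}"
      by (simp add: negligible_iff_null_sets null_sets_completionI)
    moreover have "open {x. g x \<noteq> 0}" using c by (intro open_Collect_neq continuous_intros)
    moreover have "1 / 2 \<in> {x. g x \<noteq> 0}" using g(2) by auto
    ultimately show False using open_not_negligible by blast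
  qed
  moreover have "0 \<le> K" unfolding K_def by simp
  ultimately have K: "0 < K" by simp
  show ?thesis
  proof (rule that)
    show "(\<lambda>x. of_real (1 / sqrt K) * g x) \<in> test_funs" using g(1) by (rule test_funs_cmult)
    have "corr (\<lambda>x. of_real (1 / sqrt K) * g x) 0 = (LINT x|lborel. of_real ((1 / K) * (norm (g x))\<^sup>2))"
      unfolding corr_def
    proof (intro Bochner_Integration.integral_cong refl)
      fix x
      have "cnj (of_real (1 / sqrt K) * g x) * (of_real (1 / sqrt K) * g (x + 0)) =
         of_real (1 / sqrt K * (1 / sqrt K)) * (g x * cnj (g x))"
        by (simp only: complex_cnj_mult complex_cnj_complex_of_real add_0_right of_real_mult mult_ac)
      also have "1 / sqrt K * (1 / sqrt K) = 1 / K" using K by (simp add: field_simps)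
      also have "of_real (1 / K) * (g x * cnj (g x)) = of_real ((1 / K) * (norm (g x))\<^sup>2)"
        by (simp only: of_real_mult complex_norm_square)
      finally show "cnj (of_real (1 / sqrt K) * g x) * (of_real (1 / sqrt K) * g (x + 0)) = of_real ((1 / K) * (norm (g x))\<^sup>2)" .
    qed
    also have "\<dots> = of_real ((1 / K) * K)"
      unfolding integral_complex_of_real K_def integral_mult_right_zero ..
    finally show "corr (\<lambda>x. of_real (1 / sqrt K) * g x) 0 = 1" using K by simp
  qed
qed

text \<open>Helly's selection theorem gives a limit measure, after division by a weight that makes the
  family of measures tight.\<close>

lemma weak_limit_representation:
  fixes T :: "(real \<Rightarrow> complex) \<Rightarrow> complex" and r :: "nat \<Rightarrow> real \<Rightarrow> real"
  assumes rm: "\<And>n. r n \<in> borel_measurable borel" and r0: "\<And>n y. 0 \<le> r n y"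
    and lim: "\<And>u. u \<in> test_funs \<Longrightarrow> (\<lambda>n. LINT y|lborel. fourier u y * of_real (r n y)) \<longlonglongrightarrow> of_real (sqrt (2 * pi)) * T u"
    and bi: "\<And>n. integrable lborel (\<lambda>y. r n y / (1 + y\<^sup>2) ^ k)"
    and bd: "\<And>n. (LINT y|lborel. r n y / (1 + y\<^sup>2) ^ k) \<le> A"
  shows "\<exists>M c m. real_distribution M \<and> 0 \<le> c \<and>
    (\<forall>u\<in>test_funs. T u = of_real c * (LINT x|M. of_real ((1 + x\<^sup>2) ^ m) * fourier u x))"
proof (cases "\<forall>u\<in>test_funs. T u = 0")
  \<comment> \<open>If \<open>T\<close> vanishes, the masses may tend to \<open>0\<close>, which
    leaves no control over their normalisation; with \<open>c = 0\<close> any probability measure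
    serves.\<close>
  case True
  have "real_distribution (return borel 0)"
    unfolding real_distribution_def real_distribution_axioms_def
    using prob_space_return[of "0 :: real" borel] by simp
  then show ?thesis using True by (intro exI[of _ "return borel 0"] exI[of _ 0]) auto
next
  case False
  then obtain u0 where u0: "u0 \<in> test_funs" "T u0 \<noteq> 0" by blast
  \<comment> \<open>One power more than in the assumed bound: the surplus factor
    \<open>1 / (1 + y\<^sup>2)\<close> makes the mass near infinity uniformly small.\<close>
  let ?W = "\<lambda>y::real. (1 + y\<^sup>2) ^ Suc k"
  have W: "1 \<le> ?W y" "0 < ?W y" for y by (auto simp del: power_Suc intro!: one_le_power zero_less_power add_pos_nonneg)
  define p where "p n y = r n y / ?W y" for n y
  have p0: "0 \<le> p n y" for n y unfolding p_def using r0 W(2)[of y] by (intro divide_nonneg_pos)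
  have p_eq: "p n y = r n y / (1 + y\<^sup>2) ^ k / (1 + y\<^sup>2)" for n y by (simp add: p_def mult.commute)
  have ple: "p n y \<le> r n y / (1 + y\<^sup>2) ^ k" for n y
  proof -
    have "r n y / (1 + y\<^sup>2) ^ k / (1 + y\<^sup>2) \<le> r n y / (1 + y\<^sup>2) ^ k / 1"
      using r0[of n y] by (intro divide_left_mono divide_nonneg_nonneg) (auto simp: add_pos_nonneg)
    then show ?thesis unfolding p_eq by simp
  qed
  have pm: "p n \<in> borel_measurable borel" for n unfolding p_def[abs_def] using rm by measurable
  have pi: "integrable lborel (p n)" for n
    by (rule Bochner_Integration.integrable_bound[OF bi[of n]])
       (use pm p0 ple r0 in \<open>auto intro!: AE_I2 simp: abs_of_nonneg\<close>)
  define m where "m n = (LINT y|lborel. p n y)" for n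
  have mA: "m n \<le> A" for n unfolding m_def using bd[of n] integral_mono[OF pi bi ple] by (meson order_trans)
  define F where "F u y = of_real (?W y) * fourier u y" for u y
  have Fc: "continuous_on UNIV (F u)" if "u \<in> test_funs" for u
    unfolding F_def using fourier_rapid[OF that] unfolding rapid_def by (intro continuous_intros) auto
  have Fb: "\<exists>B. \<forall>y. norm (F u y) \<le> B" if u: "u \<in> test_funs" for u
  proof -
    obtain C where "\<And>y. ?W y * norm (fourier u y) \<le> C" using rapid_bound[OF fourier_rapid[OF u], of "Suc k"] by metis
    moreover have "norm (F u y) = ?W y * norm (fourier u y)" for y
      unfolding F_def norm_mult norm_of_real using W(2)[of y] by (simp del: power_Suc)
    ultimately show ?thesis by metis
  qed
  have pF: "(LINT y|lborel. p n y *\<^sub>R F u y) = (LINT y|lborel. fourier u y * of_real (r n y))" for n u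
  proof (intro Bochner_Integration.integral_cong refl)
    fix y
    have "?W y \<noteq> 0" using W(2)[of y] by (rule less_imp_neq[THEN not_sym])
    then have "p n y * ?W y = r n y"
      unfolding p_def times_divide_eq_left by (rule nonzero_mult_div_cancel_right)
    then have "complex_of_real (p n y) * of_real (?W y) = of_real (r n y)" by (metis of_real_mult)
    then show "p n y *\<^sub>R F u y = fourier u y * of_real (r n y)"
      unfolding F_def scaleR_conv_of_real mult.assoc[symmetric] by (simp only: mult.commute)
  qed
  \<comment> \<open>Since \<open>T u0\<close> is nonzero, the integrals against \<open>F u0\<close>
    stay away from \<open>0\<close> for large \<open>n\<close>; as \<open>F u0\<close> is bounded,
    so do the masses \<open>m n\<close>.\<close>
  obtain S0 where S0: "\<And>y. norm (F u0 y) \<le> S0" using Fb[OF u0(1)] by blast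
  define S where "S = max S0 1"
  have S: "0 < S" "\<And>y. norm (F u0 y) \<le> S" unfolding S_def using S0 by (auto intro: max.coboundedI1)
  define a where "a = norm (of_real (sqrt (2 * pi)) * T u0) / 2"
  have a: "0 < a" using u0(2) by (simp add: a_def)
  have "\<forall>\<^sub>F n in sequentially. a < norm (LINT y|lborel. fourier u0 y * of_real (r n y))"
    using tendsto_norm[OF lim[OF u0(1)]] a by (intro order_tendstoD(1)) (auto simp: a_def)
  then obtain n0 where n0: "\<And>n. n \<ge> n0 \<Longrightarrow> a < norm (LINT y|lborel. fourier u0 y * of_real (r n y))"
    by (auto simp: eventually_sequentially)
  have mlow: "a / S \<le> m n" if "n \<ge> n0" for n
  proof -
    have "a \<le> norm (LINT y|lborel. p n y *\<^sub>R F u0 y)" using n0[OF that] unfolding pF by simp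
    also have "\<dots> \<le> (LINT y|lborel. p n y * S)"
      by (rule norm_lebesgue_integral_le) (use pi p0 S in \<open>auto intro!: mult_left_mono\<close>)
    also have "\<dots> = m n * S" by (simp add: m_def)
    finally show ?thesis using S(1) by (simp add: field_simps)
  qed
  define \<alpha> where "\<alpha> = a / S"
  have aS: "0 < \<alpha>" using a S by (simp add: \<alpha>_def)
  note mlow = mlow[folded \<alpha>_def]
  \<comment> \<open>The finitely many indices without a lower bound on the mass are skipped.\<close>
  define q where "q i = i + n0" for i :: nat
  have mpos: "0 < m (q i)" for i using less_le_trans[OF aS mlow[of "q i"]] by (simp add: q_def)
  define \<nu> where "\<nu> i = density lborel (\<lambda>y. ennreal (p (q i) y / m (q i)))" for i
  have dm: "(\<lambda>y. p (q i) y / m (q i)) \<in> borel_measurable lborel" for i using pm by measurable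
  have d0: "0 \<le> p (q i) y / m (q i)" for i y using p0 mpos[of i] by (intro divide_nonneg_pos)
  have di: "integrable lborel (\<lambda>y. p (q i) y / m (q i))" for i using pi by simp
  have rd: "real_distribution (\<nu> i)" for i
  proof -
    have "(\<integral>\<^sup>+ y. ennreal (p (q i) y / m (q i)) \<partial>lborel) = ennreal (LINT y|lborel. p (q i) y / m (q i))"
      by (rule nn_integral_eq_integral[OF di]) (use d0 in auto)
    also have "(LINT y|lborel. p (q i) y / m (q i)) = 1" using mpos[of i] by (simp add: m_def)
    finally have "emeasure (\<nu> i) (space (\<nu> i)) = 1"
      unfolding \<nu>_def using dm[of i] by (simp add: emeasure_density)
    then have "prob_space (\<nu> i)" by (rule prob_spaceI)
    then show ?thesis by (simp add: real_distribution_def real_distribution_axioms_def \<nu>_def)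
  qed
  have \<nu>int: "m (q i) *\<^sub>R (LINT y|\<nu> i. F u y) = (LINT y|lborel. fourier u y * of_real (r (q i) y))" if "u \<in> test_funs" for i u
  proof -
    have "(LINT y|\<nu> i. F u y) = (LINT y|lborel. (p (q i) y / m (q i)) *\<^sub>R F u y)"
      unfolding \<nu>_def by (rule integral_density) (use borel_measurable_continuous_UNIV[OF Fc[OF that]] dm d0 in auto)
    also have "\<dots> = (LINT y|lborel. (1 / m (q i)) *\<^sub>R (p (q i) y *\<^sub>R F u y))" by simp
    also have "\<dots> = (1 / m (q i)) *\<^sub>R (LINT y|lborel. p (q i) y *\<^sub>R F u y)" by (rule integral_scaleR_right)
    finally show ?thesis using mpos[of i] by (simp add: pF)
  qed
  have tight: "tight \<nu>"
    unfolding tight_def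
  proof (intro conjI allI impI rd)
    fix \<epsilon> :: real assume \<epsilon>: "0 < \<epsilon>"
    have A: "0 \<le> A" using mA[of n0] mlow[of n0] aS by simp
    \<comment> \<open>Outside \<open>{- b<..b}\<close> the surplus factor is at most
      \<open>1 / b\<close>, which leaves mass at most \<open>A / \<alpha> / b\<close>. The summand
      \<open>1\<close> makes this strictly less than \<open>\<epsilon>\<close> and gives
      \<open>b \<le> b\<^sup>2\<close>.\<close>
    define b where "b = A / \<alpha> / \<epsilon> + 1"
    have b: "1 \<le> b" unfolding b_def using divide_nonneg_pos[OF divide_nonneg_pos[OF A aS] \<epsilon>] by linarith
    have "measure (\<nu> i) {- b<..b} > 1 - \<epsilon>" for i
    proof -
      interpret real_distribution "\<nu> i" by (rule rd)
      have "measure (\<nu> i) (UNIV - {- b<..b}) = (LINT y|\<nu> i. indicator (UNIV - {- b<..b}) y)" by simp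
      also have "\<dots> = (LINT y|lborel. (p (q i) y / m (q i)) * indicator (UNIV - {- b<..b}) y)"
        unfolding \<nu>_def by (subst integral_density) (use dm d0 in auto)
      also have "\<dots> \<le> (LINT y|lborel. (1 / (m (q i) * b)) * (r (q i) y / (1 + y\<^sup>2) ^ k))"
      proof (rule integral_mono')
        show "integrable lborel (\<lambda>y. 1 / (m (q i) * b) * (r (q i) y / (1 + y\<^sup>2) ^ k))" using bi by (rule integrable_mult_right)
        fix y :: real
        have nn: "0 \<le> 1 / (m (q i) * b) * (r (q i) y / (1 + y\<^sup>2) ^ k)"
          using mpos[of i] b r0 by (intro mult_nonneg_nonneg divide_nonneg_nonneg) auto
        then show "0 \<le> 1 / (m (q i) * b) * (r (q i) y / (1 + y\<^sup>2) ^ k)" .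
        show "p (q i) y / m (q i) * indicator (UNIV - {- b<..b}) y \<le> 1 / (m (q i) * b) * (r (q i) y / (1 + y\<^sup>2) ^ k)"
        proof (cases "y \<in> {- b<..b}")
          case False
          then have "b \<le> \<bar>y\<bar>" by auto
          then have "b\<^sup>2 \<le> y\<^sup>2" using b by (metis abs_le_square_iff abs_of_nonneg order_trans zero_le_one)
          moreover have "b \<le> b\<^sup>2" using b by (simp add: power2_eq_square)
          ultimately have b1: "b \<le> 1 + y\<^sup>2" by simp
          have "p (q i) y \<le> r (q i) y / (1 + y\<^sup>2) ^ k / b"
            unfolding p_eq using b1 b r0 by (intro divide_left_mono mult_pos_pos divide_nonneg_nonneg) auto
          then have "p (q i) y / m (q i) \<le> r (q i) y / (1 + y\<^sup>2) ^ k / b / m (q i)"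
            using mpos[of i] by (intro divide_right_mono) auto
          then show ?thesis using False by (simp add: mult_ac)
        qed (use nn in simp)
      qed
      also have "\<dots> \<le> 1 / (m (q i) * b) * A"
        using bd[of "q i"] mpos[of i] b by (subst integral_mult_right_zero, intro mult_left_mono) auto
      also have "\<dots> \<le> A / \<alpha> / b"
      proof -
        have "A / m (q i) \<le> A / \<alpha>" using mlow[of "q i"] aS A by (intro divide_left_mono mult_pos_pos mpos) (auto simp: q_def)
        then have "A / m (q i) / b \<le> A / \<alpha> / b" using b by (intro divide_right_mono) auto
        then show ?thesis by (simp add: mult_ac)
      qed
      also have "\<dots> < \<epsilon>"
      proof -
        have "A / \<alpha> < \<epsilon> * b" unfolding b_def distrib_left using \<epsilon> by simp
        then show ?thesis using b by (subst pos_divide_less_eq) auto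
      qed
      finally have "measure (\<nu> i) (UNIV - {- b<..b}) < \<epsilon>" .
      then show ?thesis using prob_compl[of "{- b<..b}"] by simp
    qed
    then show "\<exists>a b. a < b \<and> (\<forall>n. 1 - \<epsilon> < measure (\<nu> n) {a<..b})"
      using b by (intro exI[of _ "- b"] exI[of _ b]) auto
  qed
  \<comment> \<open>Normalisation has removed the masses, so their limit is needed too: a first
    subsequence makes them converge, a further one the measures.\<close>
  have "\<forall>i. m (q i) \<in> {0..A}" using mA mpos less_imp_le by auto
  then obtain l s where l: "l \<in> {0..A}" and s: "strict_mono s" and ml: "((\<lambda>i. m (q i)) \<circ> s) \<longlonglongrightarrow> l"
    using compact_Icc[of 0 A] unfolding compact_def by metis
  obtain h M where h: "strict_mono h" and M: "real_distribution M" and wc: "weak_conv_m (\<nu> \<circ> s \<circ> h) M"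
    using tight_imp_convergent_subsubsequence[OF tight s] by blast
  have "T u = of_real (l / sqrt (2 * pi)) * (LINT x|M. F u x)" if u: "u \<in> test_funs" for u
  proof -
    obtain B where B: "\<And>y. norm (F u y) \<le> B" using Fb[OF u] by blast
    interpret M: real_distribution M by (rule M)
    have "(\<lambda>i. LINT x|(\<nu> \<circ> s \<circ> h) i. F u x) \<longlonglongrightarrow> (LINT x|M. F u x)"
    proof (rule weak_conv_imp_integral_bdd_continuous_conv[OF _ M wc])
      show "isCont (F u) x" for x using Fc[OF u] by (simp add: continuous_on_eq_continuous_at)
    qed (use rd B in auto)
    moreover have "(\<lambda>i. m (q (s (h i)))) \<longlonglongrightarrow> l"
      using LIMSEQ_subseq_LIMSEQ[OF ml h] by (simp add: o_def)
    ultimately have "(\<lambda>i. m (q (s (h i))) *\<^sub>R (LINT x|\<nu> (s (h i)). F u x)) \<longlonglongrightarrow> l *\<^sub>R (LINT x|M. F u x)"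
      by (intro tendsto_scaleR) (simp_all add: o_def)
    then have "(\<lambda>i. LINT y|lborel. fourier u y * of_real (r (q (s (h i))) y)) \<longlonglongrightarrow> l *\<^sub>R (LINT x|M. F u x)"
      unfolding \<nu>int[OF u] .
    moreover have "(\<lambda>i. LINT y|lborel. fourier u y * of_real (r (q (s (h i))) y)) \<longlonglongrightarrow> of_real (sqrt (2 * pi)) * T u"
    proof -
      have "strict_mono (\<lambda>i. q (s (h i)))"
        using s h by (auto simp: strict_mono_def q_def)
      from LIMSEQ_subseq_LIMSEQ[OF lim[OF u] this] show ?thesis by (simp add: o_def)
    qed
    ultimately have "of_real (sqrt (2 * pi)) * T u = l *\<^sub>R (LINT x|M. F u x)" using LIMSEQ_unique by blast
    then show ?thesis by (simp add: scaleR_conv_of_real field_simps)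
  qed
  then show ?thesis
    using M l unfolding F_def by (intro exI[of _ M] exI[of _ "l / sqrt (2 * pi)"] exI[of _ "Suc k"] conjI) auto
qed

locale positive_functional = test_functional +
  assumes T_pos: "g \<in> test_funs \<Longrightarrow> T (corr g) \<in> \<real>\<^sub>\<ge>\<^sub>0"
begin

text \<open>\<open>T\<close> is regularised by the multipliers \<open>\<theta> n\<close>, which tend to \<open>1\<close>. As \<open>\<theta> n\<close> is an
  autocorrelation, the Fourier transform \<open>r n\<close> of \<open>\<theta> n T\<close> is a nonnegative function.\<close>

theorem bochner_schwartz:
  "\<exists>M c m. real_distribution M \<and> 0 \<le> c \<and>
    (\<forall>u\<in>test_funs. T u = of_real c * (LINT x|M. of_real ((1 + x\<^sup>2) ^ m) * fourier u x))"
proof -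
  obtain g where g: "g \<in> test_funs" "corr g 0 = 1" by (rule normalised_test_function)
  define G where "G = corr g"
  have Gt: "G \<in> test_funs" unfolding G_def by (rule corr_test_funs[OF g(1)])
  have Gs: "smooth G" using Gt by (rule test_funs_smooth)
  obtain R where R: "R > 0" "G \<in> test_funs_in {-R..R}" using test_funsE[OF Gt] by metis
  define \<epsilon> where "\<epsilon> n = 1 / real (Suc n)" for n
  have \<epsilon>: "0 < \<epsilon> n" "\<epsilon> n \<le> 1" for n by (auto simp: \<epsilon>_def)
  have \<epsilon>0: "\<epsilon> \<longlonglongrightarrow> 0" unfolding \<epsilon>_def by (rule LIMSEQ_Suc[OF lim_const_over_n])
  define \<theta> where "\<theta> n x = G (\<epsilon> n * x)" for n x
  have \<theta>d: "derivs (\<theta> n) (\<lambda>k x. of_real (\<epsilon> n) ^ k * nth_deriv k G (\<epsilon> n * x))" for n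
    using derivs_affine[OF smooth_derivs[OF Gs], of "\<epsilon> n" 0] by (simp add: \<theta>_def[abs_def])
  have \<theta>s: "smooth (\<theta> n)" for n using \<theta>d by (rule derivs_imp_smooth)
  define gn where "gn n \<xi> = of_real (sqrt (\<epsilon> n)) * g (\<epsilon> n * \<xi>)" for n \<xi>
  have gnt: "gn n \<in> test_funs" for n
    unfolding gn_def[abs_def] by (intro test_funs_cmult dilation_test_funs \<epsilon> g)
  have \<theta>_corr: "\<theta> n = corr (gn n)" for n
    unfolding gn_def[abs_def] \<theta>_def[abs_def] G_def using corr_dilation[OF \<epsilon>(1), of n g] by (simp add: fun_eq_iff)
  have \<theta>t: "\<theta> n \<in> test_funs" for n unfolding \<theta>_corr by (rule corr_test_funs[OF gnt])
  define \<rho> where "\<rho> n y = T (\<lambda>x. \<theta> n x * wave y x)" for n y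
  define r where "r n y = Re (\<rho> n y)" for n y
  have "\<rho> n y \<in> \<real>\<^sub>\<ge>\<^sub>0" for n y
  proof -
    have "T (corr (\<lambda>\<xi>. wave y \<xi> * gn n \<xi>)) \<in> \<real>\<^sub>\<ge>\<^sub>0" by (intro T_pos test_funs_mult' gnt wave_smooth)
    then show ?thesis unfolding \<rho>_def \<theta>_corr corr_wave[abs_def] by (simp only: mult.commute)
  qed
  then have r0: "0 \<le> r n y" and \<rho>r: "\<rho> n y = of_real (r n y)" for n y
    unfolding r_def by (auto simp: complex_nonneg_Reals_iff complex_eq_iff)
  have rc: "continuous_on UNIV (r n)" for n
    unfolding r_def[abs_def] \<rho>_def using T_wave_continuous[OF \<theta>t[of n]] by (intro continuous_intros)
  then have rm: "r n \<in> borel_measurable borel" for n by (rule borel_measurable_continuous_onI)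
  \<comment> \<open>\<open>T_osc\<close> with \<open>w = fourier u\<close>, whose \<open>osc\<close>
    is \<open>u\<close> up to the factor \<open>sqrt (2 * pi)\<close>; this is Parseval's formula
    for \<open>\<theta> n\<close> times \<open>T\<close>.\<close>
  have key: "integrable lborel (\<lambda>y. fourier u y * of_real (r n y))"
    "(LINT y|lborel. fourier u y * of_real (r n y)) = of_real (sqrt (2 * pi)) * T (\<lambda>x. \<theta> n x * u x)"
    if u: "u \<in> test_funs" for n u
  proof -
    note t = T_osc[OF \<theta>t[of n] fourier_rapid[OF u], folded \<rho>_def, unfolded \<rho>r]
    show "integrable lborel (\<lambda>y. fourier u y * of_real (r n y))" by (rule t(1))
    have "osc (fourier u) x = of_real (sqrt (2 * pi)) * u x" for x
    proof -
      have "of_real (sqrt (2 * pi)) * u x = of_real (sqrt (2 * pi) * (1 / sqrt (2 * pi))) * osc (fourier u) x"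
        using arg_cong[OF osc_fourier[OF u, of x], of "(*) (of_real (sqrt (2 * pi)))"]
        by (simp only: of_real_mult mult.assoc)
      then show ?thesis by simp
    qed
    then have "T (\<lambda>x. \<theta> n x * osc (fourier u) x) = T (\<lambda>x. of_real (sqrt (2 * pi)) * (\<theta> n x * u x))"
      by (simp add: mult.left_commute)
    also have "\<dots> = of_real (sqrt (2 * pi)) * T (\<lambda>x. \<theta> n x * u x)"
      by (intro T_cmult test_funs_mult \<theta>t test_funs_smooth u)
    finally show "(LINT y|lborel. fourier u y * of_real (r n y)) = of_real (sqrt (2 * pi)) * T (\<lambda>x. \<theta> n x * u x)"
      using t(2) by simp
  qed
  have lim: "(\<lambda>n. LINT y|lborel. fourier u y * of_real (r n y)) \<longlonglongrightarrow> of_real (sqrt (2 * pi)) * T u"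
    if u: "u \<in> test_funs" for u
  proof -
    obtain S where S: "S > 0" "u \<in> test_funs_in {-S..S}" using test_funsE[OF u] by metis
    obtain C N where C: "0 \<le> C" "\<And>v \<beta>. smooth v \<Longrightarrow>
      (\<And>k x. k \<le> N \<Longrightarrow> x \<in> {-S..S} \<Longrightarrow> norm (nth_deriv k v x) \<le> \<beta>) \<Longrightarrow> norm (T (\<lambda>x. u x * v x)) \<le> C * \<beta>"
      using T_mult_bound[OF S(2) less_imp_le[OF S(1)]] by blast
    \<comment> \<open>Order \<open>Suc N\<close> guarantees the first derivative, used for the
      Lipschitz bound, also when \<open>N = 0\<close>.\<close>
    obtain B where B: "0 \<le> B" "\<And>k x. k \<le> Suc N \<Longrightarrow> norm (nth_deriv k G x) \<le> B"
      using test_funs_bounded_nth_derivs[OF Gt, of "Suc N"] by blast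
    have Glip: "norm (G x - G 0) \<le> B * \<bar>x\<bar>" for x
    proof -
      have "norm (G x - G 0) \<le> B * norm (x - 0)"
      proof (rule differentiable_bound[OF convex_UNIV])
        show "(G has_derivative (\<lambda>h. h *\<^sub>R nth_deriv 1 G z)) (at z within UNIV)" for z
          using smooth_has_vector_derivative[OF Gs, of 0 z] by (simp add: has_vector_derivative_def)
        show "onorm (\<lambda>h. h *\<^sub>R nth_deriv 1 G z) \<le> B" for z
          using B(2)[of 1 z] onorm_scaleR_left[OF bounded_linear_ident, of "nth_deriv 1 G z"] by (simp add: onorm_id)
      qed auto
      then show ?thesis by simp
    qed
    \<comment> \<open>On \<open>{-S..S}\<close> every derivative of \<open>\<theta> n - 1\<close> up
      to order \<open>N\<close> is of size \<open>\<epsilon> n\<close>: the function itself because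
      \<open>G\<close> is Lipschitz with \<open>G 0 = 1\<close>, the higher ones because each
      differentiation brings out \<open>\<epsilon> n\<close>. The factor \<open>S + 1\<close> is a
      common bound for \<open>\<bar>x\<bar>\<close> and \<open>1\<close>.\<close>
    have "norm (T (\<lambda>x. \<theta> n x * u x) - T u) \<le> C * (\<epsilon> n * (B * (S + 1)))" for n
    proof -
      define V where "V x = \<theta> n x + (- 1) * 1" for x
      have Vd: "derivs V (\<lambda>k x. of_real (\<epsilon> n) ^ k * nth_deriv k G (\<epsilon> n * x) + (- 1) * (if k = 0 then 1 else 0))"
        unfolding V_def[abs_def] by (intro derivs_add derivs_cmult \<theta>d smooth_const)
      have "norm (T (\<lambda>x. u x * V x)) \<le> C * (\<epsilon> n * (B * (S + 1)))"
      proof (rule C(2))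
        show "smooth V" using Vd by (rule derivs_imp_smooth)
        fix k x assume kx: "k \<le> N" "x \<in> {-S..S}"
        have e: "nth_deriv k V x = of_real (\<epsilon> n) ^ k * nth_deriv k G (\<epsilon> n * x) + (- 1) * (if k = 0 then 1 else 0)"
          using derivs_nth_deriv_eq[OF Vd] by simp
        show "norm (nth_deriv k V x) \<le> \<epsilon> n * (B * (S + 1))"
        proof (cases "k = 0")
          case True
          have "norm (G (\<epsilon> n * x) - G 0) \<le> B * \<bar>\<epsilon> n * x\<bar>" by (rule Glip)
          also have "\<dots> = \<epsilon> n * (B * \<bar>x\<bar>)" using \<epsilon>(1)[of n] by (simp add: abs_mult)
          also have "\<dots> \<le> \<epsilon> n * (B * (S + 1))" using \<epsilon>(1)[of n] B(1) kx by (intro mult_left_mono) auto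
          finally show ?thesis using True e g(2) by (simp add: G_def)
        next
          case False
          have "norm (nth_deriv k V x) = \<epsilon> n ^ k * norm (nth_deriv k G (\<epsilon> n * x))"
            using e False \<epsilon>(1)[of n] by (simp add: norm_mult norm_power)
          also have "\<dots> \<le> \<epsilon> n * B"
          proof (rule mult_mono)
            show "\<epsilon> n ^ k \<le> \<epsilon> n" using \<epsilon>[of n] False power_decreasing[of 1 k "\<epsilon> n"] by simp
          qed (use B kx \<epsilon>(1)[of n] in auto)
          also have "\<dots> \<le> \<epsilon> n * (B * (S + 1))" using \<epsilon>(1)[of n] B(1) S(1) by (intro mult_left_mono) (auto simp: mult_le_cancel_left1)
          finally show ?thesis .
        qed
      qed
      also have "T (\<lambda>x. u x * V x) = T (\<lambda>x. u x * \<theta> n x) + (- 1) * T (\<lambda>x. u x * 1)"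
        unfolding V_def by (intro T_mult_add u \<theta>s derivs_imp_smooth[OF smooth_const])
      finally show ?thesis by (simp add: mult.commute)
    qed
    then have "\<forall>\<^sub>F n in sequentially. norm (T (\<lambda>x. \<theta> n x * u x) - T u) \<le> C * (\<epsilon> n * (B * (S + 1)))"
      by (intro always_eventually allI)
    moreover have "(\<lambda>n. C * (\<epsilon> n * (B * (S + 1)))) \<longlonglongrightarrow> C * (0 * (B * (S + 1)))"
      by (intro tendsto_mult tendsto_const \<epsilon>0)
    then have "(\<lambda>n. C * (\<epsilon> n * (B * (S + 1)))) \<longlonglongrightarrow> 0" by simp
    ultimately have "(\<lambda>n. T (\<lambda>x. \<theta> n x * u x) - T u) \<longlonglongrightarrow> 0" by (rule Lim_null_comparison)
    then have "(\<lambda>n. T (\<lambda>x. \<theta> n x * u x)) \<longlonglongrightarrow> T u" by (rule LIM_zero_cancel)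
    then show ?thesis unfolding key(2)[OF u] by (rule tendsto_mult_left)
  qed
  define P where "P y = sqrt (2 * pi) * (norm (fourier g y))\<^sup>2" for y
  have FG: "fourier G y = of_real (P y)" for y unfolding G_def P_def by (rule fourier_corr[OF g(1)])
  have P0: "0 \<le> P y" for y by (simp add: P_def)
  have Pc: "continuous_on UNIV P"
    unfolding P_def[abs_def] using fourier_rapid[OF g(1)] unfolding rapid_def by (intro continuous_intros) auto
  then have Pm [measurable]: "P \<in> borel_measurable borel" by (rule borel_measurable_continuous_onI)
  have Pi: "integrable lborel P"
    using rapid_integrable[OF fourier_rapid[OF Gt]] unfolding FG[abs_def] by (simp add: complex_of_real_integrable_eq)
  obtain C N where C: "0 \<le> C" "\<And>v \<beta>. smooth v \<Longrightarrow>
    (\<And>k x. k \<le> N \<Longrightarrow> x \<in> {-R..R} \<Longrightarrow> norm (nth_deriv k v x) \<le> \<beta>) \<Longrightarrow> norm (T (\<lambda>x. G x * v x)) \<le> C * \<beta>"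
    using T_mult_bound[OF R(2) less_imp_le[OF R(1)]] by blast
  obtain B where B: "0 \<le> B" "\<And>k x. k \<le> N \<Longrightarrow> norm (nth_deriv k G x) \<le> B"
    using test_funs_bounded_nth_derivs[OF Gt, of N] by blast
  define A0 where "A0 = sqrt (2 * pi) * (C * (2 ^ N * B))"
  have A0: "0 \<le> A0" unfolding A0_def using C B by simp
  \<comment> \<open>\<open>P\<close> translated by \<open>s\<close> is the transform of
    \<open>G\<close> modulated by \<open>s\<close>. Derivatives of \<open>wave s\<close> produce the
    power of \<open>1 + s\<^sup>2\<close>, and the constant is uniform in \<open>n\<close> since
    \<open>\<epsilon> n \<le> 1\<close> keeps the derivatives of \<open>\<theta> n\<close> below the
    bound \<open>B\<close> for those of \<open>G\<close>.\<close>
  have trans: "(\<integral>\<^sup>+ y. ennreal (P (y - s) * r n y) \<partial>lborel) \<le> ennreal (A0 * (1 + s\<^sup>2) ^ N)" for n s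
  proof -
    let ?u = "\<lambda>x. wave s x * G x"
    have u: "?u \<in> test_funs" by (intro test_funs_mult' Gt wave_smooth)
    have e: "fourier ?u y * of_real (r n y) = of_real (P (y - s) * r n y)" for y
      unfolding fourier_wave FG by simp
    have i: "integrable lborel (\<lambda>y. P (y - s) * r n y)"
      using key(1)[OF u, of n] unfolding e by (simp only: complex_of_real_integrable_eq)
    have "norm (T (\<lambda>x. G x * (\<theta> n x * wave s x))) \<le> C * (2 ^ N * (B * (1 + s\<^sup>2) ^ N))"
    proof (rule C(2))
      show "smooth (\<lambda>x. \<theta> n x * wave s x)" by (intro smooth_mult \<theta>s wave_smooth)
      fix k x assume k: "k \<le> N"
      have "norm (nth_deriv k (\<lambda>x. \<theta> n x * wave s x) x) \<le> 2 ^ k * (B * (1 + s\<^sup>2) ^ N)"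
      proof (rule nth_deriv_mult_bound[OF \<theta>s wave_smooth])
        fix j assume j: "j \<le> k"
        have "norm (nth_deriv j (\<theta> n) x) = \<epsilon> n ^ j * norm (nth_deriv j G (\<epsilon> n * x))"
          using \<epsilon>(1)[of n] by (simp add: derivs_nth_deriv_eq[OF \<theta>d] norm_mult norm_power)
        also have "\<dots> \<le> 1 * B" using \<epsilon>[of n] B j k by (intro mult_mono power_le_one) (auto simp: less_imp_le)
        finally show "norm (nth_deriv j (\<theta> n) x) \<le> B" by simp
        show "norm (nth_deriv j (wave s) x) \<le> (1 + s\<^sup>2) ^ N" using j k by (intro wave_deriv_bound) auto
      qed
      also have "\<dots> \<le> 2 ^ N * (B * (1 + s\<^sup>2) ^ N)" using k B by (intro mult_right_mono power_increasing) auto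
      finally show "norm (nth_deriv k (\<lambda>x. \<theta> n x * wave s x) x) \<le> 2 ^ N * (B * (1 + s\<^sup>2) ^ N)" .
    qed
    also have "(\<lambda>x. G x * (\<theta> n x * wave s x)) = (\<lambda>x. \<theta> n x * ?u x)" by (simp add: mult_ac)
    finally have b: "norm (T (\<lambda>x. \<theta> n x * ?u x)) \<le> C * (2 ^ N * (B * (1 + s\<^sup>2) ^ N))" .
    have "complex_of_real (LINT y|lborel. P (y - s) * r n y) = of_real (sqrt (2 * pi)) * T (\<lambda>x. \<theta> n x * ?u x)"
      using key(2)[OF u, of n] unfolding e integral_complex_of_real .
    then have "norm (complex_of_real (LINT y|lborel. P (y - s) * r n y)) = sqrt (2 * pi) * norm (T (\<lambda>x. \<theta> n x * ?u x))"
      by (simp add: norm_mult)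
    also have "\<dots> \<le> sqrt (2 * pi) * (C * (2 ^ N * (B * (1 + s\<^sup>2) ^ N)))" using b by (intro mult_left_mono) auto
    also have "\<dots> = A0 * (1 + s\<^sup>2) ^ N" by (simp add: A0_def mult_ac)
    finally have le: "(LINT y|lborel. P (y - s) * r n y) \<le> A0 * (1 + s\<^sup>2) ^ N" by simp
    have "(\<integral>\<^sup>+ y. ennreal (P (y - s) * r n y) \<partial>lborel) = ennreal (LINT y|lborel. P (y - s) * r n y)"
      by (rule nn_integral_eq_integral[OF i]) (use P0 r0 in auto)
    then show ?thesis using le by (simp add: ennreal_leI)
  qed
  \<comment> \<open>One power beyond \<open>N\<close>, so that
    \<open>q s * (1 + s\<^sup>2) ^ N\<close> is integrable in \<open>s\<close>.\<close>
  define k where "k = Suc N"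
  define q where "q s = 1 / (1 + s\<^sup>2) ^ k" for s :: real
  have q0: "0 < q s" for s unfolding q_def by (intro divide_pos_pos zero_less_power add_pos_nonneg) auto
  have qm [measurable]: "q \<in> borel_measurable borel" unfolding q_def[abs_def] by measurable
  \<comment> \<open>Peetre's inequality, raised to the power \<open>k\<close>; the difference of the
    two sides is written as a sum of squares.\<close>
  have qq: "q (y - \<sigma>) \<ge> q y * q \<sigma> / 2 ^ k" for y \<sigma>
  proof -
    have "2 * (1 + y\<^sup>2) * (1 + \<sigma>\<^sup>2) - (1 + (y - \<sigma>)\<^sup>2) = 1 + (y + \<sigma>)\<^sup>2 + 2 * (y * \<sigma>)\<^sup>2"
      by (simp add: power2_eq_square algebra_simps)
    then have "1 + (y - \<sigma>)\<^sup>2 \<le> 2 * (1 + y\<^sup>2) * (1 + \<sigma>\<^sup>2)"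
      using zero_le_power2[of "y + \<sigma>"] zero_le_power2[of "y * \<sigma>"] by linarith
    then have "(1 + (y - \<sigma>)\<^sup>2) ^ k \<le> (2 * (1 + y\<^sup>2) * (1 + \<sigma>\<^sup>2)) ^ k" by (intro power_mono) auto
    then have "1 / (2 * (1 + y\<^sup>2) * (1 + \<sigma>\<^sup>2)) ^ k \<le> q (y - \<sigma>)"
      unfolding q_def by (intro divide_left_mono mult_pos_pos zero_less_power add_pos_nonneg) auto
    moreover have "q y * q \<sigma> / 2 ^ k = 1 / (2 * (1 + y\<^sup>2) * (1 + \<sigma>\<^sup>2)) ^ k"
      unfolding q_def power_mult_distrib by simp
    ultimately show ?thesis by simp
  qed
  define K where "K = (LINT \<sigma>|lborel. q \<sigma> * P \<sigma>)"
  have qPi: "integrable lborel (\<lambda>\<sigma>. q \<sigma> * P \<sigma>)"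
  proof (rule Bochner_Integration.integrable_bound[OF Pi])
    show "(\<lambda>\<sigma>. q \<sigma> * P \<sigma>) \<in> borel_measurable lborel" by measurable
    show "AE \<sigma> in lborel. norm (q \<sigma> * P \<sigma>) \<le> norm (P \<sigma>)"
    proof (rule AE_I2)
      fix \<sigma> :: real
      have "1 \<le> (1 + \<sigma>\<^sup>2) ^ k" by (intro one_le_power) simp
      from frac_le[OF zero_le_one order_refl zero_less_one this] have "q \<sigma> \<le> 1" unfolding q_def by simp
      then have "q \<sigma> * P \<sigma> \<le> 1 * P \<sigma>" using P0 by (intro mult_right_mono)
      then show "norm (q \<sigma> * P \<sigma>) \<le> norm (P \<sigma>)" using P0[of \<sigma>] q0[of \<sigma>] by (simp add: abs_mult)
    qed
  qed
  \<comment> \<open>Were \<open>P\<close> zero almost everywhere, Fourier inversion at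
    \<open>0\<close> would give \<open>G 0 = 0\<close>, contrary to the normalisation
    \<open>corr g 0 = 1\<close>.\<close>
  have K: "0 < K"
  proof -
    have "0 \<le> K" unfolding K_def using P0 q0 by (intro Bochner_Integration.integral_nonneg mult_nonneg_nonneg) (auto simp: less_imp_le)
    moreover have "K \<noteq> 0"
    proof
      assume "K = 0"
      then have "AE \<sigma> in lborel. q \<sigma> * P \<sigma> = 0"
        unfolding K_def using integral_nonneg_eq_0_iff_AE[OF qPi] P0 q0 by (simp add: less_imp_le)
      then have "AE \<sigma> in lborel. P \<sigma> = 0"
        by (rule eventually_mono) (use q0 in \<open>simp add: less_le\<close>)
      then have "(LINT \<sigma>|lborel. P \<sigma>) = 0" by (rule integral_eq_zero_AE)
      then have "complex_of_real (1 / sqrt (2 * pi)) * osc (fourier G) 0 = 0"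
        by (simp add: osc_def FG)
      then show False unfolding osc_fourier[OF Gt] using g(2) by (simp add: G_def)
    qed
    ultimately show ?thesis by simp
  qed
  define I1 where "I1 = (LINT s::real|lborel. 1 / (1 + s\<^sup>2))"
  define A where "A = 2 ^ k / K * (A0 * I1)"
  \<comment> \<open>Averages \<open>trans\<close> over \<open>s\<close> with weight
    \<open>q\<close>. By \<open>qq\<close> the averaged translates of \<open>P\<close> are at least
    \<open>K / 2 ^ k * q y\<close>, so the average controls the integral of \<open>r n * q\<close>.
    Extended nonnegative integrals are used because integrability of \<open>r n * q\<close> is only
    a result of this estimate.\<close>
  have bound: "(\<integral>\<^sup>+ y. ennreal (r n y * q y) \<partial>lborel) \<le> ennreal A" for n
  proof -
    have rmn [measurable]: "r n \<in> borel_measurable borel" by (rule rm)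
    have "ennreal (K / 2 ^ k) * (\<integral>\<^sup>+ y. ennreal (r n y * q y) \<partial>lborel) =
       (\<integral>\<^sup>+ y. ennreal (K / 2 ^ k) * ennreal (r n y * q y) \<partial>lborel)"
      by (rule nn_integral_cmult[symmetric]) measurable
    also have "\<dots> \<le> (\<integral>\<^sup>+ y. (\<integral>\<^sup>+ s. ennreal (q s * (P (y - s) * r n y)) \<partial>lborel) \<partial>lborel)"
    proof (rule nn_integral_mono)
      fix y :: real
      have "ennreal (K / 2 ^ k) * ennreal (r n y * q y) = ennreal (r n y * q y / 2 ^ k) * ennreal K"
        using r0[of n y] q0[of y] K by (simp add: ennreal_mult[symmetric] less_imp_le mult_ac)
      also have "ennreal K = (\<integral>\<^sup>+ \<sigma>. ennreal (q \<sigma> * P \<sigma>) \<partial>lborel)"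
        unfolding K_def by (rule nn_integral_eq_integral[symmetric, OF qPi]) (use P0 q0 in \<open>auto simp: less_imp_le\<close>)
      also have "ennreal (r n y * q y / 2 ^ k) * \<dots> = (\<integral>\<^sup>+ \<sigma>. ennreal (r n y * q y / 2 ^ k) * ennreal (q \<sigma> * P \<sigma>) \<partial>lborel)"
        by (rule nn_integral_cmult[symmetric]) measurable
      also have "\<dots> \<le> (\<integral>\<^sup>+ \<sigma>. ennreal (q (y + (- 1) * \<sigma>) * (P (y - (y + (- 1) * \<sigma>)) * r n y)) \<partial>lborel)"
      proof (rule nn_integral_mono)
        fix \<sigma> :: real
        have "ennreal (r n y * q y / 2 ^ k) * ennreal (q \<sigma> * P \<sigma>) = ennreal (r n y * q y / 2 ^ k * (q \<sigma> * P \<sigma>))"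
          using r0[of n y] q0[of y] q0[of \<sigma>] P0[of \<sigma>] by (intro ennreal_mult[symmetric]) (auto simp: less_imp_le)
        also have "\<dots> \<le> ennreal (q (y - \<sigma>) * (P \<sigma> * r n y))"
        proof (rule ennreal_leI)
          have "q y * q \<sigma> / 2 ^ k * (P \<sigma> * r n y) \<le> q (y - \<sigma>) * (P \<sigma> * r n y)"
            using qq P0 r0 by (intro mult_right_mono) auto
          then show "r n y * q y / 2 ^ k * (q \<sigma> * P \<sigma>) \<le> q (y - \<sigma>) * (P \<sigma> * r n y)" by (simp add: mult_ac)
        qed
        finally show "ennreal (r n y * q y / 2 ^ k) * ennreal (q \<sigma> * P \<sigma>) \<le>
          ennreal (q (y + (- 1) * \<sigma>) * (P (y - (y + (- 1) * \<sigma>)) * r n y))" by simp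
      qed
      also have "\<dots> = (\<integral>\<^sup>+ s. ennreal (q s * (P (y - s) * r n y)) \<partial>lborel)"
      proof -
        have "(\<lambda>s. ennreal (q s * (P (y - s) * r n y))) \<in> borel_measurable borel" by measurable
        from nn_integral_real_affine[OF this, of "- 1" y] show ?thesis by simp
      qed
      finally show "ennreal (K / 2 ^ k) * ennreal (r n y * q y) \<le> (\<integral>\<^sup>+ s. ennreal (q s * (P (y - s) * r n y)) \<partial>lborel)" .
    qed
    also have "\<dots> = (\<integral>\<^sup>+ s. (\<integral>\<^sup>+ y. ennreal (q s * (P (y - s) * r n y)) \<partial>lborel) \<partial>lborel)"
      by (rule lborel_pair.Fubini') measurable
    also have "\<dots> \<le> (\<integral>\<^sup>+ s. ennreal (A0 * (1 / (1 + s\<^sup>2))) \<partial>lborel)"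
    proof (rule nn_integral_mono)
      fix s :: real
      have "(\<integral>\<^sup>+ y. ennreal (q s * (P (y - s) * r n y)) \<partial>lborel) = (\<integral>\<^sup>+ y. ennreal (q s) * ennreal (P (y - s) * r n y) \<partial>lborel)"
        using q0 P0 r0 by (intro nn_integral_cong ennreal_mult) (auto simp: less_imp_le)
      also have "\<dots> = ennreal (q s) * (\<integral>\<^sup>+ y. ennreal (P (y - s) * r n y) \<partial>lborel)"
        by (rule nn_integral_cmult) measurable
      also have "\<dots> \<le> ennreal (q s) * ennreal (A0 * (1 + s\<^sup>2) ^ N)" by (intro mult_left_mono trans) auto
      also have "\<dots> = ennreal (q s * (A0 * (1 + s\<^sup>2) ^ N))"
        using q0 A0 by (intro ennreal_mult[symmetric]) (auto simp: less_imp_le)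
      also have "q s * (A0 * (1 + s\<^sup>2) ^ N) = A0 * (1 / (1 + s\<^sup>2))"
      proof -
        have "1 + s\<^sup>2 \<noteq> 0" by (metis add_pos_nonneg less_irrefl zero_le_power2 zero_less_one)
        then show ?thesis unfolding q_def k_def by simp
      qed
      finally show "(\<integral>\<^sup>+ y. ennreal (q s * (P (y - s) * r n y)) \<partial>lborel) \<le> ennreal (A0 * (1 / (1 + s\<^sup>2)))" .
    qed
    also have "\<dots> = ennreal (LINT s::real|lborel. A0 * (1 / (1 + s\<^sup>2)))"
      by (rule nn_integral_eq_integral[OF integrable_mult_right[OF integrable_inverse_1_plus_square_UNIV]])
         (use A0 in \<open>auto intro!: AE_I2 divide_nonneg_nonneg\<close>)
    also have "(LINT s::real|lborel. A0 * (1 / (1 + s\<^sup>2))) = A0 * I1" unfolding I1_def by (rule integral_mult_right_zero)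
    finally have le: "ennreal (K / 2 ^ k) * (\<integral>\<^sup>+ y. ennreal (r n y * q y) \<partial>lborel) \<le> ennreal (A0 * I1)" .
    have "(\<integral>\<^sup>+ y. ennreal (r n y * q y) \<partial>lborel) = ennreal (2 ^ k / K) * (ennreal (K / 2 ^ k) * (\<integral>\<^sup>+ y. ennreal (r n y * q y) \<partial>lborel))"
      using K by (simp add: mult.assoc[symmetric] ennreal_mult[symmetric])
    also have "\<dots> \<le> ennreal (2 ^ k / K) * ennreal (A0 * I1)" using le by (intro mult_left_mono) auto
    also have "\<dots> = ennreal A"
    proof -
      have "0 \<le> I1" unfolding I1_def by (intro Bochner_Integration.integral_nonneg) (auto intro!: divide_nonneg_nonneg)
      then show ?thesis unfolding A_def using K A0 by (intro ennreal_mult[symmetric]) auto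
    qed
    finally show ?thesis .
  qed
  have A: "0 \<le> A"
  proof -
    have "0 \<le> I1" unfolding I1_def by (intro Bochner_Integration.integral_nonneg) (auto intro!: divide_nonneg_nonneg)
    then show ?thesis unfolding A_def using K A0 by simp
  qed
  have rq: "r n y * q y = r n y / (1 + y\<^sup>2) ^ k" for n y by (simp add: q_def)
  have bi: "integrable lborel (\<lambda>y. r n y / (1 + y\<^sup>2) ^ k)" for n
    unfolding rq[symmetric]
  proof (rule integrableI_nonneg)
    show "(\<lambda>y. r n y * q y) \<in> borel_measurable lborel" using rm qm by measurable
    show "AE y in lborel. 0 \<le> r n y * q y" using r0 q0 by (intro AE_I2) (simp add: less_imp_le)
    show "(\<integral>\<^sup>+ y. ennreal (r n y * q y) \<partial>lborel) < \<infinity>" using bound[of n] by (simp add: less_top order_le_less_trans)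
  qed
  have bd: "(LINT y|lborel. r n y / (1 + y\<^sup>2) ^ k) \<le> A" for n
  proof -
    have "ennreal (LINT y|lborel. r n y / (1 + y\<^sup>2) ^ k) \<le> ennreal A"
      using bound[of n] nn_integral_eq_integral[OF bi[of n]] r0 unfolding rq by simp
    then show ?thesis using A by simp
  qed
  show ?thesis
    by (rule weak_limit_representation[OF rm r0 lim bi bd])
qed

end

section \<open>Sign-definite Hankel forms\<close>

text \<open>On \<open>{-R..R}\<close> the derivatives of \<open>m\<close> up to any given order are
  bounded, whatever its growth at infinity. This is what permits division by Gamma.\<close>

lemma dist_bounded_mult:
  assumes b: "dist_bounded b" and m: "smooth m"
  shows "dist_bounded (\<lambda>u. b (\<lambda>x. m x * u x))"
  unfolding dist_bounded_def
proof
  fix R :: real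
  obtain C N where C: "0 \<le> C" "\<forall>u\<in>test_funs_in {-R..R}. \<forall>\<beta>.
     (\<forall>k\<le>N. \<forall>x. norm (nth_deriv k u x) \<le> \<beta>) \<longrightarrow> norm (b u) \<le> C * \<beta>"
    using b unfolding dist_bounded_def by blast
  obtain B where B: "0 \<le> B" "\<And>k x. k \<le> N \<Longrightarrow> x \<in> {-R..R} \<Longrightarrow> norm (nth_deriv k m x) \<le> B"
    using bounded_nth_derivs[of m "{-R..R}" N] m by (metis bounded_closed_interval)
  have "norm (b (\<lambda>x. m x * u x)) \<le> (C * (2 ^ N * B)) * \<beta>"
    if u: "u \<in> test_funs_in {-R..R}" and \<beta>: "\<forall>k\<le>N. \<forall>x. norm (nth_deriv k u x) \<le> \<beta>" for u \<beta>
  proof -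
    have us: "smooth u" "\<forall>x. R < \<bar>x\<bar> \<longrightarrow> u x = 0" using u by (auto simp: test_funs_in_interval)
    have \<beta>0: "0 \<le> \<beta>" using \<beta> norm_ge_zero order_trans by blast
    have "norm (nth_deriv k (\<lambda>x. m x * u x) x) \<le> 2 ^ N * (B * \<beta>)" if k: "k \<le> N" for k x
    proof (cases "x \<in> {-R..R}")
      case True
      have "norm (nth_deriv k (\<lambda>x. m x * u x) x) \<le> 2 ^ k * (B * \<beta>)"
        using k B \<beta> True by (intro nth_deriv_mult_bound us m) auto
      also have "\<dots> \<le> 2 ^ N * (B * \<beta>)" using k B \<beta>0 by (intro mult_right_mono power_increasing) auto
      finally show ?thesis .
    next
      case False
      then have "nth_deriv k (\<lambda>x. m x * u x) x = 0"
        using us by (intro nth_deriv_eq_0_outside[of R]) (auto simp: abs_if split: if_splits)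
      then show ?thesis using B \<beta>0 by simp
    qed
    moreover have "(\<lambda>x. m x * u x) \<in> test_funs_in {-R..R}"
      using test_funs_in_mult[OF u m] by (simp add: mult.commute)
    ultimately have "norm (b (\<lambda>x. m x * u x)) \<le> C * (2 ^ N * (B * \<beta>))" using C(2) by blast
    then show ?thesis by (simp add: mult.assoc)
  qed
  then show "\<exists>C\<ge>0. \<exists>N. \<forall>u\<in>test_funs_in {-R..R}. \<forall>\<beta>.
     (\<forall>k\<le>N. \<forall>x. norm (nth_deriv k u x) \<le> \<beta>) \<longrightarrow> norm (b (\<lambda>x. m x * u x)) \<le> C * \<beta>"
    using C(1) B(1) by (intro exI[of _ "C * (2 ^ N * B)"] conjI exI[of _ N]) auto
qed

lemma fourier_add:
  "u \<in> test_funs \<Longrightarrow> v \<in> test_funs \<Longrightarrow> fourier (\<lambda>x. u x + v x) \<xi> = fourier u \<xi> + fourier v \<xi>"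
  unfolding fourier_osc by (subst osc_add) (auto intro!: rapid_integrable test_funs_rapid simp: distrib_left)

lemma fourier_cmult: "fourier (\<lambda>x. c * u x) \<xi> = c * fourier u \<xi>"
  unfolding fourier_osc osc_cmult by (rule mult.left_commute)

lemma mellin_Z_add:
  "u \<in> test_funs \<Longrightarrow> v \<in> test_funs \<Longrightarrow> mellin_Z (\<lambda>x. u x + v x) = (\<lambda>t. mellin_Z u t + mellin_Z v t)"
  by (auto simp: mellin_Z_def fourier_add)

lemma mellin_Z_cmult: "mellin_Z (\<lambda>x. c * u x) = (\<lambda>t. c * mellin_Z u t)"
  by (auto simp: mellin_Z_def fourier_cmult)

text \<open>The neighbourhood of \<open>0\<close> on which \<open>norm (h F) < 1\<close> is traced
  back through both transferred topologies, the pullback to \<open>Zplus\<close> and the image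
  topology on \<open>Z\<close>, to an open set of test functions.\<close>

lemma Zplus_dual_dist_bounded:
  assumes "h \<in> Zplus_dual" shows "dist_bounded (\<lambda>u. h (mellin_Z u))"
proof -
  have hc: "h (\<lambda>t. c * F t) = cnj c * h F" if "F \<in> Zplus" for c F
    using assms that by (auto simp: Zplus_dual_def)
  have cont: "continuous_map Zplus_topology euclidean h" using assms by (simp add: Zplus_dual_def)
  have zt: "(\<lambda>x. 0) \<in> test_funs" by (auto simp: test_funs_iff intro: derivs_imp_smooth[OF smooth_const])
  have top: "topspace Z_topology = Z"
  proof
    show "topspace Z_topology \<subseteq> Z" using openin_topspace[of Z_topology] unfolding openin_Z_topology by blast
    have "{u \<in> test_funs. fourier u \<in> Z} = topspace test_topology"
      using fourier_in_Z topspace_test_topology by auto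
    then have "openin Z_topology Z" unfolding openin_Z_topology by (metis openin_topspace order_refl)
    then show "Z \<subseteq> topspace Z_topology" by (rule openin_subset)
  qed
  have "openin Zplus_topology {F \<in> topspace Zplus_topology. h F \<in> ball 0 1}"
    using cont by (rule openin_continuous_map_preimage) simp
  then obtain V where V: "openin Z_topology V"
    "{F \<in> topspace Zplus_topology. h F \<in> ball 0 1} = (\<lambda>F x. F (exp x)) -` V \<inter> Zplus"
    unfolding Zplus_topology_def openin_pullback_topology by blast
  show ?thesis
  proof (rule continuous_imp_dist_bounded[where U = "{u \<in> test_funs. fourier u \<in> V}"])
    show "norm (h (mellin_Z (\<lambda>x. c * u x))) = norm c * norm (h (mellin_Z u))" if "u \<in> test_funs" for c u
      unfolding mellin_Z_cmult hc[OF mellin_Z_in_Zplus[OF that]] by (simp add: norm_mult)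
    show "openin test_topology {u \<in> test_funs. fourier u \<in> V}" using V(1) unfolding openin_Z_topology by blast
    show "norm (h (mellin_Z u)) < 1" if "u \<in> {u \<in> test_funs. fourier u \<in> V}" for u
    proof -
      have "mellin_Z u \<in> (\<lambda>F x. F (exp x)) -` V \<inter> Zplus"
        using that mellin_Z_in_Zplus by (simp add: mellin_Z_exp)
      then have "h (mellin_Z u) \<in> ball 0 1" unfolding V(2)[symmetric] by blast
      then show ?thesis by simp
    qed
    show "(\<lambda>x. 0) \<in> {u \<in> test_funs. fourier u \<in> V}"
    proof -
      have "h (mellin_Z (\<lambda>x. 0)) = 0"
      proof -
        have "mellin_Z (\<lambda>x. 0) = (\<lambda>t. 0)" by (simp add: mellin_Z_def fourier_def fun_eq_iff)
        then show ?thesis using hc[OF mellin_Z_in_Zplus[OF zt], of 0] by simp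
      qed
      moreover have "mellin_Z (\<lambda>x. 0) \<in> topspace Zplus_topology"
        unfolding Zplus_topology_def topspace_pullback_topology top
        using mellin_Z_in_Zplus[OF zt] fourier_in_Z[OF zt] by (simp add: mellin_Z_exp)
      ultimately have "mellin_Z (\<lambda>x. 0) \<in> (\<lambda>F x. F (exp x)) -` V \<inter> Zplus" unfolding V(2)[symmetric] by simp
      then show ?thesis using zt by (simp add: mellin_Z_exp)
    qed
  qed
qed

text \<open>This is \<open>s * exp (- s)\<close> at \<open>s = exp y\<close>, the Laplace kernel in
  logarithmic variables; up to reflection it is the density of the Gumbel distribution.\<close>

definition gumbel :: "real \<Rightarrow> real" where
  "gumbel y = exp (y - exp y)"

lemma gumbel_pos: "0 < gumbel y"
  by (simp add: gumbel_def)

lemma power_le_exp: "0 \<le> (x :: real) \<Longrightarrow> x ^ j \<le> real j ^ j * exp x"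
proof (cases "j = 0")
  case False
  assume x: "0 \<le> x"
  have "x ^ j = real j ^ j * (x / real j) ^ j" using False by (simp add: power_divide)
  also have "(x / real j) ^ j \<le> (1 + x / real j) ^ j" using x by (intro power_mono) auto
  also have "(1 + x / real j) ^ j \<le> exp x" using exp_ge_one_plus_x_over_n_power_n[of j x] x False by simp
  finally show ?thesis by (simp add: mult_left_mono)
qed simp

text \<open>To the right the double exponential decides, through
  \<open>exp s \<ge> s\<^sup>2 / 2\<close> at \<open>s = exp y\<close>; to the left the factor
  \<open>exp y\<close> suffices.\<close>

lemma gumbel_le: "gumbel y \<le> 2 * exp (- \<bar>y\<bar>)"
proof (cases "0 \<le> y")
  case True
  have "(exp y)\<^sup>2 / 2 \<le> exp (exp y)" using exp_lower_Taylor_quadratic[of "exp y"] exp_gt_zero[of y] by linarith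
  then have "exp y * exp y \<le> 2 * exp (exp y)" by (simp add: power2_eq_square)
  then have "exp y / exp (exp y) \<le> 2 / exp y" by (simp add: field_simps)
  then show ?thesis using True by (simp add: gumbel_def exp_diff exp_minus divide_inverse)
next
  case False
  have "gumbel y \<le> exp y" by (simp add: gumbel_def)
  also have "\<dots> \<le> 2 * exp y" by simp
  finally show ?thesis using False by simp
qed

lemma gumbel_rapid: "rapid (\<lambda>y. of_real (gumbel y))"
  unfolding rapid_def
proof (intro conjI allI)
  show "continuous_on UNIV (\<lambda>y. complex_of_real (gumbel y))"
    unfolding gumbel_def by (intro continuous_intros)
  fix j
  have "\<bar>y\<bar> ^ j * norm (complex_of_real (gumbel y)) \<le> 2 * real j ^ j" for y
  proof -
    have "\<bar>y\<bar> ^ j * gumbel y \<le> (real j ^ j * exp \<bar>y\<bar>) * (2 * exp (- \<bar>y\<bar>))"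
      using gumbel_pos[of y] by (intro mult_mono power_le_exp gumbel_le) auto
    also have "\<dots> = 2 * real j ^ j" by (simp add: exp_minus)
    finally show ?thesis using gumbel_pos[of y] by simp
  qed
  then show "\<exists>C. \<forall>y. \<bar>y\<bar> ^ j * norm (complex_of_real (gumbel y)) \<le> C" by blast
qed

lemma gumbel_measurable [measurable]: "gumbel \<in> borel_measurable borel"
  unfolding gumbel_def[abs_def] by measurable

text \<open>Multiplication by \<open>Gamma (1 - \<i> \<zeta>)\<close> is the Laplace transform in logarithmic variables.\<close>

lemma fourier_Gamma_mult:
  assumes u: "u \<in> test_funs"
  shows "fourier (\<lambda>\<zeta>. Gamma (1 - \<i> * of_real \<zeta>) * u \<zeta>) x = (LINT y|lborel. of_real (gumbel (y - x)) * fourier u y)"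
proof -
  let ?c = "complex_of_real (1 / sqrt (2 * pi))"
  \<comment> \<open>Gamma on this line is the Fourier transform of \<open>gumbel\<close>; once the
    integrals are exchanged, the product with \<open>u\<close> becomes a correlation of
    transforms.\<close>
  have G: "Gamma (1 - \<i> * of_real \<zeta>) = (LINT y|lborel. of_real (gumbel y) * exp (- \<i> * of_real (\<zeta> * y)))" for \<zeta>
  proof -
    have "Gamma (1 - \<i> * of_real \<zeta>) = (LINT y|lborel. exp ((1 - \<i> * of_real \<zeta>) * of_real y - of_real (exp y)))"
      by (rule Gamma_integral_exp(2)[symmetric]) simp
    also have "\<dots> = (LINT y|lborel. of_real (gumbel y) * exp (- \<i> * of_real (\<zeta> * y)))"
    proof (intro Bochner_Integration.integral_cong refl)
      fix y
      have "complex_of_real (gumbel y) = exp (of_real y - of_real (exp y))"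
        unfolding gumbel_def using exp_of_real[of "y - exp y", where 'a = complex] by (simp only: of_real_diff)
      then show "exp ((1 - \<i> * of_real \<zeta>) * of_real y - of_real (exp y)) = of_real (gumbel y) * exp (- \<i> * of_real (\<zeta> * y))"
        by (simp only: mult_exp_exp) (rule arg_cong[of _ _ exp], simp add: algebra_simps)
    qed
    finally show ?thesis .
  qed
  have gi: "integrable lborel (\<lambda>y. complex_of_real (gumbel y))" using gumbel_rapid by (rule rapid_integrable)
  have ui: "integrable lborel u" using u by (intro rapid_integrable test_funs_rapid)
  let ?k = "\<lambda>\<zeta> y. ?c * exp (- \<i> * of_real (\<zeta> * (x + y)))"
  have "fourier (\<lambda>\<zeta>. Gamma (1 - \<i> * of_real \<zeta>) * u \<zeta>) x =
     (LINT \<zeta>|lborel. LINT y|lborel. u \<zeta> * of_real (gumbel y) * ?k \<zeta> y)"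
    unfolding fourier_def integral_mult_right_zero[symmetric]
  proof (intro Bochner_Integration.integral_cong refl)
    fix \<zeta>
    have "?c * (exp (- \<i> * of_real (\<zeta> * x)) * (Gamma (1 - \<i> * of_real \<zeta>) * u \<zeta>)) =
       (LINT y|lborel. (?c * exp (- \<i> * of_real (\<zeta> * x)) * u \<zeta>) * (of_real (gumbel y) * exp (- \<i> * of_real (\<zeta> * y))))"
      unfolding G integral_mult_right_zero by (simp only: mult_ac)
    also have "\<dots> = (LINT y|lborel. u \<zeta> * of_real (gumbel y) * ?k \<zeta> y)"
    proof (intro Bochner_Integration.integral_cong refl)
      fix y
      have "exp (- \<i> * of_real (\<zeta> * (x + y))) = exp (- \<i> * of_real (\<zeta> * x)) * exp (- \<i> * of_real (\<zeta> * y))"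
        unfolding mult_exp_exp by (rule arg_cong[of _ _ exp]) (simp add: algebra_simps)
      then show "(?c * exp (- \<i> * of_real (\<zeta> * x)) * u \<zeta>) * (of_real (gumbel y) * exp (- \<i> * of_real (\<zeta> * y))) =
         u \<zeta> * of_real (gumbel y) * ?k \<zeta> y" by (simp only: mult_ac)
    qed
    finally show "?c * (exp (- \<i> * of_real (\<zeta> * x)) * (Gamma (1 - \<i> * of_real \<zeta>) * u \<zeta>)) =
       (LINT y|lborel. u \<zeta> * of_real (gumbel y) * ?k \<zeta> y)" .
  qed
  also have "\<dots> = (LINT y|lborel. LINT \<zeta>|lborel. u \<zeta> * of_real (gumbel y) * ?k \<zeta> y)"
  proof (rule Fubini_mult_bounded[OF ui gi, symmetric])
    show "(\<lambda>(\<zeta>, y). ?k \<zeta> y) \<in> borel_measurable (lborel \<Otimes>\<^sub>M lborel)" by measurable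
    show "norm (?k \<zeta> y) \<le> norm ?c" for \<zeta> y
      using norm_exp_i_times_real[of "- (\<zeta> * (x + y))"] unfolding norm_mult by simp
  qed
  also have "\<dots> = (LINT y|lborel. of_real (gumbel y) * fourier u (y + x))"
    unfolding fourier_def integral_mult_right_zero[symmetric] by (simp only: mult_ac add.commute)
  also have "\<dots> = (LINT y|lborel. of_real (gumbel (y - x)) * fourier u y)"
    using integral_shift[of "\<lambda>y. of_real (gumbel (y - x)) * fourier u y" x] by simp
  finally show ?thesis .
qed

lemma borel_measurable_cnj [measurable]: "cnj \<in> borel_measurable borel"
  by (intro borel_measurable_continuous_onI continuous_intros)

definition weight :: "nat \<Rightarrow> real \<Rightarrow> real" where
  "weight m x = (1 + x\<^sup>2) ^ m"

lemma weight_ge_1: "1 \<le> weight m x"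
  unfolding weight_def by (intro one_le_power) simp

lemma weight_nonneg: "0 \<le> weight m x"
  using weight_ge_1[of m x] by linarith

lemma weight_measurable [measurable]: "weight m \<in> borel_measurable borel"
  unfolding weight_def[abs_def] by measurable

text \<open>Peetre's inequality. It shifts the polynomial weight of the measure from
  \<open>x\<close> to \<open>y - x\<close>, where \<open>gumbel\<close> decays, and to
  \<open>y\<close>, where the test function decays.\<close>

lemma weight_le: "weight m x \<le> 2 ^ m * weight m (y - x) * weight m y"
proof -
  have "2 * (1 + (y - x)\<^sup>2) * (1 + y\<^sup>2) - (1 + x\<^sup>2) = 1 + (x - 2 * y)\<^sup>2 + 2 * ((y - x) * y)\<^sup>2"
    by (simp add: power2_eq_square algebra_simps)
  then have "1 + x\<^sup>2 \<le> 2 * (1 + (y - x)\<^sup>2) * (1 + y\<^sup>2)"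
    using zero_le_power2[of "x - 2 * y"] zero_le_power2[of "(y - x) * y"] by linarith
  then have "(1 + x\<^sup>2) ^ m \<le> (2 * (1 + (y - x)\<^sup>2) * (1 + y\<^sup>2)) ^ m" by (intro power_mono) auto
  then show ?thesis unfolding weight_def power_mult_distrib .
qed

lemma Gamma_line_cancel:
  assumes "0 < a" shows "Gamma (of_real a - \<i> * of_real x) * (rGamma (of_real a - \<i> * of_real x) * z) = z"
proof -
  have "of_real a - \<i> * complex_of_real x \<notin> \<int>\<^sub>\<le>\<^sub>0"
    using assms by (auto elim!: nonpos_Ints_cases simp: complex_eq_iff)
  then show ?thesis by (simp add: rGamma_inverse_Gamma Gamma_eq_zero_iff)
qed

text \<open>The Bochner-Schwartz theorem represents \<open>h\<close> with Gamma divided out;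
  multiplying back by Gamma smooths the transform of \<open>u\<close> by \<open>gumbel\<close>,
  which is the inner integral here.\<close>

lemma representing_distribution:
  assumes h: "h \<in> Zplus_dual" and pos: "\<forall>f\<in>D. h ((\<lambda>s. cnj (f s)) \<star> f) \<in> \<real>\<^sub>\<ge>\<^sub>0"
  shows "\<exists>M c m. real_distribution M \<and> 0 \<le> c \<and> (\<forall>u\<in>test_funs. h (mellin_Z u) =
    of_real c * (LINT x|M. LINT y|lborel. of_real (weight m x * gumbel (y - x)) * cnj (fourier u y)))"
proof -
  let ?c = "complex_of_real (1 / sqrt (2 * pi))"
  define b where "b u = h (mellin_Z u)" for u
  have b_add: "b (\<lambda>x. u x + v x) = b u + b v" if "u \<in> test_funs" "v \<in> test_funs" for u v
    using h mellin_Z_in_Zplus that unfolding b_def mellin_Z_add[OF that] Zplus_dual_def by blast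
  have b_cmult: "b (\<lambda>x. c * u x) = cnj c * b u" if "u \<in> test_funs" for u c
    using h mellin_Z_in_Zplus[OF that] unfolding b_def mellin_Z_cmult Zplus_dual_def by blast
  have bb: "dist_bounded b" unfolding b_def using h by (rule Zplus_dual_dist_bounded)
  define r where "r \<zeta> = ?c * rGamma (1 - \<i> * of_real \<zeta>)" for \<zeta>
  have rs: "smooth r" unfolding r_def[abs_def] using smooth_cmult[OF Gamma_line_smooth(2)[of 1], of ?c] by simp
  \<comment> \<open>The bracket is antilinear in the test function; its conjugate is linear and
    keeps nonnegative values.\<close>
  define T where "T u = cnj (b (\<lambda>\<zeta>. r \<zeta> * u \<zeta>))" for u
  have rt: "(\<lambda>\<zeta>. r \<zeta> * u \<zeta>) \<in> test_funs" if "u \<in> test_funs" for u using that rs by (rule test_funs_mult')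
  interpret positive_functional T
  proof unfold_locales
    fix u v :: "real \<Rightarrow> complex"
    assume u: "u \<in> test_funs" and v: "v \<in> test_funs"
    show "T (\<lambda>x. u x + v x) = T u + T v"
      unfolding T_def distrib_left b_add[OF rt[OF u] rt[OF v]] by simp
  next
    fix u and c :: complex assume u: "u \<in> test_funs"
    show "T (\<lambda>x. c * u x) = c * T u"
      unfolding T_def mult.left_commute[of "r _" c] b_cmult[OF rt[OF u]] by simp
  next
    show "dist_bounded T"
      using dist_bounded_mult[OF bb rs] unfolding dist_bounded_def T_def by simp
  next
    fix g assume g: "g \<in> test_funs"
    \<comment> \<open>Chosen so that the function called \<open>g\<close> in
      \<open>laplace_conv_mellin\<close> becomes the given one; thus positivity on \<open>D\<close>
      reaches every autocorrelation.\<close>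
    define v where "v \<eta> = rGamma (1 / 2 - \<i> * of_real \<eta>) * g \<eta>" for \<eta>
    have v: "v \<in> test_funs"
      unfolding v_def[abs_def] using test_funs_mult'[OF g Gamma_line_smooth(2)[of "1 / 2"]] by simp
    have "Gamma (1 / 2 - \<i> * of_real \<eta>) * v \<eta> = g \<eta>" for \<eta>
      unfolding v_def using Gamma_line_cancel[of "1 / 2" \<eta> "g \<eta>"] by simp
    then have "(\<lambda>s. cnj (mellin_D v s)) \<star> mellin_D v = mellin_Z (\<lambda>\<zeta>. r \<zeta> * corr g \<zeta>)"
      using laplace_conv_mellin[OF v] by (simp only: r_def mult.assoc)
    then have "b (\<lambda>\<zeta>. r \<zeta> * corr g \<zeta>) \<in> \<real>\<^sub>\<ge>\<^sub>0"
      using pos mellin_D_in_D[OF v] unfolding b_def by metis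
    then show "T (corr g) \<in> \<real>\<^sub>\<ge>\<^sub>0" unfolding T_def by (simp add: complex_nonneg_Reals_iff)
  qed
  obtain M c m where M: "real_distribution M" "0 \<le> c"
    "\<And>u. u \<in> test_funs \<Longrightarrow> T u = of_real c * (LINT x|M. of_real ((1 + x\<^sup>2) ^ m) * fourier u x)"
    using bochner_schwartz by blast
  have "h (mellin_Z u) = of_real (c * sqrt (2 * pi)) *
     (LINT x|M. LINT y|lborel. of_real (weight m x * gumbel (y - x)) * cnj (fourier u y))"
    if u: "u \<in> test_funs" for u
  proof -
    \<comment> \<open>The inverse of multiplication by \<open>r\<close>, so that \<open>T u'\<close>
      is the conjugate of \<open>h (mellin_Z u)\<close>.\<close>
    define u' where "u' \<zeta> = of_real (sqrt (2 * pi)) * (Gamma (1 - \<i> * of_real \<zeta>) * u \<zeta>)" for \<zeta>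
    have u': "u' \<in> test_funs"
      unfolding u'_def[abs_def] using test_funs_cmult[OF test_funs_mult'[OF u Gamma_line_smooth(1)[of 1]]] by simp
    have "r \<zeta> * u' \<zeta> = u \<zeta>" for \<zeta>
    proof -
      have "r \<zeta> * u' \<zeta> = of_real (1 / sqrt (2 * pi) * sqrt (2 * pi)) * (Gamma (1 - \<i> * of_real \<zeta>) * (rGamma (1 - \<i> * of_real \<zeta>) * u \<zeta>))"
        unfolding r_def u'_def by (simp only: of_real_mult mult_ac)
      then show ?thesis using Gamma_line_cancel[of 1 \<zeta> "u \<zeta>"] by simp
    qed
    then have "h (mellin_Z u) = cnj (T u')" unfolding T_def b_def by simp
    also have "\<dots> = of_real c * (LINT x|M. of_real (weight m x) * cnj (fourier u' x))"
      unfolding M(3)[OF u'] complex_cnj_mult cnj_lebesgue_integral weight_def by simp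
    also have "\<dots> = of_real c * (LINT x|M. of_real (sqrt (2 * pi)) *
       (LINT y|lborel. of_real (weight m x * gumbel (y - x)) * cnj (fourier u y)))"
    proof (rule arg_cong[of _ _ "(*) (of_real c)"], rule Bochner_Integration.integral_cong[OF refl])
      fix x
      have "cnj (fourier u' x) = of_real (sqrt (2 * pi)) * (LINT y|lborel. of_real (gumbel (y - x)) * cnj (fourier u y))"
        unfolding u'_def fourier_cmult fourier_Gamma_mult[OF u] complex_cnj_mult cnj_lebesgue_integral by simp
      then have "of_real (weight m x) * cnj (fourier u' x) =
          of_real (sqrt (2 * pi)) * (of_real (weight m x) * (LINT y|lborel. of_real (gumbel (y - x)) * cnj (fourier u y)))"
        by (simp only: mult.left_commute)
      also have "of_real (weight m x) * (LINT y|lborel. of_real (gumbel (y - x)) * cnj (fourier u y)) =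
         (LINT y|lborel. of_real (weight m x) * (of_real (gumbel (y - x)) * cnj (fourier u y)))"
        by (rule integral_mult_right_zero[symmetric])
      finally show "of_real (weight m x) * cnj (fourier u' x) = of_real (sqrt (2 * pi)) *
         (LINT y|lborel. of_real (weight m x * gumbel (y - x)) * cnj (fourier u y))"
        by (simp only: of_real_mult mult.assoc)
    qed
    also have "\<dots> = of_real (c * sqrt (2 * pi)) *
       (LINT x|M. LINT y|lborel. of_real (weight m x * gumbel (y - x)) * cnj (fourier u y))"
      unfolding integral_mult_right_zero by (simp only: of_real_mult mult.assoc)
    finally show ?thesis .
  qed
  then show ?thesis using M(1,2) by (intro exI[of _ M] exI[of _ "c * sqrt (2 * pi)"] exI[of _ m]) auto
qed

section \<open>The measure and its Laplace transform\<close>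

theorem theorem4p7:
  fixes h :: "(real \<Rightarrow> complex) \<Rightarrow> complex"
  assumes "h \<in> Zplus_dual"
    and "real_dist h"
    and "\<forall>f\<in>D. h ((\<lambda>s. cnj (f s)) \<star> f) \<in> \<real>\<^sub>\<ge>\<^sub>0"
  shows "\<exists>m :: real measure.
    space m = {0<..} \<and> sets m = sets (restrict_space borel {0<..}) \<and>
    (\<forall>t>0. integrable m (\<lambda>l. exp (- t * l))) \<and>
    dist_eq_fun h (\<lambda>t. complex_of_real (LINT l|m. exp (- t * l))) \<and>
    (\<exists>\<kappa>::real. (\<integral>\<^sup>+ l. ennreal ((1 + \<bar>ln l\<bar>) powr (- \<kappa>) / l) \<partial>m) < \<infinity>)"
proof -
  obtain M c n where M: "real_distribution M" and c: "0 \<le> c" and hM: "\<And>u. u \<in> test_funs \<Longrightarrow> h (mellin_Z u) =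
    of_real c * (LINT x|M. LINT y|lborel. of_real (weight n x * gumbel (y - x)) * cnj (fourier u y))"
    using representing_distribution[OF assms(1,3)] by blast
  interpret M: real_distribution M by (rule M)
  interpret P: pair_sigma_finite M lborel ..
  \<comment> \<open>The factor \<open>exp (- x)\<close> is \<open>\<lambda>\<close>; together with
    the Jacobian \<open>exp y\<close> of \<open>t = exp y\<close> it completes
    \<open>exp (- t * \<lambda>)\<close> to \<open>gumbel (y - x)\<close>.\<close>
  define d where "d x = c * weight n x * exp (- x)" for x
  have d0: "0 \<le> d x" for x unfolding d_def using c weight_nonneg by simp
  have dm [measurable]: "d \<in> borel_measurable borel" unfolding d_def[abs_def] by measurable
  define m where "m = distr (density M (\<lambda>x. ennreal (d x))) (restrict_space borel {0<..}) (\<lambda>x. exp (- x))"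
  have em: "(\<lambda>x. exp (- x)) \<in> measurable (density M (\<lambda>x. ennreal (d x))) (restrict_space borel {0<..})"
    by (rule measurable_restrict_space2) (auto intro!: borel_measurable_continuous_onI continuous_intros)
  have gm: "(\<lambda>l. f l) \<in> borel_measurable (restrict_space borel {0<..})" if "f \<in> borel_measurable borel" for f :: "real \<Rightarrow> 'b :: topological_space"
    using that by (rule measurable_restrict_space1)
  obtain Cg where Cg: "0 \<le> Cg" "\<And>y. weight n y * gumbel y \<le> Cg"
    using rapid_bound[OF gumbel_rapid, of n] gumbel_pos unfolding weight_def by (auto simp: less_imp_le)
  \<comment> \<open>For fixed \<open>y\<close> the kernel is bounded in \<open>x\<close>, hence
    integrable for the probability measure \<open>M\<close>; this gives convergence of the Laplace
    integral for every \<open>t\<close>.\<close>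
  have kb: "weight n x * gumbel (y - x) \<le> 2 ^ n * weight n y * Cg" for x y
  proof -
    have "weight n x * gumbel (y - x) \<le> 2 ^ n * weight n (y - x) * weight n y * gumbel (y - x)"
      using weight_le gumbel_pos[of "y - x"] by (intro mult_right_mono) auto
    also have "\<dots> = 2 ^ n * weight n y * (weight n (y - x) * gumbel (y - x))" by simp
    also have "\<dots> \<le> 2 ^ n * weight n y * Cg" using weight_nonneg Cg by (intro mult_left_mono) auto
    finally show ?thesis .
  qed
  have shift: "exp y * (d x * exp (- exp y * exp (- x))) = c * (weight n x * gumbel (y - x))" for x y
  proof -
    have "exp y * exp (- x) * exp (- exp y * exp (- x)) = gumbel (y - x)"
      unfolding gumbel_def mult_exp_exp by (simp add: exp_diff exp_minus divide_inverse)
    then have "c * weight n x * (exp y * exp (- x) * exp (- exp y * exp (- x))) = c * weight n x * gumbel (y - x)" by simp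
    then show ?thesis by (simp add: d_def mult_ac)
  qed
  have ki: "integrable M (\<lambda>x. c * (weight n x * gumbel (y - x)))" for y
  proof (rule M.integrable_const_bound[where B = "c * (2 ^ n * weight n y * Cg)"])
    show "AE x in M. norm (c * (weight n x * gumbel (y - x))) \<le> c * (2 ^ n * weight n y * Cg)"
      using kb c weight_nonneg gumbel_pos
      by (intro AE_I2) (auto simp: abs_mult abs_of_nonneg less_imp_le intro!: mult_left_mono)
  qed measurable
  have int: "integrable m (\<lambda>l. exp (- t * l))" if t: "0 < t" for t
  proof -
    have "integrable M (\<lambda>x. d x * exp (- t * exp (- x)))"
    proof -
      have "t * (d x * exp (- t * exp (- x))) = c * (weight n x * gumbel (ln t - x))" for x
        using shift[of "ln t" x] unfolding exp_ln[OF t] .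
      then have "integrable M (\<lambda>x. (1 / t) * (t * (d x * exp (- t * exp (- x)))))"
        using integrable_mult_right[OF ki[of "ln t"], of "1 / t"] by (simp only:)
      then show ?thesis using t by simp
    qed
    then have "integrable (density M (\<lambda>x. ennreal (d x))) (\<lambda>x. exp (- t * exp (- x)))"
      by (subst integrable_density) (use d0 in auto)
    then show ?thesis unfolding m_def
      by (subst integrable_distr_eq[OF em]) (auto intro!: gm)
  qed
  define H where "H t = (LINT l|m. exp (- t * l))" for t
  have H: "H t = (LINT x|M. d x * exp (- t * exp (- x)))" for t
  proof -
    have "H t = (LINT x|density M (\<lambda>x. ennreal (d x)). exp (- t * exp (- x)))"
      unfolding H_def m_def by (rule integral_distr[OF em]) (auto intro!: gm)
    also have "\<dots> = (LINT x|M. d x *\<^sub>R exp (- t * exp (- x)))"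
      by (rule integral_density) (use d0 in auto)
    finally show ?thesis by simp
  qed
  have Hm [measurable]: "H \<in> borel_measurable borel"
    unfolding H[abs_def] by (intro M.borel_measurable_lebesgue_integral) measurable
  have HE: "exp y * H (exp y) = (LINT x|M. c * (weight n x * gumbel (y - x)))" for y
    unfolding H shift[symmetric] by (rule integral_mult_right_zero[symmetric])
  have "set_integrable lborel {0<..} (\<lambda>t. of_real (H t) * cnj (F t)) \<and>
      h F = (LINT t:{0<..}|lborel. of_real (H t) * cnj (F t))" if F: "F \<in> Zplus" for F
  proof -
    obtain u where u: "u \<in> test_funs" "F = mellin_Z u" using Zplus_eq_mellin_Z[OF F] by metis
    define \<phi> where "\<phi> = fourier u"
    have \<phi>m [measurable]: "\<phi> \<in> borel_measurable borel" unfolding \<phi>_def using u(1) by (rule fourier_measurable)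
    have Fm: "F \<in> borel_measurable borel"
      unfolding u(2) mellin_Z_def[abs_def] \<phi>_def[symmetric] by measurable
    obtain C\<phi> where C\<phi>: "0 \<le> C\<phi>" "\<And>y. weight n y * norm (\<phi> y) \<le> C\<phi>"
      using rapid_bound[OF fourier_rapid[OF u(1)], of n] unfolding weight_def \<phi>_def by metis
    have wi: "integrable lborel (\<lambda>y. weight n y * gumbel y)"
    proof -
      obtain K where K: "\<And>y. (1 + y\<^sup>2) ^ Suc n * norm (complex_of_real (gumbel y)) \<le> K"
        using rapid_bound[OF gumbel_rapid, of "Suc n"] by metis
      show ?thesis
      proof (rule integrable_if_decay[where C = K])
        show "(1 + y\<^sup>2) * norm (weight n y * gumbel y) \<le> K" for y
          using K[of y] weight_nonneg[of n y] gumbel_pos[of y] by (simp add: weight_def abs_mult mult.assoc)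
      qed measurable
    qed
    let ?Q = "\<lambda>x y. complex_of_real (c * (weight n x * gumbel (y - x))) * cnj (\<phi> y)"
    \<comment> \<open>The majorant depends on \<open>y - x\<close> only, so its integral over
      \<open>y\<close> is the same for all \<open>x\<close>; since \<open>M\<close> is finite,
      Fubini's theorem applies.\<close>
    let ?B = "\<lambda>x y. c * (2 ^ n * C\<phi>) * (weight n (y - x) * gumbel (y - x))"
    have Qle: "norm (?Q x y) \<le> ?B x y" for x y
    proof -
      have "norm (?Q x y) = c * (weight n x * gumbel (y - x)) * norm (\<phi> y)"
        using c weight_nonneg[of n x] gumbel_pos[of "y - x"] by (simp add: norm_mult abs_of_nonneg)
      also have "\<dots> \<le> c * ((2 ^ n * weight n (y - x) * weight n y) * gumbel (y - x)) * norm (\<phi> y)"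
        using c gumbel_pos[of "y - x"] by (intro mult_right_mono mult_left_mono weight_le) auto
      also have "\<dots> = c * 2 ^ n * (weight n (y - x) * gumbel (y - x)) * (weight n y * norm (\<phi> y))" by simp
      also have "\<dots> \<le> c * 2 ^ n * (weight n (y - x) * gumbel (y - x)) * C\<phi>"
        using c weight_nonneg[of n "y - x"] gumbel_pos[of "y - x"] by (intro mult_left_mono C\<phi>) auto
      finally show ?thesis by (simp add: mult_ac)
    qed
    have Bi: "integrable lborel (\<lambda>y. ?B x y)" for x
      using integrable_shift[OF wi, of "- x"] by (intro integrable_mult_right) simp
    have Qm: "(\<lambda>(x, y). ?Q x y) \<in> borel_measurable (M \<Otimes>\<^sub>M lborel)" by measurable
    have Qi: "integrable lborel (\<lambda>y. ?Q x y)" for x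
    proof (rule Bochner_Integration.integrable_bound[OF Bi[of x]])
      show "AE y in lborel. norm (?Q x y) \<le> norm (?B x y)" using Qle by (intro AE_I2) (metis abs_ge_self order_trans real_norm_def)
    qed measurable
    have pi: "integrable (M \<Otimes>\<^sub>M lborel) (\<lambda>(x, y). ?Q x y)"
    proof (rule P.Fubini_integrable[OF Qm])
      show "AE x in M. integrable lborel (\<lambda>y. case (x, y) of (x, y) \<Rightarrow> ?Q x y)" using Qi by simp
      show "integrable M (\<lambda>x. LINT y|lborel. norm (case (x, y) of (x, y) \<Rightarrow> ?Q x y))"
      proof (rule M.integrable_const_bound[where B = "c * (2 ^ n * C\<phi>) * (LINT y|lborel. weight n y * gumbel y)"])
        show "AE x in M. norm (LINT y|lborel. norm (case (x, y) of (x, y) \<Rightarrow> ?Q x y))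
           \<le> c * (2 ^ n * C\<phi>) * (LINT y|lborel. weight n y * gumbel y)"
        proof (rule AE_I2)
          fix x
          have "norm (LINT y|lborel. norm (?Q x y)) \<le> (LINT y|lborel. ?B x y)"
            by (rule norm_lebesgue_integral_le[OF Bi]) (use Qle in simp)
          also have "\<dots> = c * (2 ^ n * C\<phi>) * (LINT y|lborel. weight n (y + - x) * gumbel (y + - x))"
            by (simp only: integral_mult_right_zero diff_conv_add_uminus)
          also have "(LINT y|lborel. weight n (y + - x) * gumbel (y + - x)) = (LINT y|lborel. weight n y * gumbel y)"
            by (rule integral_shift)
          finally show "norm (LINT y|lborel. norm (case (x, y) of (x, y) \<Rightarrow> ?Q x y))
             \<le> c * (2 ^ n * C\<phi>) * (LINT y|lborel. weight n y * gumbel y)" by simp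
        qed
        have "(\<lambda>(x, y). norm (?Q x y)) \<in> borel_measurable (M \<Otimes>\<^sub>M lborel)" by measurable
        then show "(\<lambda>x. LINT y|lborel. norm (case (x, y) of (x, y) \<Rightarrow> ?Q x y)) \<in> borel_measurable M"
          by (simp add: lborel.borel_measurable_lebesgue_integral)
      qed
    qed
    let ?f = "\<lambda>t. complex_of_real (H t) * cnj (F t)"
    have fm: "?f \<in> borel_measurable borel"
      by (intro borel_measurable_times measurable_compose[OF Fm borel_measurable_continuous_onI]
        measurable_compose[OF Hm borel_measurable_continuous_onI]) (auto intro!: continuous_intros)
    have fe: "\<bar>exp y\<bar> *\<^sub>R ?f (exp y) = (LINT x|M. ?Q x y)" for y
    proof -
      have "\<bar>exp y\<bar> *\<^sub>R ?f (exp y) = of_real (exp y * H (exp y)) * cnj (\<phi> y)"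
        unfolding u(2) mellin_Z_exp \<phi>_def scaleR_conv_of_real abs_exp_cancel by (simp only: of_real_mult mult.assoc)
      also have "\<dots> = (LINT x|M. of_real (c * (weight n x * gumbel (y - x)))) * cnj (\<phi> y)"
        unfolding HE integral_complex_of_real ..
      also have "\<dots> = (LINT x|M. ?Q x y)" by (rule integral_mult_left_zero[symmetric])
      finally show ?thesis .
    qed
    note cv = lborel_change_variables[of exp exp "{0<..}" ?f, OF DERIV_exp _ range_exp_real _ fm, unfolded fe]
    have "integrable lborel (\<lambda>y. LINT x|M. ?Q x y)" using P.integrable_snd[OF pi] by simp
    then have si: "set_integrable lborel {0<..} ?f" using cv(1) by (auto simp: inj_def)
    have "h F = of_real c * (LINT x|M. LINT y|lborel. of_real (weight n x * gumbel (y - x)) * cnj (\<phi> y))"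
      unfolding u(2) \<phi>_def by (rule hM[OF u(1)])
    also have "\<dots> = (LINT x|M. LINT y|lborel. ?Q x y)"
      unfolding integral_mult_right_zero[symmetric] by (simp only: of_real_mult mult.assoc)
    also have "\<dots> = (LINT y|lborel. LINT x|M. ?Q x y)" using P.Fubini_integral[OF pi] by simp
    also have "\<dots> = (LINT t:{0<..}|lborel. ?f t)" using cv(2) by (auto simp: inj_def)
    finally show ?thesis using si by simp
  qed
  then have rep: "dist_eq_fun h (\<lambda>t. of_real (LINT l|m. exp (- t * l)))"
    unfolding dist_eq_fun_def H_def by blast
  \<comment> \<open>The exponent is \<open>\<kappa> = 2 * n\<close>: with
    \<open>\<lambda> = exp (- x)\<close> the factor \<open>1 / \<lambda>\<close> cancels
    \<open>exp (- x)\<close> in \<open>d\<close>, and \<open>weight n x\<close> is at most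
    \<open>(1 + \<bar>x\<bar>) ^ (2 * n)\<close>. The integral is then at most \<open>c\<close>
    because \<open>M\<close> is a probability measure.\<close>
  have "(\<integral>\<^sup>+ l. ennreal ((1 + \<bar>ln l\<bar>) powr (- real (2 * n)) / l) \<partial>m) \<le> ennreal c"
  proof -
    have "(\<integral>\<^sup>+ l. ennreal ((1 + \<bar>ln l\<bar>) powr (- real (2 * n)) / l) \<partial>m) =
       (\<integral>\<^sup>+ x. ennreal ((1 + \<bar>ln (exp (- x))\<bar>) powr (- real (2 * n)) / exp (- x)) \<partial>density M (\<lambda>x. ennreal (d x)))"
      unfolding m_def by (rule nn_integral_distr[OF em]) (simp only: measurable_distr_eq1, rule gm, measurable)
    also have "\<dots> = (\<integral>\<^sup>+ x. ennreal (d x) * ennreal ((1 + \<bar>ln (exp (- x))\<bar>) powr (- real (2 * n)) / exp (- x)) \<partial>M)"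
      by (rule nn_integral_density) measurable
    also have "\<dots> \<le> (\<integral>\<^sup>+ x. ennreal c \<partial>M)"
    proof (rule nn_integral_mono)
      fix x :: real
      have p: "0 < (1 + \<bar>x\<bar>) ^ (2 * n)" by (intro zero_less_power) auto
      have "(1 + \<bar>x\<bar>) powr (- real (2 * n)) = 1 / (1 + \<bar>x\<bar>) ^ (2 * n)"
        by (subst powr_minus_divide, subst powr_realpow) auto
      then have "d x * ((1 + \<bar>ln (exp (- x))\<bar>) powr (- real (2 * n)) / exp (- x)) = c * (weight n x / (1 + \<bar>x\<bar>) ^ (2 * n))"
        unfolding d_def by simp
      also have "\<dots> \<le> c * 1"
        using c p one_plus_square_power_le[of x n] unfolding weight_def by (intro mult_left_mono) (auto simp: pos_divide_le_eq)
      finally show "ennreal (d x) * ennreal ((1 + \<bar>ln (exp (- x))\<bar>) powr (- real (2 * n)) / exp (- x)) \<le> ennreal c"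
        using d0[of x] by (subst ennreal_mult[symmetric]) (auto intro: ennreal_leI)
    qed
    also have "\<dots> = ennreal c" by (simp only: nn_integral_const M.emeasure_space_1 mult_1_right)
    finally show ?thesis .
  qed
  then have "(\<integral>\<^sup>+ l. ennreal ((1 + \<bar>ln l\<bar>) powr (- real (2 * n)) / l) \<partial>m) < \<infinity>"
    by (rule order_le_less_trans) simp
  moreover have "space m = {0<..}" "sets m = sets (restrict_space borel {0<..})"
    by (simp_all add: m_def space_restrict_space)
  ultimately show ?thesis using int rep by (intro exI[of _ m]) blast
qed

end
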